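(* Let $X=(X_t)_{t\ge0}$ be a Lévy process in $\mathbb R^d$ with Lévy triplet $(\ell,Q,\nu)$ and characteristic exponent $\psi$. a) If $Q=0$, $\kappa\in(0,1]$, $\lambda>0$ and $\int_{|y|\ge1}e^{\lambda|y|^\kappa}\,\nu(dy)<\infty$, then there is a constant $C_{\kappa,\lambda}>0$ such that $$\mathbb E\,e^{\lambda|X_t|^\kappa}\le\begin{cases}e^{C_{\kappa,\lambda}\,t^{\kappa/2}},&\text{if } t<1,\\ e^{C_{\kappa,\lambda}\,t},&\text{if } t\ge1.\end{cases}$$ b) If $Q=0$, $\kappa\in(0,1]$, $\lambda>0$, $\int_{|y|\ge1}e^{\lambda|y|^\kappa}\,\nu(dy)<\infty$ and $\int_{0<|y|<1}|y|^\kappa\,\nu(dy)<\infty$, then for any $t>0$ $$\mathbb E\,e^{\lambda|X_t|^\kappa}\le\exp\big[\lambda|\hat\ell|^\kappa t^\kappa+M_{\kappa,\lambda}\,t\big],$$ where $$\hat\ell:=\ell-\int_{0<|y|<1}y\,\nu(dy),\qquad M_{\kappa,\lambda}:=\int_{y\ne0}\big(e^{\lambda|y|^\kappa}-1\big)\,\nu(dy).$$ c) If $\nu\ne0$ and $\kappa>1$, then $\mathbb E\,e^{\lambda|X_t|^\kappa}=\infty$ for any $\lambda,t>0$. d) If $\psi$ is real-valued, then $\mathbb E\,e^{\lambda|X_t|^{-\kappa}}=\infty$ for any $\lambda,t,\kappa>0$.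
   Context: A Lévy process $X=(X_t)_{t\ge0}$ in $\mathbb R^d$ has stationary independent increments, càdlàg paths and $X_0=0$. Its characteristic exponent $\psi:\mathbb R^d\to\mathbb C$ is defined by $\mathbb E e^{i\xi\cdot X_t}=e^{-t\psi(\xi)}$ and has the form $$\psi(\xi)=-i\ell\cdot\xi+\tfrac12\xi\cdot Q\xi+\int_{y\ne0}\big(1-e^{i\xi\cdot y}+i\xi\cdot y\,\mathbf 1_{(0,1)}(|y|)\big)\,\nu(dy),$$ where $\ell\in\mathbb R^d$, $Q$ is a non-negative semidefinite $d\times d$ matrix and $\nu$ is a measure on $\mathbb R^d\setminus\{0\}$ with $\int_{y\ne0}(1\wedge|y|^2)\,\nu(dy)<\infty$. The constant $C_{\kappa,\lambda}$ depends on $\kappa$, $\lambda$ and on the law of the process $X$ (its triplet), but not on $t$. Convention: $\frac10:=\infty$ (and $e^{\infty}=\infty$). *)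

theory Defs
  imports "HOL-Probability.Probability"
begin

locale levy_process = prob_space M for M :: "'w measure" +
  fixes X :: "real \<Rightarrow> 'w \<Rightarrow> real ^ 'd"
  assumes random_variable: "\<And>t. 0 \<le> t \<Longrightarrow> random_variable borel (X t)"
    and start_zero: "\<And>\<omega>. \<omega> \<in> space M \<Longrightarrow> X 0 \<omega> = 0"
    and stationary_increments:
      "\<And>s t. 0 \<le> s \<Longrightarrow> 0 \<le> t \<Longrightarrow>
         distr M borel (\<lambda>\<omega>. X (s + t) \<omega> - X s \<omega>) = distr M borel (X t)"
    and independent_increments:
      "\<And>n (\<tau> :: nat \<Rightarrow> real). 0 \<le> \<tau> 0 \<Longrightarrow> mono_on {..n} \<tau> \<Longrightarrow>
         indep_vars (\<lambda>_. borel) (\<lambda>i \<omega>. X (\<tau> (Suc i)) \<omega> - X (\<tau> i) \<omega>) {..<n}"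
    and right_continuous_paths:
      "\<And>\<omega> t. \<omega> \<in> space M \<Longrightarrow> 0 \<le> t \<Longrightarrow> continuous (at_right t) (\<lambda>s. X s \<omega>)"
    and left_limits:
      "\<And>\<omega> t. \<omega> \<in> space M \<Longrightarrow> 0 < t \<Longrightarrow> \<exists>x. ((\<lambda>s. X s \<omega>) \<longlongrightarrow> x) (at_left t)"

text \<open>The equation for all \<open>t \<ge> 0\<close> determines \<open>\<psi>\<close> uniquely, although the one for a single
  \<open>t\<close> does not (the complex exponential is periodic).\<close>

definition is_characteristic_exponent ::
    "'w measure \<Rightarrow> (real \<Rightarrow> 'w \<Rightarrow> real ^ 'd) \<Rightarrow> (real ^ 'd \<Rightarrow> complex) \<Rightarrow> bool" where
  "is_characteristic_exponent M X \<psi> \<longleftrightarrow>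
     (\<forall>t\<ge>0. \<forall>\<xi>. (CLINT \<omega>|M. iexp (\<xi> \<bullet> X t \<omega>)) = exp (- complex_of_real t * \<psi> \<xi>))"

text \<open>A measure on \<open>\<real>\<^sup>d - {0}\<close> is represented by a Borel measure on \<open>\<real>\<^sup>d\<close> without
  mass at the origin.\<close>

definition is_levy_measure :: "(real ^ 'd) measure \<Rightarrow> bool" where
  "is_levy_measure \<nu> \<longleftrightarrow>
     sets \<nu> = sets borel \<and> emeasure \<nu> {0} = 0 \<and>
     (\<integral>\<^sup>+y\<in>{y. y \<noteq> 0}. ennreal (min 1 ((norm y)\<^sup>2)) \<partial>\<nu>) < \<infinity>"

definition is_levy_triplet ::
    "real ^ 'd \<Rightarrow> real ^ 'd ^ 'd \<Rightarrow> (real ^ 'd) measure \<Rightarrow> bool" where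
  "is_levy_triplet l Q \<nu> \<longleftrightarrow>
     transpose Q = Q \<and> (\<forall>x. 0 \<le> x \<bullet> (Q *v x)) \<and> is_levy_measure \<nu>"

definition levy_khintchine ::
    "real ^ 'd \<Rightarrow> real ^ 'd ^ 'd \<Rightarrow> (real ^ 'd) measure \<Rightarrow> real ^ 'd \<Rightarrow> complex" where
  "levy_khintchine l Q \<nu> \<xi> =
     - \<i> * complex_of_real (l \<bullet> \<xi>) + complex_of_real (1 / 2 * (\<xi> \<bullet> (Q *v \<xi>))) +
     (CLINT y:{y. y \<noteq> 0}|\<nu>.
        1 - iexp (\<xi> \<bullet> y) + \<i> * complex_of_real (\<xi> \<bullet> y * indicator {0<..<1} (norm y)))"

end

(* The law of X_t enters parts a), b), d) only through its characteristic function exp (- t psi).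

   For a), b) the law is approximated, in the sense of characteristic functions, by a drift plus
   many independent rare jumps: the N-fold convolution of
   (1 - t |nu_n| / N) delta_0 + (t / N) nu_n, where nu_n is nu off a small ball. The weight
   g x = exp (lam |x|^kappa) is submultiplicative because kappa <= 1, so its integral against
   such a convolution is at most exp (t * integral of (g - 1) d nu_n). Gaussian smoothing turns
   convergence of characteristic functions into convergence of densities; Fatou's lemma and,
   again, submultiplicativity carry the bound over to the limit. In a) the compensated small
   jumps are controlled by exponential moments of the coordinates, of order exp (O(t)), and
   |y|^kappa <= t^(kappa/2) (1 + |y|^2 / t).

   For c), n E (1 - cos (xi . X_(t/n)))^2 tends to t times the integral of (1 - cos (xi . y))^2
   d nu, in which the Gaussian part cancels. Hence P (|xi . X_(t/n)| >= c) >= q / n, and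
   independence of the n increments gives P (|X_t| >= r n) >= (q / 2n)^n, which
   exp (lam (r n)^kappa) outgrows.

   For d), a positive characteristic function phi makes
   E exp (- s^2 |X|^2 / 2) = E phi (s Z), with Z standard Gaussian, at least of order s^(-d),
   whereas the finiteness of the moment would make it O(s^(-d-1)). *)

theory Submission
  imports Defs "HOL-Real_Asymp.Real_Asymp"
begin

section \<open>Gaussian densities and characteristic functions\<close>

text \<open>Only an upper bound has to survive the limit. Comparing both laws after adding the same
  Gaussian noise s Z therefore avoids tightness and weak convergence: the noise costs factors that
  tend to 1 as s tends to 0.

  The obstacle in a) is the compensating drift. Since |y| need not be nu-integrable near 0, the
  drift of the truncated process may diverge, and its weight with it. Under exp (y . w) the drift
  cancels exactly against the first-order term of the jump integral, so linear exponentials are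
  estimated first and the weight is recovered from them through hyperbolic cosines. The power
  t^(kappa/2) reflects the size sqrt t of the compensated part.

  In c) a tail of order 1/n is needed, but 1 - Re E exp (i xi . X_(t/n)) has that order for a
  Gaussian process too; a quantity of fourth order in xi . X tells the two apart. The condition
  kappa > 1 decides n^kappa against n ln n.

  In d) the dimension enters as the volume of a ball whose radius is of order 1/s.\<close>

definition gauss :: "'a::euclidean_space \<Rightarrow> real" where
  "gauss x = (\<Prod>b\<in>Basis. std_normal_density (x \<bullet> b))"

lemma gauss_pos: "0 < gauss x"
  unfolding gauss_def by (intro prod_pos) (simp add: normal_density_pos)

lemma gauss_nonneg [simp]: "0 \<le> gauss x"
  using gauss_pos[of x] by simp

lemma borel_measurable_gauss [measurable]: "gauss \<in> borel_measurable borel"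
  unfolding gauss_def[abs_def] by measurable

text \<open>The product in the definition suits the Fourier transform, which factorises over the
  coordinates; estimates use this radial form.\<close>

lemma gauss_eq:
  fixes x :: "'a::euclidean_space"
  shows "gauss x = (1 / sqrt (2 * pi)) ^ DIM('a) * exp (- (norm x)\<^sup>2 / 2)"
proof -
  have "(norm x)\<^sup>2 = (\<Sum>b\<in>Basis. (x \<bullet> b)\<^sup>2)"
    by (subst power2_norm_eq_inner, subst euclidean_inner) (simp add: power2_eq_square)
  then show ?thesis
    unfolding gauss_def std_normal_density_def
    by (simp add: prod.distrib prod_dividef power_one_over exp_sum[symmetric] sum_negf[symmetric] sum_divide_distrib)
qed

lemma integrable_std_normal_iexp:
  "integrable lborel (\<lambda>x. complex_of_real (std_normal_density x) * iexp (t * x))"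
proof -
  have "integrable lborel std_normal_density" by simp
  then show ?thesis
    by (rule Bochner_Integration.integrable_bound) (auto simp: norm_mult)
qed

lemma integral_std_normal_iexp:
  "(CLINT x|lborel. std_normal_density x * iexp (t * x)) = complex_of_real (exp (- t\<^sup>2 / 2))"
proof -
  have "char std_normal_distribution t = complex_of_real (exp (- t\<^sup>2 / 2))"
    by (simp add: char_std_normal_distribution)
  then show ?thesis
    unfolding char_def by (subst (asm) integral_density) (auto simp: scaleR_conv_of_real)
qed

lemma iexp_inner_eq_prod:
  "iexp (w \<bullet> x) = (\<Prod>b\<in>Basis. iexp ((w \<bullet> b) * (x \<bullet> b)))"
  by (subst euclidean_inner) (simp add: exp_sum[symmetric] sum_distrib_left)

text \<open>\<open>lborel\<close> is the image of a product of one-dimensional Lebesgue measures and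
  the integrand is a product over \<open>Basis\<close>, so each coordinate contributes the
  characteristic function of the standard normal law.\<close>

lemma gauss_fourier:
  fixes w :: "'a::euclidean_space"
  shows "integrable lborel (\<lambda>x. complex_of_real (gauss x) * iexp (w \<bullet> x))"
    and "(CLINT x|lborel. gauss x * iexp (w \<bullet> x)) = complex_of_real (exp (- (norm w)\<^sup>2 / 2))"
proof -
  define f where "f b y = complex_of_real (std_normal_density y) * iexp ((w \<bullet> b) * y)" for b y
  have eq: "complex_of_real (gauss x) * iexp (w \<bullet> x) = (\<Prod>b\<in>Basis. f b (x \<bullet> b))" for x
    unfolding iexp_inner_eq_prod gauss_def f_def by (simp add: prod.distrib)
  interpret product_sigma_finite "\<lambda>_. lborel :: real measure" ..
  have int: "integrable lborel (f b)" for b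
    unfolding f_def by (rule integrable_std_normal_iexp)
  have fm [measurable]: "f b \<in> borel_measurable borel" for b
    unfolding f_def by measurable
  have eq2: "(\<Prod>b\<in>Basis. f b ((\<Sum>i\<in>Basis. y i *\<^sub>R i) \<bullet> b)) = (\<Prod>b\<in>Basis. f b (y b))"
    for y :: "'a \<Rightarrow> real"
    by (intro prod.cong) auto
  show "integrable lborel (\<lambda>x. complex_of_real (gauss x) * iexp (w \<bullet> x))"
    unfolding eq
    apply (subst lborel_eq)
    apply (subst integrable_distr_eq)
      apply measurable
    unfolding eq2
    by (intro product_integrable_prod int) auto
  have "(CLINT x|lborel. gauss x * iexp (w \<bullet> x)) = (\<Prod>b\<in>Basis. integral\<^sup>L lborel (f b))"
    unfolding eq
    apply (subst lborel_eq)
    apply (subst integral_distr)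
      apply measurable
    unfolding eq2
    by (intro product_integral_prod int) auto
  also have "\<dots> = (\<Prod>b\<in>(Basis::'a set). complex_of_real (exp (- (w \<bullet> b)\<^sup>2 / 2)))"
    unfolding f_def integral_std_normal_iexp by simp
  also have "\<dots> = complex_of_real (exp (- (norm w)\<^sup>2 / 2))"
    unfolding power2_norm_eq_inner
    by (subst euclidean_inner)
      (simp add: exp_sum[symmetric] sum_negf[symmetric] sum_divide_distrib power2_eq_square flip: of_real_prod)
  finally show "(CLINT x|lborel. gauss x * iexp (w \<bullet> x)) = complex_of_real (exp (- (norm w)\<^sup>2 / 2))" .
qed

lemma integrable_gauss: "integrable lborel (gauss :: 'a::euclidean_space \<Rightarrow> real)"
  using integrable_norm[OF gauss_fourier(1)[of "0::'a"]] by (simp add: norm_mult)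

lemma integral_gauss: "(LINT x|lborel. gauss (x::'a::euclidean_space)) = 1"
  using gauss_fourier(2)[of "0::'a"] by (simp flip: of_real_eq_iff)

lemma nn_integral_gauss: "(\<integral>\<^sup>+x. ennreal (gauss (x::'a::euclidean_space)) \<partial>lborel) = 1"
  by (subst nn_integral_eq_integral) (simp_all add: integrable_gauss integral_gauss)

lemma integrable_gauss_times:
  fixes f :: "'a::euclidean_space \<Rightarrow> complex"
  assumes [measurable]: "f \<in> borel_measurable borel" and "\<And>x. norm (f x) \<le> 1"
  shows "integrable lborel (\<lambda>w. gauss w * f w)"
  using integrable_gauss
  by (rule Bochner_Integration.integrable_bound)
    (auto simp: norm_mult mult_left_le assms(2))

lemma nn_integral_lborel_affine:
  fixes t :: "'a::euclidean_space"
  assumes [measurable]: "f \<in> borel_measurable borel" and c: "c \<noteq> 0"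
  shows "(\<integral>\<^sup>+x. f x \<partial>lborel) = ennreal (\<bar>c\<bar> ^ DIM('a)) * (\<integral>\<^sup>+x. f (t + c *\<^sub>R x) \<partial>lborel)"
  by (subst lborel_affine[OF c, of t])
    (simp add: nn_integral_density nn_integral_distr nn_integral_cmult)

section \<open>Characteristic functions of Borel probability measures\<close>

definition charfn :: "'a::euclidean_space measure \<Rightarrow> 'a \<Rightarrow> complex" where
  "charfn \<mu> \<xi> = (CLINT x|\<mu>. iexp (\<xi> \<bullet> x))"

locale borel_prob = prob_space \<mu> for \<mu> :: "'a::euclidean_space measure" +
  assumes sets_eq [measurable_cong, simp]: "sets \<mu> = sets borel"
begin

lemma norm_charfn_le_1: "norm (charfn \<mu> \<xi>) \<le> 1"
proof -
  have "norm (charfn \<mu> \<xi>) \<le> (LINT x|\<mu>. norm (iexp (\<xi> \<bullet> x)))"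
    unfolding charfn_def by (rule integral_norm_bound)
  then show ?thesis by (simp add: prob_space)
qed

lemma charfn_measurable [measurable]: "charfn \<mu> \<in> borel_measurable borel"
  unfolding charfn_def[abs_def] by measurable

text \<open>The Gaussian is, up to scaling, its own Fourier transform; Fubini then moves the transform to \<^term>\<open>\<mu>\<close>.\<close>

lemma gauss_smoothing:
  fixes a :: 'a
  shows "complex_of_real (LINT x|\<mu>. exp (- (norm (c *\<^sub>R (a - x)))\<^sup>2 / 2)) =
    (CLINT w|lborel. gauss w * (iexp (c * (w \<bullet> a)) * charfn \<mu> (- c *\<^sub>R w)))"
proof -
  interpret P: pair_sigma_finite \<mu> "lborel :: 'a measure" ..
  let ?f = "\<lambda>x w. complex_of_real (gauss w) * iexp ((c *\<^sub>R (a - x)) \<bullet> w)"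
  have int: "integrable (\<mu> \<Otimes>\<^sub>M lborel) (\<lambda>(x, w). ?f x w)"
  proof (rule P.Fubini_integrable)
    show "AE x in \<mu>. integrable lborel (\<lambda>w. case (x, w) of (x, w) \<Rightarrow> ?f x w)"
      unfolding prod.case by (intro AE_I2 gauss_fourier(1))
  qed (simp_all add: norm_mult integral_gauss)
  have "complex_of_real (LINT x|\<mu>. exp (- (norm (c *\<^sub>R (a - x)))\<^sup>2 / 2)) =
      (CLINT x|\<mu>. exp (- (norm (c *\<^sub>R (a - x)))\<^sup>2 / 2))"
    by simp
  also have "\<dots> = (CLINT x|\<mu>. CLINT w|lborel. ?f x w)"
    unfolding gauss_fourier(2) by simp
  also have "\<dots> = (CLINT w|lborel. CLINT x|\<mu>. ?f x w)"
    using P.Fubini_integral[OF int] by simp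
  also have "\<dots> = (CLINT w|lborel. gauss w * (iexp (c * (w \<bullet> a)) * charfn \<mu> (- c *\<^sub>R w)))"
  proof (rule Bochner_Integration.integral_cong[OF refl])
    fix w :: 'a
    have "?f x w = gauss w * (iexp (c * (w \<bullet> a)) * iexp ((- c *\<^sub>R w) \<bullet> x))" for x
      by (simp add: inner_diff_left inner_commute algebra_simps flip: exp_add)
    then show "(CLINT x|\<mu>. ?f x w) = gauss w * (iexp (c * (w \<bullet> a)) * charfn \<mu> (- c *\<^sub>R w))"
      unfolding charfn_def by (simp only: integral_mult_right_zero)
  qed
  finally show ?thesis .
qed

end

section \<open>Gaussian smoothing of subexponential weights\<close>

text \<open>The shares a / s and b / s of the sum add up to 1 and lie in [0, 1], where raising to a
  power of at most 1 can only increase them.\<close>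

lemma powr_add_le_add_powr:
  fixes a b p :: real
  assumes "0 \<le> a" "0 \<le> b" "0 < p" "p \<le> 1"
  shows "(a + b) powr p \<le> a powr p + b powr p"
proof (cases "a + b = 0")
  case True
  then show ?thesis using assms by simp
next
  case False
  define s where "s = a + b"
  have s: "0 < s" using False assms by (simp add: s_def)
  have *: "c / s * s powr p \<le> c powr p" if "0 \<le> c" "c \<le> s" for c
  proof -
    have "c / s \<le> (c / s) powr p"
      using powr_mono'[of p 1 "c / s"] that s assms by simp
    then have "c / s * s powr p \<le> (c / s) powr p * s powr p"
      by (intro mult_right_mono) auto
    also have "\<dots> = c powr p"
      using that s by (simp add: powr_divide)
    finally show ?thesis .
  qed
  have "(a + b) powr p = (a / s + b / s) * s powr p"
    using s by (simp add: s_def flip: add_divide_distrib)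
  also have "\<dots> \<le> a powr p + b powr p"
    using *[of a] *[of b] assms by (simp add: distrib_right s_def)
  finally show ?thesis .
qed

lemma powr_le_one_plus:
  fixes u p q :: real
  assumes "0 \<le> u" "0 < p" "p \<le> q"
  shows "u powr p \<le> 1 + u powr q"
proof (cases "u \<le> 1")
  case True
  then have "u powr p \<le> 1" using assms by (intro powr_le1) auto
  then show ?thesis by (smt (verit) powr_ge_zero)
next
  case False
  then have "u powr p \<le> u powr q" using assms by (intro powr_mono) auto
  then show ?thesis by linarith
qed

section \<open>The weight exp (lam |x|^kappa)\<close>

definition powexp :: "real \<Rightarrow> real \<Rightarrow> 'a::real_normed_vector \<Rightarrow> real" where
  "powexp lam \<kappa> x = exp (lam * norm x powr \<kappa>)"

lemma powexp_pos [simp]: "0 < powexp lam \<kappa> x" "0 \<le> powexp lam \<kappa> x"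
  by (simp_all add: powexp_def)

lemma powexp_0 [simp]: "powexp lam \<kappa> 0 = 1"
  by (simp add: powexp_def)

lemma powexp_minus [simp]: "powexp lam \<kappa> (- x) = powexp lam \<kappa> x"
  by (simp add: powexp_def)

lemma borel_measurable_powexp [measurable]:
  "powexp lam \<kappa> \<in> borel_measurable (borel :: 'a::{real_normed_vector, second_countable_topology} measure)"
  unfolding powexp_def[abs_def] by measurable

lemma powexp_add_le:
  assumes "0 < \<kappa>" "\<kappa> \<le> 1" "0 < lam"
  shows "powexp lam \<kappa> (x + y) \<le> powexp lam \<kappa> x * powexp lam \<kappa> y"
proof -
  have "norm (x + y) powr \<kappa> \<le> (norm x + norm y) powr \<kappa>"
    using assms by (intro powr_mono2) (auto intro: norm_triangle_ineq)
  also have "\<dots> \<le> norm x powr \<kappa> + norm y powr \<kappa>"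
    using assms by (intro powr_add_le_add_powr) auto
  finally show ?thesis
    using assms by (simp add: powexp_def flip: exp_add distrib_left)
qed

lemma powexp_le_exp:
  assumes "0 < \<kappa>" "\<kappa> \<le> 1" "0 < lam"
  shows "powexp lam \<kappa> x \<le> exp (lam * (1 + norm x))"
  using powr_le_one_plus[of "norm x" \<kappa> 1] assms by (simp add: powexp_def)

text \<open>Completing the square absorbs c |z| into c^2 and 3/8 of |z|^2; what remains is exp (-
  |z|^2 / 8), a Gaussian of standard deviation 2.\<close>

lemma nn_integral_gauss_exp_finite:
  "(\<integral>\<^sup>+z. ennreal (gauss (z::'a::euclidean_space) * exp (c * (1 + norm z))) \<partial>lborel) < \<infinity>"
proof -
  have *: "ennreal (gauss z * exp (c * (1 + norm z))) \<le> ennreal (exp (c + c\<^sup>2)) * ennreal (gauss (0 + (1 / 2) *\<^sub>R z))"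
    for z :: 'a
  proof -
    have "0 \<le> (c - norm z / 2)\<^sup>2" by simp
    then have "c * norm z \<le> c\<^sup>2 + (norm z)\<^sup>2 / 4"
      by (simp add: power2_eq_square algebra_simps)
    then have "c * norm z \<le> c\<^sup>2 + 3 * (norm z)\<^sup>2 / 8"
      using zero_le_power2[of "norm z"] by linarith
    then have "c * (1 + norm z) - (norm z)\<^sup>2 / 2 \<le> c + c\<^sup>2 - (norm z)\<^sup>2 / 8"
      by (simp add: algebra_simps)
    then have "exp (- (norm z)\<^sup>2 / 2) * exp (c * (1 + norm z)) \<le> exp (c + c\<^sup>2) * exp (- (norm z)\<^sup>2 / 8)"
      by (simp flip: exp_add)
    then have "gauss z * exp (c * (1 + norm z)) \<le> exp (c + c\<^sup>2) * gauss ((1/2) *\<^sub>R z)"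
      unfolding gauss_eq
      using mult_left_mono[of "exp (- (norm z)\<^sup>2 / 2) * exp (c * (1 + norm z))" "exp (c + c\<^sup>2) * exp (- (norm z)\<^sup>2 / 8)"
         "(1 / sqrt (2 * pi)) ^ DIM('a)"]
      by (simp add: power_divide mult.assoc mult.left_commute)
    then show ?thesis by (simp flip: ennreal_mult)
  qed
  have "(\<integral>\<^sup>+z. ennreal (gauss (z::'a) * exp (c * (1 + norm z))) \<partial>lborel) \<le>
      (\<integral>\<^sup>+z. ennreal (exp (c + c\<^sup>2)) * ennreal (gauss (0 + (1 / 2) *\<^sub>R (z::'a))) \<partial>lborel)"
    by (intro nn_integral_mono *)
  also have "\<dots> < \<infinity>"
  proof -
    \<comment> \<open>The substitution writes the total mass 1 as a positive multiple of the
      integral in question, which is therefore finite.\<close>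
    have "(1::ennreal) = ennreal (\<bar>1 / 2\<bar> ^ DIM('a)) * (\<integral>\<^sup>+x. ennreal (gauss (0 + (1 / 2) *\<^sub>R (x::'a))) \<partial>lborel)"
      by (subst nn_integral_lborel_affine[symmetric]) (simp_all add: nn_integral_gauss)
    then have "ennreal (\<bar>1 / 2\<bar> ^ DIM('a)) * (\<integral>\<^sup>+x. ennreal (gauss (0 + (1 / 2) *\<^sub>R (x::'a))) \<partial>lborel) \<noteq> \<infinity>"
      by (metis ennreal_one_neq_top infinity_ennreal_def)
    then have "(\<integral>\<^sup>+x. ennreal (gauss (0 + (1 / 2) *\<^sub>R (x::'a))) \<partial>lborel) < \<infinity>"
      by (auto simp: ennreal_mult_eq_top_iff less_top)
    then show ?thesis
      by (subst nn_integral_cmult) (auto simp: ennreal_mult_less_top)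
  qed
  finally show ?thesis .
qed

lemma gauss_le: "gauss (x::'a::euclidean_space) \<le> (1 / sqrt (2 * pi)) ^ DIM('a)"
  unfolding gauss_eq by (simp add: mult_left_le)

section \<open>Densities after adding Gaussian noise\<close>

context borel_prob
begin

text \<open>This is \<open>s ^ DIM('a)\<close> times the density at \<open>a\<close> of x + s z,
  where x has law \<open>\<mu>\<close> and z is an independent standard Gaussian; the factor
  reappears in \<open>nn_integral_smooth\<close>.\<close>

definition smooth_density :: "real \<Rightarrow> 'a \<Rightarrow> real" where
  "smooth_density s a = (LINT x|\<mu>. gauss ((1 / s) *\<^sub>R (a - x)))"

lemma nn_smooth_density: "(\<integral>\<^sup>+x. ennreal (gauss ((1 / s) *\<^sub>R (a - x))) \<partial>\<mu>) = ennreal (smooth_density s a)"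
  unfolding smooth_density_def
  by (intro nn_integral_eq_integral integrable_const_bound[of _ "(1 / sqrt (2 * pi)) ^ DIM('a)"])
    (auto simp: gauss_le)

lemma smooth_density_nonneg [simp]: "0 \<le> smooth_density s a"
  unfolding smooth_density_def by (intro integral_nonneg_AE) auto

lemma smooth_density_measurable [measurable]: "smooth_density s \<in> borel_measurable borel"
  unfolding smooth_density_def[abs_def] by measurable

lemma smooth_density_charfn:
  "smooth_density s a = (1 / sqrt (2 * pi)) ^ DIM('a) *
     Re (CLINT w|lborel. gauss w * (iexp (1 / s * (w \<bullet> a)) * charfn \<mu> (- (1 / s) *\<^sub>R w)))"
proof -
  have "smooth_density s a = (1 / sqrt (2 * pi)) ^ DIM('a) *
      Re (complex_of_real (LINT x|\<mu>. exp (- (norm ((1 / s) *\<^sub>R (a - x)))\<^sup>2 / 2)))"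
    unfolding smooth_density_def gauss_eq by simp
  then show ?thesis by (simp only: gauss_smoothing)
qed

lemma nn_integral_smooth:
  assumes [measurable]: "h \<in> borel_measurable borel" and s: "0 < s"
  shows "(\<integral>\<^sup>+a. h a * ennreal (smooth_density s a) \<partial>lborel) =
    ennreal (s ^ DIM('a)) * (\<integral>\<^sup>+x. (\<integral>\<^sup>+z. ennreal (gauss z) * h (x + s *\<^sub>R z) \<partial>lborel) \<partial>\<mu>)"
proof -
  interpret P: pair_sigma_finite \<mu> "lborel :: 'a measure" ..
  have "(\<integral>\<^sup>+a. h a * ennreal (smooth_density s a) \<partial>lborel) =
      (\<integral>\<^sup>+a. (\<integral>\<^sup>+x. h a * ennreal (gauss ((1 / s) *\<^sub>R (a - x))) \<partial>\<mu>) \<partial>lborel)"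
    unfolding nn_smooth_density[symmetric] by (subst nn_integral_cmult) auto
  also have "\<dots> = (\<integral>\<^sup>+x. (\<integral>\<^sup>+a. h a * ennreal (gauss ((1 / s) *\<^sub>R (a - x))) \<partial>lborel) \<partial>\<mu>)"
    by (rule P.Fubini') measurable
  also have "\<dots> = (\<integral>\<^sup>+x. ennreal (s ^ DIM('a)) * (\<integral>\<^sup>+z. ennreal (gauss z) * h (x + s *\<^sub>R z) \<partial>lborel) \<partial>\<mu>)"
  proof (rule nn_integral_cong)
    fix x :: 'a
    show "(\<integral>\<^sup>+a. h a * ennreal (gauss ((1 / s) *\<^sub>R (a - x))) \<partial>lborel) =
      ennreal (s ^ DIM('a)) * (\<integral>\<^sup>+z. ennreal (gauss z) * h (x + s *\<^sub>R z) \<partial>lborel)"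
      using s by (subst nn_integral_lborel_affine[of _ s x]) (auto simp: mult.commute)
  qed
  finally show ?thesis by (simp add: nn_integral_cmult)
qed

end

text \<open>The smoothed density is an integral of the characteristic function against a Gaussian.
  Characteristic functions are bounded by 1, so the Gaussian itself dominates and pointwise
  convergence suffices.\<close>

lemma smooth_density_tendsto:
  fixes \<mu> :: "'a::euclidean_space measure" and N :: "nat \<Rightarrow> 'a measure"
  assumes "borel_prob \<mu>" and N: "\<And>n. borel_prob (N n)"
    and conv: "\<And>\<xi>. (\<lambda>n. charfn (N n) \<xi>) \<longlonglongrightarrow> charfn \<mu> \<xi>"
  shows "(\<lambda>n. borel_prob.smooth_density (N n) s a) \<longlonglongrightarrow> borel_prob.smooth_density \<mu> s a"
proof -
  interpret borel_prob \<mu> by fact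
  have [measurable]: "charfn (N n) \<in> borel_measurable borel" for n
    by (rule borel_prob.charfn_measurable[OF N])
  show ?thesis
    unfolding borel_prob.smooth_density_charfn[OF N] smooth_density_charfn
  proof (intro tendsto_mult tendsto_const tendsto_Re integral_dominated_convergence[where w=gauss])
    show "integrable lborel (gauss :: 'a \<Rightarrow> real)" by (rule integrable_gauss)
    show "AE w in lborel. (\<lambda>n. gauss w * (iexp (1 / s * (w \<bullet> a)) * charfn (N n) (- (1 / s) *\<^sub>R w)))
        \<longlonglongrightarrow> gauss w * (iexp (1 / s * (w \<bullet> a)) * charfn \<mu> (- (1 / s) *\<^sub>R w))"
      by (intro AE_I2 tendsto_mult tendsto_const conv)
    show "AE w in lborel. norm (gauss w * (iexp (1 / s * (w \<bullet> a)) * charfn (N n) (- (1 / s) *\<^sub>R w))) \<le> gauss w" for n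
      using borel_prob.norm_charfn_le_1[OF N, of n] by (auto simp: norm_mult mult_left_le)
  qed measurable
qed

text \<open>Write g for the weight. From g (x + s z) \<le> g x * g (s z) and g x \<le> g (x + s z) *
  g (s z), noise changes an integral of g by a factor of at most \<open>U s\<close> upwards and at
  least \<open>L s\<close> downwards. Fatou's lemma for the smoothed densities links the two laws in
  \<open>E * L s \<le> B * U s\<close>, and both factors tend to 1 as s tends to 0.\<close>

lemma powexp_limit_bound:
  fixes \<mu> :: "'a::euclidean_space measure" and N :: "nat \<Rightarrow> 'a measure"
  assumes \<mu>: "borel_prob \<mu>" and N: "\<And>n. borel_prob (N n)"
    and conv: "\<And>\<xi>. (\<lambda>n. charfn (N n) \<xi>) \<longlonglongrightarrow> charfn \<mu> \<xi>"
    and k: "0 < \<kappa>" "\<kappa> \<le> 1" "0 < lam"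
    and B: "\<And>n. (\<integral>\<^sup>+x. ennreal (powexp lam \<kappa> x) \<partial>N n) \<le> B"
  shows "(\<integral>\<^sup>+x. ennreal (powexp lam \<kappa> x) \<partial>\<mu>) \<le> B"
proof -
  let ?g = "powexp lam \<kappa> :: 'a \<Rightarrow> real"
  define E where "E = (\<integral>\<^sup>+x. ennreal (?g x) \<partial>\<mu>)"
  define L where "L s = (\<integral>\<^sup>+z. ennreal (gauss z) * ennreal (1 / ?g (s *\<^sub>R z)) \<partial>lborel)" for s
  define U where "U s = (\<integral>\<^sup>+z. ennreal (gauss z) * ennreal (?g (s *\<^sub>R z)) \<partial>lborel)" for s
  interpret borel_prob \<mu> by fact
  have main: "E * L s \<le> B * U s" if s: "0 < s" for s
  proof -
    let ?S = "\<lambda>M. \<integral>\<^sup>+x. (\<integral>\<^sup>+z. ennreal (gauss z) * ennreal (?g (x + s *\<^sub>R z)) \<partial>lborel) \<partial>M"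
    let ?c = "ennreal (s ^ DIM('a))"
    have up: "?S (N n) \<le> B * U s" for n
    proof -
      interpret Nn: borel_prob "N n" by (rule N)
      have "?S (N n) \<le> (\<integral>\<^sup>+x. (\<integral>\<^sup>+z. ennreal (?g x) * (ennreal (gauss z) * ennreal (?g (s *\<^sub>R z))) \<partial>lborel) \<partial>N n)"
        using powexp_add_le[OF k]
        by (intro nn_integral_mono) (auto simp: ennreal_mult[symmetric] mult.left_commute intro!: ennreal_leI mult_left_mono)
      also have "\<dots> = (\<integral>\<^sup>+x. ennreal (?g x) \<partial>N n) * U s"
        unfolding U_def by (simp add: nn_integral_cmult nn_integral_multc)
      also have "\<dots> \<le> B * U s" by (intro mult_right_mono B) auto
      finally show ?thesis .
    qed
    have low: "E * L s \<le> ?S \<mu>"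
    proof -
      have "E * L s = (\<integral>\<^sup>+x. (\<integral>\<^sup>+z. ennreal (?g x) * (ennreal (gauss z) * ennreal (1 / ?g (s *\<^sub>R z))) \<partial>lborel) \<partial>\<mu>)"
        unfolding E_def L_def by (simp add: nn_integral_cmult nn_integral_multc)
      also have "\<dots> \<le> ?S \<mu>"
      proof (intro nn_integral_mono)
        fix x z :: 'a
        have "?g x \<le> ?g (x + s *\<^sub>R z) * ?g (s *\<^sub>R z)"
          using powexp_add_le[OF k, of "x + s *\<^sub>R z" "- (s *\<^sub>R z)"] by simp
        then have "?g x * (gauss z * (1 / ?g (s *\<^sub>R z))) \<le> gauss z * ?g (x + s *\<^sub>R z)"
          using mult_left_mono[of "?g x / ?g (s *\<^sub>R z)" "?g (x + s *\<^sub>R z)" "gauss z"]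
          by (simp add: pos_divide_le_eq field_simps)
        then show "ennreal (?g x) * (ennreal (gauss z) * ennreal (1 / ?g (s *\<^sub>R z)))
            \<le> ennreal (gauss z) * ennreal (?g (x + s *\<^sub>R z))"
          by (simp add: ennreal_mult[symmetric])
      qed
      finally show ?thesis .
    qed
    have [measurable]: "borel_prob.smooth_density (N n) s \<in> borel_measurable borel" for n
      by (rule borel_prob.smooth_density_measurable[OF N])
    have "?c * (E * L s) \<le> ?c * ?S \<mu>" by (intro mult_left_mono low) auto
    also have "\<dots> = (\<integral>\<^sup>+a. ennreal (?g a) * ennreal (smooth_density s a) \<partial>lborel)"
      using s by (subst nn_integral_smooth) auto
    also have "\<dots> = (\<integral>\<^sup>+a. liminf (\<lambda>n. ennreal (?g a) * ennreal (borel_prob.smooth_density (N n) s a)) \<partial>lborel)"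
    proof (rule nn_integral_cong)
      fix a :: 'a
      have "(\<lambda>n. ennreal (?g a * borel_prob.smooth_density (N n) s a)) \<longlonglongrightarrow> ennreal (?g a * smooth_density s a)"
        by (intro tendsto_ennrealI tendsto_mult tendsto_const smooth_density_tendsto[OF \<mu> N conv])
      then show "ennreal (?g a) * ennreal (smooth_density s a) =
          liminf (\<lambda>n. ennreal (?g a) * ennreal (borel_prob.smooth_density (N n) s a))"
        by (simp add: ennreal_mult' lim_imp_Liminf)
    qed
    also have "\<dots> \<le> liminf (\<lambda>n. \<integral>\<^sup>+a. ennreal (?g a) * ennreal (borel_prob.smooth_density (N n) s a) \<partial>lborel)"
      by (intro nn_integral_liminf) measurable
    also have "\<dots> = liminf (\<lambda>n. ?c * ?S (N n))"
      using s by (subst borel_prob.nn_integral_smooth[OF N]) auto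
    also have "\<dots> \<le> liminf (\<lambda>n. ?c * (B * U s))"
      by (intro Liminf_mono always_eventually allI mult_left_mono up) auto
    also have "\<dots> = ?c * (B * U s)"
      by (rule Liminf_const) simp
    finally show ?thesis
      using s by (subst (asm) ennreal_mult_le_mult_iff) auto
  qed
  let ?s = "\<lambda>n. 1 / real (Suc n)"
  have lim: "(\<lambda>n. ?g (?s n *\<^sub>R z)) \<longlonglongrightarrow> 1" for z
  proof -
    have "(\<lambda>n. ?g (?s n *\<^sub>R z)) = (\<lambda>n. exp (lam * ((?s n) powr \<kappa> * norm z powr \<kappa>)))"
      by (auto simp: powexp_def powr_mult powr_divide)
    moreover have "(\<lambda>n. ?s n powr \<kappa>) \<longlonglongrightarrow> 0"
      using tendsto_neg_powr[OF _ filterlim_compose[OF filterlim_real_sequentially filterlim_Suc], of "-\<kappa>"] k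
      by (simp add: powr_divide powr_minus_divide)
    then have "(\<lambda>n. exp (lam * (?s n powr \<kappa> * norm z powr \<kappa>))) \<longlonglongrightarrow> exp (lam * (0 * norm z powr \<kappa>))"
      by (intro tendsto_intros)
    ultimately show ?thesis by simp
  qed
  have L: "(\<lambda>n. L (?s n)) \<longlonglongrightarrow> 1"
    unfolding L_def nn_integral_gauss[where 'a='a, symmetric]
  proof (rule nn_integral_dominated_convergence[where w="\<lambda>z. ennreal (gauss z)"])
    show "AE z in lborel. ennreal (gauss (z::'a)) * ennreal (1 / ?g (?s n *\<^sub>R z)) \<le> ennreal (gauss z)" for n
    proof (rule AE_I2)
      fix z :: 'a
      have "1 \<le> ?g (?s n *\<^sub>R z)" using k by (simp add: powexp_def)
      then have "gauss z * (1 / ?g (?s n *\<^sub>R z)) \<le> gauss z"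
        by (intro mult_left_le) auto
      then show "ennreal (gauss z) * ennreal (1 / ?g (?s n *\<^sub>R z)) \<le> ennreal (gauss z)"
        by (simp only: ennreal_mult'[symmetric] gauss_nonneg ennreal_leI)
    qed
    show "AE z in lborel. (\<lambda>n. ennreal (gauss (z::'a)) * ennreal (1 / ?g (?s n *\<^sub>R z))) \<longlonglongrightarrow> ennreal (gauss z)"
    proof (rule AE_I2)
      fix z :: 'a
      have "(\<lambda>n. ennreal (gauss z * (1 / ?g (?s n *\<^sub>R z)))) \<longlonglongrightarrow> ennreal (gauss z * (1 / 1))"
        by (intro tendsto_ennrealI tendsto_intros lim) auto
      then show "(\<lambda>n. ennreal (gauss z) * ennreal (1 / ?g (?s n *\<^sub>R z))) \<longlonglongrightarrow> ennreal (gauss z)"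
        by (simp only: ennreal_mult'[symmetric] gauss_nonneg) simp
    qed
  qed (auto simp: nn_integral_gauss)
  have U: "(\<lambda>n. U (?s n)) \<longlonglongrightarrow> 1"
    unfolding U_def nn_integral_gauss[where 'a='a, symmetric]
  proof (rule nn_integral_dominated_convergence[where w="\<lambda>z. ennreal (gauss z * exp (lam * (1 + norm z)))"])
    show "AE z in lborel. ennreal (gauss (z::'a)) * ennreal (?g (?s n *\<^sub>R z)) \<le> ennreal (gauss z * exp (lam * (1 + norm z)))" for n
    proof (rule AE_I2)
      fix z :: 'a
      have "?g (?s n *\<^sub>R z) \<le> exp (lam * (1 + norm (?s n *\<^sub>R z)))"
        by (rule powexp_le_exp[OF k])
      also have "norm (?s n *\<^sub>R z) \<le> norm z"
        by (simp add: divide_le_eq mult_le_cancel_left1)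
      finally have "?g (?s n *\<^sub>R z) \<le> exp (lam * (1 + norm z))" using k by simp
      then show "ennreal (gauss z) * ennreal (?g (?s n *\<^sub>R z)) \<le> ennreal (gauss z * exp (lam * (1 + norm z)))"
        by (auto simp: ennreal_mult[symmetric] intro!: ennreal_leI mult_left_mono)
    qed
    show "(\<integral>\<^sup>+z. ennreal (gauss (z::'a) * exp (lam * (1 + norm z))) \<partial>lborel) < \<infinity>"
      by (rule nn_integral_gauss_exp_finite)
    show "AE z in lborel. (\<lambda>n. ennreal (gauss (z::'a)) * ennreal (?g (?s n *\<^sub>R z))) \<longlonglongrightarrow> ennreal (gauss z)"
    proof (rule AE_I2)
      fix z :: 'a
      have "(\<lambda>n. ennreal (gauss z * ?g (?s n *\<^sub>R z))) \<longlonglongrightarrow> ennreal (gauss z * 1)"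
        by (intro tendsto_ennrealI tendsto_intros lim)
      then show "(\<lambda>n. ennreal (gauss z) * ennreal (?g (?s n *\<^sub>R z))) \<longlonglongrightarrow> ennreal (gauss z)"
        by (simp add: ennreal_mult')
    qed
  qed auto
  \<comment> \<open>\<open>E\<close> and \<open>B\<close> may be infinite; the product still
    converges because the other factor tends to 1 and not to 0.\<close>
  have "(\<lambda>n. E * L (?s n)) \<longlonglongrightarrow> E * 1"
    by (intro tendsto_mult_ennreal tendsto_const L) auto
  moreover have "(\<lambda>n. B * U (?s n)) \<longlonglongrightarrow> B * 1"
    by (intro tendsto_mult_ennreal tendsto_const U) auto
  ultimately have "E * 1 \<le> B * 1"
    by (rule LIMSEQ_le) (auto intro!: main exI[of _ 0])
  then show ?thesis by (simp add: E_def)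
qed

section \<open>Convolutions of rare jump laws\<close>

lemma borel_prob_return: "borel_prob (return borel a)"
  by (intro borel_prob.intro prob_space_return borel_prob_axioms.intro) auto

lemma charfn_return: "charfn (return borel a) \<xi> = iexp (\<xi> \<bullet> a)"
  unfolding charfn_def by (subst integral_return) auto

lemma borel_prob_convolution:
  assumes "borel_prob \<mu>" "borel_prob \<nu>"
  shows "borel_prob (\<mu> \<star> \<nu>)"
proof -
  interpret m: borel_prob \<mu> by fact
  interpret n: borel_prob \<nu> by fact
  interpret pair_prob_space \<mu> \<nu> ..
  show ?thesis
    unfolding convolution_def
    by (intro borel_prob.intro prob_space_distr borel_prob_axioms.intro) auto
qed

lemma charfn_convolution:
  fixes \<mu> \<nu> :: "'a::ordered_euclidean_space measure"
  assumes "borel_prob \<mu>" "borel_prob \<nu>"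
  shows "charfn (\<mu> \<star> \<nu>) \<xi> = charfn \<mu> \<xi> * charfn \<nu> \<xi>"
proof -
  interpret m: borel_prob \<mu> by fact
  interpret n: borel_prob \<nu> by fact
  interpret P: pair_prob_space \<mu> \<nu> ..
  let ?f = "\<lambda>z. iexp (\<xi> \<bullet> fst z) * iexp (\<xi> \<bullet> snd z)"
  have int: "integrable (\<mu> \<Otimes>\<^sub>M \<nu>) ?f"
    by (rule P.P.integrable_const_bound[of _ 1]) (auto simp: norm_mult)
  have "charfn (\<mu> \<star> \<nu>) \<xi> = (CLINT z|\<mu> \<Otimes>\<^sub>M \<nu>. ?f z)"
    unfolding charfn_def convolution_def
    by (subst integral_distr)
      (auto simp: inner_add_right exp_add distrib_left intro!: Bochner_Integration.integral_cong)
  also have "\<dots> = (CLINT x|\<mu>. CLINT y|\<nu>. ?f (x, y))"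
    using P.integral_fst'[OF int] by simp
  also have "\<dots> = charfn \<mu> \<xi> * charfn \<nu> \<xi>"
    unfolding charfn_def by simp
  finally show ?thesis .
qed

text \<open>Two instances are used: \<open>powexp\<close> for the final bounds and exp (x . w) for
  the compensated jumps. The condition \<open>h 0 = 1\<close> makes the absence of a jump cost
  nothing, so that a rare jump of rate \<epsilon> contributes the factor 1 + \<epsilon> times the
  integral of h - 1.\<close>

definition submult_weight :: "('a::ordered_euclidean_space \<Rightarrow> real) \<Rightarrow> bool" where
  "submult_weight h \<longleftrightarrow> h \<in> borel_measurable borel \<and> h 0 = 1 \<and> (\<forall>x. 0 \<le> h x) \<and>
     (\<forall>x y. h (x + y) \<le> h x * h y)"

lemma submult_weight_powexp:
  "0 < \<kappa> \<Longrightarrow> \<kappa> \<le> 1 \<Longrightarrow> 0 < lam \<Longrightarrow> submult_weight (powexp lam \<kappa>)"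
  by (auto simp: submult_weight_def powexp_add_le)

lemma submult_weight_exp_inner: "submult_weight (\<lambda>x. exp (x \<bullet> w))"
  by (auto simp: submult_weight_def inner_add_left exp_add)

lemma nn_integral_convolution_le:
  assumes "borel_prob \<mu>" "borel_prob \<nu>" and h: "submult_weight h"
  shows "(\<integral>\<^sup>+x. ennreal (h x) \<partial>(\<mu> \<star> \<nu>)) \<le> (\<integral>\<^sup>+x. ennreal (h x) \<partial>\<mu>) * (\<integral>\<^sup>+x. ennreal (h x) \<partial>\<nu>)"
proof -
  interpret m: borel_prob \<mu> by fact
  interpret n: borel_prob \<nu> by fact
  have [measurable]: "h \<in> borel_measurable borel"
    using h by (simp add: submult_weight_def)
  have "(\<integral>\<^sup>+x. ennreal (h x) \<partial>(\<mu> \<star> \<nu>)) = (\<integral>\<^sup>+x. \<integral>\<^sup>+y. ennreal (h (x + y)) \<partial>\<nu> \<partial>\<mu>)"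
    by (rule nn_integral_convolution) (auto intro: m.finite_measure_axioms n.finite_measure_axioms)
  also have "\<dots> \<le> (\<integral>\<^sup>+x. \<integral>\<^sup>+y. ennreal (h x) * ennreal (h y) \<partial>\<nu> \<partial>\<mu>)"
    using h by (intro nn_integral_mono) (auto simp: submult_weight_def ennreal_mult[symmetric] intro!: ennreal_leI)
  also have "\<dots> = (\<integral>\<^sup>+x. ennreal (h x) \<partial>\<mu>) * (\<integral>\<^sup>+x. ennreal (h x) \<partial>\<nu>)"
    by (simp add: nn_integral_cmult nn_integral_multc)
  finally show ?thesis .
qed

fun convolution_power :: "'a::ordered_euclidean_space measure \<Rightarrow> nat \<Rightarrow> 'a measure" where
  "convolution_power \<mu> 0 = return borel 0"
| "convolution_power \<mu> (Suc n) = (\<mu> \<star> convolution_power \<mu> n)"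

lemma borel_prob_convolution_power: "borel_prob \<mu> \<Longrightarrow> borel_prob (convolution_power \<mu> n)"
  by (induction n) (auto intro: borel_prob_return borel_prob_convolution)

lemma charfn_convolution_power: "borel_prob \<mu> \<Longrightarrow> charfn (convolution_power \<mu> n) \<xi> = charfn \<mu> \<xi> ^ n"
  by (induction n)
    (auto simp: charfn_return charfn_convolution borel_prob_convolution_power)

lemma nn_integral_convolution_power_le:
  assumes \<mu>: "borel_prob \<mu>" and h: "submult_weight h"
  shows "(\<integral>\<^sup>+x. ennreal (h x) \<partial>convolution_power \<mu> n) \<le> (\<integral>\<^sup>+x. ennreal (h x) \<partial>\<mu>) ^ n"
proof (induction n)
  case 0
  then show ?case using h by (simp add: submult_weight_def nn_integral_return)
next
  case (Suc n)
  have "(\<integral>\<^sup>+x. ennreal (h x) \<partial>convolution_power \<mu> (Suc n)) \<le>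
      (\<integral>\<^sup>+x. ennreal (h x) \<partial>\<mu>) * (\<integral>\<^sup>+x. ennreal (h x) \<partial>convolution_power \<mu> n)"
    using nn_integral_convolution_le[OF \<mu> borel_prob_convolution_power[OF \<mu>] h] by simp
  also have "\<dots> \<le> (\<integral>\<^sup>+x. ennreal (h x) \<partial>\<mu>) * (\<integral>\<^sup>+x. ennreal (h x) \<partial>\<mu>) ^ n"
    by (intro mult_left_mono Suc) auto
  finally show ?case by simp
qed

section \<open>Rare jumps and their sums\<close>

lemma integral_if_fst_bernoulli:
  fixes f :: "'a \<Rightarrow> 'b::{banach, second_countable_topology}"
  assumes p: "0 \<le> p" "p \<le> 1" and "prob_space \<eta>" and f: "integrable \<eta> f"
  defines "P \<equiv> measure_pmf (bernoulli_pmf p) \<Otimes>\<^sub>M \<eta>"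
  shows "integrable P (\<lambda>x. if fst x then f (snd x) else c)"
    and "(LINT x|P. (if fst x then f (snd x) else c)) = p *\<^sub>R (LINT x|\<eta>. f x) + (1 - p) *\<^sub>R c"
proof -
  interpret e: prob_space \<eta> by fact
  interpret P: pair_prob_space "measure_pmf (bernoulli_pmf p)" \<eta> ..
  have [measurable]: "f \<in> borel_measurable \<eta>" using f by auto
  have "integrable P (\<lambda>(b, x). if b then f x else c)"
    unfolding P_def
  proof (rule P.Fubini_integrable)
    show "integrable (measure_pmf (bernoulli_pmf p)) (\<lambda>b. LINT x|\<eta>. norm (case (b, x) of (b, x) \<Rightarrow> if b then f x else c))"
      by (rule integrable_measure_pmf_finite) auto
    show "AE b in measure_pmf (bernoulli_pmf p). integrable \<eta> (\<lambda>x. case (b, x) of (b, x) \<Rightarrow> if b then f x else c)"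
      unfolding prod.case
    proof (rule AE_I2)
      fix b show "integrable \<eta> (\<lambda>x. if b then f x else c)" using f by (cases b) auto
    qed
  qed measurable
  then show int: "integrable P (\<lambda>x. if fst x then f (snd x) else c)"
    by (simp add: case_prod_beta')
  have "(LINT x|P. (if fst x then f (snd x) else c)) = 
     (LINT b|measure_pmf (bernoulli_pmf p). LINT x|\<eta>. (if b then f x else c))"
    using P.integral_fst'[OF int[unfolded P_def]] unfolding P_def fst_conv snd_conv by (rule sym)
  also have "\<dots> = p *\<^sub>R (LINT x|\<eta>. f x) + (1 - p) *\<^sub>R c"
    using p by (subst integral_measure_pmf[of UNIV]) (auto simp: UNIV_bool e.prob_space)
  finally show "(LINT x|P. (if fst x then f (snd x) else c)) = p *\<^sub>R (LINT x|\<eta>. f x) + (1 - p) *\<^sub>R c" .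
qed

text \<open>With m the total mass of \<open>\<eta>\<close>, the law is (1 - \<epsilon> m) delta_0 +
  \<epsilon> \<open>\<eta>\<close>, a probability because \<epsilon> m \<le> 1. It is realised by a
  coin that decides whether there is a jump and an independent draw from the normalised
  \<open>\<eta>\<close>; both formulas are then instances of \<open>key\<close>.\<close>

lemma rare_jump_law:
  fixes \<eta> :: "'a::euclidean_space measure"
  assumes "finite_measure \<eta>" and sets [measurable_cong, simp]: "sets \<eta> = sets borel"
    and \<epsilon>: "0 \<le> \<epsilon>" "\<epsilon> * measure \<eta> UNIV \<le> 1"
  obtains \<rho> where "borel_prob \<rho>"
    and "\<And>\<xi>. charfn \<rho> \<xi> = 1 + \<epsilon> * (CLINT y|\<eta>. iexp (\<xi> \<bullet> y) - 1)"
    and "\<And>h::'a \<Rightarrow> real. h 0 = 1 \<Longrightarrow> integrable \<eta> h \<Longrightarrow> (\<And>x. 0 \<le> h x) \<Longrightarrow>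
      (\<integral>\<^sup>+x. ennreal (h x) \<partial>\<rho>) = ennreal (1 + \<epsilon> * (LINT y|\<eta>. h y - 1))"
proof -
  interpret e: finite_measure \<eta> by fact
  have space [simp]: "space \<eta> = UNIV" using sets_eq_imp_space_eq[OF sets] by simp
  define m where "m = measure \<eta> UNIV"
  have m: "0 \<le> m" by (simp add: m_def)
  show ?thesis
  proof (cases "m = 0")
    \<comment> \<open>The zero measure cannot be normalised; without jumps the point mass at 0 is
      the law.\<close>
    case True
    then have "emeasure \<eta> UNIV = 0" by (simp add: m_def e.emeasure_eq_measure)
    then have AE: "AE x in \<eta>. P x" for P
      using sets_eq_imp_space_eq[OF sets] by (intro AE_I'[of UNIV]) (auto simp: null_sets_def)
    have 1: "(CLINT y|\<eta>. iexp (\<xi> \<bullet> y) - 1) = 0" for \<xi>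
      by (rule integral_eq_zero_AE) (rule AE)
    have 2: "(LINT y|\<eta>. h y - 1) = 0" for h :: "'a \<Rightarrow> real"
      by (rule integral_eq_zero_AE) (rule AE)
    have [measurable]: "h \<in> borel_measurable borel" if "integrable \<eta> h" for h :: "'a \<Rightarrow> real"
      using borel_measurable_integrable[OF that] by simp
    show thesis
      by (rule that[of "return borel 0"])
        (auto simp: borel_prob_return charfn_return 1 2 nn_integral_return)
  next
    case False
    define p where "p = \<epsilon> * m"
    have p: "0 \<le> p" "p \<le> 1" using \<epsilon> m by (auto simp: p_def m_def)
    define \<eta>' where "\<eta>' = density \<eta> (\<lambda>_. ennreal (1 / m))"
    have sets' [measurable_cong, simp]: "sets \<eta>' = sets borel" by (simp add: \<eta>'_def)
    interpret e': prob_space \<eta>'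
      by standard (use False m in \<open>simp add: \<eta>'_def emeasure_density_const e.emeasure_eq_measure m_def ennreal_mult[symmetric]\<close>)
    have int': "integrable \<eta>' f" if [measurable]: "f \<in> borel_measurable borel" and "integrable \<eta> f" for f :: "'a \<Rightarrow> 'b::{banach, second_countable_topology}"
      unfolding \<eta>'_def using m False that(2) by (subst integrable_density) auto
    have I': "(LINT x|\<eta>'. f x) = (1 / m) *\<^sub>R (LINT x|\<eta>. f x)" if [measurable]: "f \<in> borel_measurable borel" for f :: "'a \<Rightarrow> 'b::{banach, second_countable_topology}"
      unfolding \<eta>'_def using m False by (subst integral_density) auto
    define P where "P = measure_pmf (bernoulli_pmf p) \<Otimes>\<^sub>M \<eta>'"
    interpret P: pair_prob_space "measure_pmf (bernoulli_pmf p)" \<eta>' ..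
    define T :: "bool \<times> 'a \<Rightarrow> 'a" where "T z = (if fst z then snd z else 0)" for z
    have T [measurable]: "T \<in> P \<rightarrow>\<^sub>M borel" unfolding T_def[abs_def] P_def by measurable
    define \<rho> where "\<rho> = distr P borel T"
    have prob: "borel_prob \<rho>"
      unfolding \<rho>_def
      by (intro borel_prob.intro prob_space.prob_space_distr borel_prob_axioms.intro T)
        (auto simp: P_def intro: P.P.prob_space_axioms)
    have key: "integrable \<rho> f" "(LINT x|\<rho>. f x) = f 0 + \<epsilon> *\<^sub>R (LINT x|\<eta>. f x - f 0)"
      if [measurable]: "f \<in> borel_measurable borel" and f: "integrable \<eta> f"
      for f :: "'a \<Rightarrow> 'b::{banach, second_countable_topology}"
    proof -
      have f': "integrable \<eta>' f" using f by (simp add: int')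
      have fT: "f (T z) = (if fst z then f (snd z) else f 0)" for z by (simp add: T_def)
      note bern = integral_if_fst_bernoulli[OF p e'.prob_space_axioms f', of "f 0", folded P_def]
      show "integrable \<rho> f"
        unfolding \<rho>_def by (subst integrable_distr_eq) (auto simp: fT bern)
      have "(LINT x|\<rho>. f x) = p *\<^sub>R (LINT x|\<eta>'. f x) + (1 - p) *\<^sub>R f 0"
        unfolding \<rho>_def by (subst integral_distr) (auto simp: fT bern)
      also have "\<dots> = f 0 + \<epsilon> *\<^sub>R ((LINT x|\<eta>. f x) - m *\<^sub>R f 0)"
        using False by (simp add: I' p_def algebra_simps)
      also have "\<dots> = f 0 + \<epsilon> *\<^sub>R (LINT x|\<eta>. f x - f 0)"
        using f by (subst Bochner_Integration.integral_diff) (auto simp: m_def)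
      finally show "(LINT x|\<rho>. f x) = f 0 + \<epsilon> *\<^sub>R (LINT x|\<eta>. f x - f 0)" .
    qed
    show thesis
    proof (rule that[OF prob])
      fix \<xi> :: 'a
      have "integrable \<eta> (\<lambda>y. iexp (\<xi> \<bullet> y))"
        by (rule e.integrable_const_bound[of _ 1]) auto
      then show "charfn \<rho> \<xi> = 1 + \<epsilon> * (CLINT y|\<eta>. iexp (\<xi> \<bullet> y) - 1)"
        unfolding charfn_def by (subst key) (auto simp: scaleR_conv_of_real)
    next
      fix h :: "'a \<Rightarrow> real" assume h: "h 0 = 1" "integrable \<eta> h" "\<And>x. 0 \<le> h x"
      have [measurable]: "h \<in> borel_measurable borel" using borel_measurable_integrable[OF h(2)] by simp
      show "(\<integral>\<^sup>+x. ennreal (h x) \<partial>\<rho>) = ennreal (1 + \<epsilon> * (LINT y|\<eta>. h y - 1))"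
        using key[of h] h by (subst nn_integral_eq_integral) auto
    qed
  qed
qed

text \<open>Both 1 + w and exp w lie in the closed unit disc, so their N-th powers differ by at most
  N times their difference. That difference is of second order in w, and 3 is a bound for exp
  1.\<close>

lemma norm_one_plus_power_exp_le:
  fixes w :: complex
  assumes "norm (1 + w) \<le> 1" "Re w \<le> 0" "norm w \<le> 1"
  shows "norm ((1 + w) ^ N - exp (real N * w)) \<le> 3 * real N * (norm w)\<^sup>2"
proof -
  have "norm ((1 + w) ^ N - exp w ^ N) \<le> N * norm (1 + w - exp w)"
    using assms by (intro norm_power_diff) auto
  also have "norm (1 + w - exp w) \<le> 3 * (norm w)\<^sup>2"
  proof -
    have "norm (exp w - (\<Sum>k\<le>1. w ^ k / fact k)) \<le> exp \<bar>Re w\<bar> * norm w ^ Suc 1 / fact 1"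
      by (rule Taylor_exp)
    then have "norm (1 + w - exp w) \<le> exp \<bar>Re w\<bar> * (norm w)\<^sup>2"
      by (simp add: norm_minus_commute power2_eq_square)
    also have "exp \<bar>Re w\<bar> \<le> 3"
      using abs_Re_le_cmod[of w] assms exp_le order_trans[of "exp \<bar>Re w\<bar>" "exp 1" 3] by simp
    finally show ?thesis by (simp add: mult_right_mono)
  qed
  finally show ?thesis
    by (simp add: exp_of_nat_mult mult_left_mono mult.assoc)
qed

text \<open>Sums of many rare jumps replace the compound Poisson law, so that no Poisson mixture has to be formed.\<close>

lemma compound_poisson_approx:
  fixes \<eta> :: "'a::ordered_euclidean_space measure" and a :: 'a
  assumes "finite_measure \<eta>" and sets [measurable_cong, simp]: "sets \<eta> = sets borel"
    and t: "0 \<le> t" and \<delta>: "0 < \<delta>"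
  obtains \<mu> where "borel_prob \<mu>"
    and "\<And>\<xi>. norm (charfn \<mu> \<xi> - exp (\<i> * (\<xi> \<bullet> a) + t * (CLINT y|\<eta>. iexp (\<xi> \<bullet> y) - 1))) \<le> \<delta>"
    and "\<And>h. submult_weight h \<Longrightarrow> integrable \<eta> h \<Longrightarrow>
      (\<integral>\<^sup>+x. ennreal (h x) \<partial>\<mu>) \<le> ennreal (h a * exp (t * (LINT y|\<eta>. h y - 1)))"
proof -
  interpret e: finite_measure \<eta> by fact
  have space [simp]: "space \<eta> = UNIV" using sets_eq_imp_space_eq[OF sets] by simp
  define m where "m = measure \<eta> UNIV"
  have m: "0 \<le> m" by (simp add: m_def)
  \<comment> \<open>Below, w = (t / N) z with |z| \<le> 2 m. The first summand gives |w| \<le> 1 and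
    an admissible jump rate, the second makes the error 3 N (2 t m / N)^2 at most \<delta>.\<close>
  define N where "N = Suc (nat \<lceil>2 * t * m + 3 * (2 * t * m)\<^sup>2 / \<delta>\<rceil>)"
  have N0: "0 < real N" by (simp add: N_def)
  have "2 * t * m + 3 * (2 * t * m)\<^sup>2 / \<delta> \<le> real N"
    unfolding N_def by linarith
  moreover have "0 \<le> 2 * t * m" "0 \<le> 3 * (2 * t * m)\<^sup>2 / \<delta>" using t m \<delta> by auto
  ultimately have N1: "2 * t * m \<le> real N" and N2: "3 * (2 * t * m)\<^sup>2 / \<delta> \<le> real N" by linarith+
  have \<epsilon>: "0 \<le> t / N" "t / N * measure \<eta> UNIV \<le> 1"
    using t m N1 N0 by (auto simp: m_def[symmetric] divide_le_eq)
  obtain \<rho> where \<rho>: "borel_prob \<rho>"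
    and cf: "\<And>\<xi>. charfn \<rho> \<xi> = 1 + (t / N) * (CLINT y|\<eta>. iexp (\<xi> \<bullet> y) - 1)"
    and h\<rho>: "\<And>h::'a \<Rightarrow> real. h 0 = 1 \<Longrightarrow> integrable \<eta> h \<Longrightarrow> (\<And>x. 0 \<le> h x) \<Longrightarrow>
      (\<integral>\<^sup>+x. ennreal (h x) \<partial>\<rho>) = ennreal (1 + (t / N) * (LINT y|\<eta>. h y - 1))"
    using rare_jump_law[OF assms(1) sets \<epsilon>] by metis
  define \<mu> where "\<mu> = (return borel a \<star> convolution_power \<rho> N)"
  show thesis
  proof (rule that)
    show "borel_prob \<mu>"
      unfolding \<mu>_def by (intro borel_prob_convolution borel_prob_return borel_prob_convolution_power \<rho>)
  next
    fix \<xi> :: 'a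
    define z where "z = (CLINT y|\<eta>. iexp (\<xi> \<bullet> y) - 1)"
    define w where "w = complex_of_real (t / N) * z"
    have int: "integrable \<eta> (\<lambda>y. iexp (\<xi> \<bullet> y) - 1)"
      by (rule e.integrable_const_bound[of _ 2])
        (auto intro!: AE_I2 order_trans[OF norm_triangle_ineq4])
    have "norm z \<le> (LINT y|\<eta>. norm (iexp (\<xi> \<bullet> y) - 1))"
      unfolding z_def by (rule integral_norm_bound)
    also have "\<dots> \<le> (LINT y|\<eta>. 2)"
      using int by (intro integral_mono integrable_norm) (auto intro!: order_trans[OF norm_triangle_ineq4])
    finally have "norm z \<le> (LINT y|\<eta>. 2)" .
    then have z: "norm z \<le> 2 * m" by (simp add: m_def)
    have "Re z = (LINT y|\<eta>. Re (iexp (\<xi> \<bullet> y) - 1))"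
      unfolding z_def by (rule integral_Re[OF int, symmetric])
    also have "\<dots> \<le> (LINT y|\<eta>. 0)"
      using integrable_Re[OF int] by (intro integral_mono) (auto simp: Re_exp)
    finally have "Re z \<le> 0" by simp
    have Rw: "Re w \<le> 0" using \<open>Re z \<le> 0\<close> t N0 by (auto simp: w_def intro!: divide_nonpos_pos mult_nonneg_nonpos)
    have nw: "norm w \<le> 2 * t * m / N"
      using mult_left_mono[OF z, of "t / N"] t N0 by (simp add: w_def norm_mult norm_divide mult_ac)
    have nw1: "norm w \<le> 1"
      using nw N1 N0 by (simp add: divide_le_eq order_trans)
    have 1: "charfn \<rho> \<xi> = 1 + w" by (simp add: cf w_def z_def)
    have "charfn \<mu> \<xi> = iexp (\<xi> \<bullet> a) * (1 + w) ^ N"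
      unfolding \<mu>_def
      by (simp add: charfn_convolution borel_prob_return borel_prob_convolution_power \<rho>
          charfn_return charfn_convolution_power 1)
    moreover have "exp (\<i> * (\<xi> \<bullet> a) + t * z) = iexp (\<xi> \<bullet> a) * exp (real N * w)"
      using N0 by (simp add: exp_add w_def)
    ultimately have "norm (charfn \<mu> \<xi> - exp (\<i> * (\<xi> \<bullet> a) + t * z)) = norm ((1 + w) ^ N - exp (real N * w))"
      by (simp add: norm_mult flip: right_diff_distrib)
    also have "\<dots> \<le> 3 * real N * (norm w)\<^sup>2"
      using borel_prob.norm_charfn_le_1[OF \<rho>, of \<xi>] Rw nw1
      by (intro norm_one_plus_power_exp_le) (auto simp: 1)
    also have "\<dots> \<le> 3 * real N * (2 * t * m / N)\<^sup>2"
      using nw N0 by (intro mult_left_mono power_mono) auto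
    also have "\<dots> = 3 * (2 * t * m)\<^sup>2 / N"
      using N0 by (simp add: power2_eq_square)
    also have "\<dots> \<le> \<delta>"
      using N2 N0 \<delta> by (simp add: divide_le_eq mult.commute)
    finally show "norm (charfn \<mu> \<xi> - exp (\<i> * (\<xi> \<bullet> a) + t * (CLINT y|\<eta>. iexp (\<xi> \<bullet> y) - 1))) \<le> \<delta>"
      unfolding z_def .
  next
    fix h :: "'a \<Rightarrow> real" assume h: "submult_weight h" and int: "integrable \<eta> h"
    have h': "h 0 = 1" "\<And>x. 0 \<le> h x" and [measurable]: "h \<in> borel_measurable borel"
      using h by (auto simp: submult_weight_def)
    define I where "I = (LINT y|\<eta>. h y - 1)"
    have "(LINT y|\<eta>. h y - 1) = (LINT y|\<eta>. h y) - m"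
      using int by (subst Bochner_Integration.integral_diff) (auto simp: m_def)
    moreover have "0 \<le> (LINT y|\<eta>. h y)" using h' by (intro integral_nonneg_AE) auto
    ultimately have "- m \<le> I" by (simp add: I_def)
    \<comment> \<open>The factor 1 + t I / N has to be nonnegative, both to pull its power through
      \<open>ennreal\<close> and to compare that power with exp (t I).\<close>
    then have "- 1 \<le> t / N * I"
      using \<epsilon> mult_left_mono[of "-m" I "t / N"] by (simp add: m_def)
    then have I: "0 \<le> 1 + t / N * I" by simp
    have "(\<integral>\<^sup>+x. ennreal (h x) \<partial>\<mu>) \<le> (\<integral>\<^sup>+x. ennreal (h x) \<partial>return borel a) * (\<integral>\<^sup>+x. ennreal (h x) \<partial>convolution_power \<rho> N)"
      unfolding \<mu>_def by (intro nn_integral_convolution_le borel_prob_return borel_prob_convolution_power \<rho> h)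
    also have "\<dots> \<le> ennreal (h a) * (\<integral>\<^sup>+x. ennreal (h x) \<partial>\<rho>) ^ N"
      by (intro mult_mono nn_integral_convolution_power_le \<rho> h) (auto simp: nn_integral_return)
    also have "\<dots> = ennreal (h a * (1 + t / N * I) ^ N)"
      using h' int I by (subst h\<rho>) (auto simp: ennreal_power ennreal_mult' I_def)
    also have "\<dots> \<le> ennreal (h a * exp (t / N * I) ^ N)"
      using I h' exp_ge_add_one_self[of "t / N * I"]
      by (intro ennreal_leI mult_left_mono power_mono) auto
    also have "exp (t / N * I) ^ N = exp (t * I)"
      using N0 by (simp flip: exp_of_nat_mult)
    finally show "(\<integral>\<^sup>+x. ennreal (h x) \<partial>\<mu>) \<le> ennreal (h a * exp (t * (LINT y|\<eta>. h y - 1)))"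
      by (simp add: I_def)
  qed
qed

section \<open>Levy measures and cut-off jumps\<close>

text \<open>The n-th law matches the n-th exponent up to 1 / (n + 1). Hence only the exponents must
  converge; drifts and jump measures may each diverge.\<close>

lemma compound_poisson_sequence:
  fixes \<eta> :: "nat \<Rightarrow> 'a::ordered_euclidean_space measure" and a :: "nat \<Rightarrow> 'a"
  assumes fin: "\<And>n. finite_measure (\<eta> n)" and sets: "\<And>n. sets (\<eta> n) = sets borel" and t: "0 \<le> t"
    and conv: "\<And>\<xi>. (\<lambda>n. \<i> * (\<xi> \<bullet> a n) + t * (CLINT y|\<eta> n. iexp (\<xi> \<bullet> y) - 1)) \<longlonglongrightarrow> L \<xi>"
  obtains \<mu> where "\<And>n. borel_prob (\<mu> n)"
    and "\<And>\<xi>. (\<lambda>n. charfn (\<mu> n) \<xi>) \<longlonglongrightarrow> exp (L \<xi>)"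
    and "\<And>n h. submult_weight h \<Longrightarrow> integrable (\<eta> n) h \<Longrightarrow>
      (\<integral>\<^sup>+x. ennreal (h x) \<partial>\<mu> n) \<le> ennreal (h (a n) * exp (t * (LINT y|\<eta> n. h y - 1)))"
proof -
  let ?e = "\<lambda>n \<xi>. \<i> * (\<xi> \<bullet> a n) + t * (CLINT y|\<eta> n. iexp (\<xi> \<bullet> y) - 1)"
  have "\<forall>n. \<exists>\<mu>. borel_prob \<mu> \<and> (\<forall>\<xi>. norm (charfn \<mu> \<xi> - exp (?e n \<xi>)) \<le> 1 / real (Suc n)) \<and>
     (\<forall>h. submult_weight h \<longrightarrow> integrable (\<eta> n) h \<longrightarrow>
      (\<integral>\<^sup>+x. ennreal (h x) \<partial>\<mu>) \<le> ennreal (h (a n) * exp (t * (LINT y|\<eta> n. h y - 1))))"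
  proof
    fix n
    have "0 < 1 / real (Suc n)" by simp
    from compound_poisson_approx[OF fin[of n] sets[of n] t this, of "a n"]
    show "\<exists>\<mu>. borel_prob \<mu> \<and> (\<forall>\<xi>. norm (charfn \<mu> \<xi> - exp (?e n \<xi>)) \<le> 1 / real (Suc n)) \<and>
     (\<forall>h. submult_weight h \<longrightarrow> integrable (\<eta> n) h \<longrightarrow>
      (\<integral>\<^sup>+x. ennreal (h x) \<partial>\<mu>) \<le> ennreal (h (a n) * exp (t * (LINT y|\<eta> n. h y - 1))))"
      by metis
  qed
  then obtain \<mu> where \<mu>: "\<And>n. borel_prob (\<mu> n)"
    and close: "\<And>n \<xi>. norm (charfn (\<mu> n) \<xi> - exp (?e n \<xi>)) \<le> 1 / real (Suc n)"
    and h: "\<And>n h. submult_weight h \<Longrightarrow> integrable (\<eta> n) h \<Longrightarrow>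
      (\<integral>\<^sup>+x. ennreal (h x) \<partial>\<mu> n) \<le> ennreal (h (a n) * exp (t * (LINT y|\<eta> n. h y - 1)))"
    by metis
  show thesis
  proof (rule that[OF \<mu> _ h])
    fix \<xi>
    have "(\<lambda>n. charfn (\<mu> n) \<xi> - exp (?e n \<xi>)) \<longlonglongrightarrow> 0"
      by (rule Lim_null_comparison[OF always_eventually LIMSEQ_Suc[OF lim_1_over_n]]) (use close in auto)
    from tendsto_add[OF this tendsto_exp[OF conv[of \<xi>]]]
    show "(\<lambda>n. charfn (\<mu> n) \<xi>) \<longlonglongrightarrow> exp (L \<xi>)" by simp
  qed
qed

text \<open>A Levy measure is finite off any ball around 0. \<open>Suc\<close> matters: with
  \<open>n\<close> alone, the value 1 / 0 = 0 would leave the first set uncut.\<close>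

definition cutoff :: "'a::real_normed_vector set \<Rightarrow> nat \<Rightarrow> 'a set" where
  "cutoff A n = A \<inter> {y. 1 / real (Suc n) \<le> norm y}"

lemma cutoff_measurable [measurable]:
  fixes A :: "'a::euclidean_space set"
  assumes [measurable]: "A \<in> sets borel"
  shows "cutoff A n \<in> sets borel"
  unfolding cutoff_def by measurable

lemma cutoff_subset: "cutoff A n \<subseteq> A"
  by (auto simp: cutoff_def)

locale levy_measure =
  fixes \<nu> :: "'a::ordered_euclidean_space measure"
  assumes sets_eq [measurable_cong, simp]: "sets \<nu> = sets borel"
    and fin: "(\<integral>\<^sup>+y. ennreal (min 1 ((norm y)\<^sup>2)) \<partial>\<nu>) < \<infinity>"
begin

lemma space_eq [simp]: "space \<nu> = UNIV"
  using sets_eq_imp_space_eq[OF sets_eq] by simp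

lemma integrable_min: "integrable \<nu> (\<lambda>y. min 1 ((norm y)\<^sup>2))"
  using fin by (intro integrableI_nonneg) auto

definition J :: real where "J = (LINT y|\<nu>. min 1 ((norm y)\<^sup>2))"

lemma J_nonneg: "0 \<le> J"
  unfolding J_def by (intro integral_nonneg_AE) auto

lemma integrable_by_min:
  fixes f :: "'a \<Rightarrow> 'b::{banach, second_countable_topology}"
  assumes [measurable]: "f \<in> borel_measurable borel"
    and f: "\<And>y. norm (f y) \<le> C * min 1 ((norm y)\<^sup>2)"
  shows "integrable \<nu> f"
proof (rule Bochner_Integration.integrable_bound)
  show "integrable \<nu> (\<lambda>y. C * min 1 ((norm y)\<^sup>2))"
    using integrable_min by simp
  show "AE y in \<nu>. norm (f y) \<le> norm (C * min 1 ((norm y)\<^sup>2))"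
    using f by (intro AE_I2) (auto intro: order_trans[OF _ abs_ge_self])
qed simp

definition jumps :: "'a set \<Rightarrow> 'a measure" where
  "jumps A = density \<nu> (\<lambda>y. ennreal (indicator A y))"

lemma sets_jumps [measurable_cong, simp]: "sets (jumps A) = sets borel"
  by (simp add: jumps_def)

lemma integral_jumps:
  fixes f :: "'a \<Rightarrow> 'b::{banach, second_countable_topology}"
  assumes [measurable]: "A \<in> sets borel" "f \<in> borel_measurable borel"
  shows "(LINT y|jumps A. f y) = (LINT y|\<nu>. indicator A y *\<^sub>R f y)"
  unfolding jumps_def by (subst integral_density) auto

lemma integrable_jumps:
  fixes f :: "'a \<Rightarrow> 'b::{banach, second_countable_topology}"
  assumes [measurable]: "A \<in> sets borel" "f \<in> borel_measurable borel"
  shows "integrable (jumps A) f \<longleftrightarrow> integrable \<nu> (\<lambda>y. indicator A y *\<^sub>R f y)"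
  unfolding jumps_def by (subst integrable_density) auto

lemma integrable_indicator_away:
  assumes [measurable]: "A \<in> sets borel" and r: "0 < r" "\<And>y. y \<in> A \<Longrightarrow> r \<le> norm y"
  shows "integrable \<nu> (indicator A :: 'a \<Rightarrow> real)"
proof (rule integrable_by_min[where C = "1 / min 1 (r\<^sup>2)"])
  fix y :: 'a
  have "r\<^sup>2 \<le> (norm y)\<^sup>2" if "y \<in> A" using r that by (intro power_mono) auto
  then have "y \<in> A \<Longrightarrow> min 1 (r\<^sup>2) \<le> min 1 ((norm y)\<^sup>2)" by auto
  then show "norm (indicator A y :: real) \<le> 1 / min 1 (r\<^sup>2) * min 1 ((norm y)\<^sup>2)"
    using r by (auto simp: indicator_def le_divide_eq)
qed simp

lemma finite_measure_jumps:
  assumes A [measurable]: "A \<in> sets borel" and r: "0 < r" "\<And>y. y \<in> A \<Longrightarrow> r \<le> norm y"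
  shows "finite_measure (jumps A)"
proof
  have "emeasure \<nu> A < \<infinity>"
    using integrable_indicator_away[OF assms] by (simp add: integrable_indicator_iff)
  then show "emeasure (jumps A) (space (jumps A)) \<noteq> \<infinity>"
    by (simp add: jumps_def emeasure_density ennreal_indicator)
qed

lemma finite_measure_cutoff: "A \<in> sets borel \<Longrightarrow> finite_measure (jumps (cutoff A n))"
  by (rule finite_measure_jumps[where r="1 / real (Suc n)"]) (auto simp: cutoff_def)

lemma integrable_indicator_cutoff: "A \<in> sets borel \<Longrightarrow> integrable \<nu> (indicator (cutoff A n) :: 'a \<Rightarrow> real)"
  by (rule integrable_indicator_away[where r="1 / real (Suc n)"]) (auto simp: cutoff_def)

text \<open>Away from the origin the indicators of the cutoff sets eventually equal that of
  \<open>A\<close>; at the origin, which every cutoff set omits, \<open>f\<close> vanishes. The rest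
  is dominated convergence.\<close>

lemma tendsto_integral_cutoff:
  fixes f :: "'a \<Rightarrow> 'b::{banach, second_countable_topology}"
  assumes [measurable]: "A \<in> sets borel" and f: "integrable \<nu> (\<lambda>y. indicator A y *\<^sub>R f y)"
    and [measurable]: "f \<in> borel_measurable borel" and f0: "f 0 = 0"
  shows "(\<lambda>n. LINT y|jumps (cutoff A n). f y) \<longlonglongrightarrow> (LINT y|\<nu>. indicator A y *\<^sub>R f y)"
proof -
  have *: "(LINT y|jumps (cutoff A n). f y) = (LINT y|\<nu>. indicator (cutoff A n) y *\<^sub>R f y)" for n
    by (rule integral_jumps) measurable
  show ?thesis
    unfolding *
  proof (rule integral_dominated_convergence[where w="\<lambda>y. norm (indicator A y *\<^sub>R f y)"])
    show "integrable \<nu> (\<lambda>y. norm (indicator A y *\<^sub>R f y))" using f by (rule integrable_norm)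
    show "AE y in \<nu>. norm (indicator (cutoff A n) y *\<^sub>R f y) \<le> norm (indicator A y *\<^sub>R f y)" for n
      by (intro AE_I2) (auto simp: indicator_def cutoff_def)
    show "AE y in \<nu>. (\<lambda>n. indicator (cutoff A n) y *\<^sub>R f y) \<longlonglongrightarrow> indicator A y *\<^sub>R f y"
    proof (rule AE_I2)
      fix y :: 'a
      show "(\<lambda>n. indicator (cutoff A n) y *\<^sub>R f y) \<longlonglongrightarrow> indicator A y *\<^sub>R f y"
      proof (cases "y = 0")
        case True
        then show ?thesis by (simp add: f0)
      next
        case False
        then have "\<forall>\<^sub>F n in sequentially. 1 / real (Suc n) < norm y"
          using order_tendstoD(2)[OF LIMSEQ_Suc[OF lim_1_over_n], of "norm y"] by simp
        then have "\<forall>\<^sub>F n in sequentially. indicator (cutoff A n) y *\<^sub>R f y = indicator A y *\<^sub>R f y"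
          by eventually_elim (auto simp: cutoff_def indicator_def)
        then show ?thesis by (rule tendsto_eventually)
      qed
    qed
  qed measurable
qed

end

text \<open>For \<open>\<kappa> \<le> 1\<close> the power dominates min 1 |y|, and exp u - 1 \<ge>
  u. Integrability of the weight minus 1 thus forces jumps of finite variation, which need no
  compensation.\<close>

lemma min_one_le_powexp:
  assumes "0 < \<kappa>" "\<kappa> \<le> 1" "0 < lam"
  shows "lam * min 1 (norm y) \<le> powexp lam \<kappa> y - 1"
proof -
  have "min 1 (norm y) \<le> norm y powr \<kappa>"
  proof (cases "norm y \<le> 1")
    case True
    then show ?thesis using powr_mono'[of \<kappa> 1 "norm y"] assms by simp
  next
    case False
    then show ?thesis using assms ge_one_powr_ge_zero[of "norm y" \<kappa>] by simp
  qed
  then have "lam * min 1 (norm y) \<le> lam * norm y powr \<kappa>" using assms by simp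
  also have "\<dots> \<le> powexp lam \<kappa> y - 1"
    unfolding powexp_def using exp_ge_add_one_self[of "lam * norm y powr \<kappa>"] by linarith
  finally show ?thesis .
qed

lemma norm_iexp_minus_one_le: "norm (iexp u - 1) \<le> \<bar>u\<bar>"
  using iexp_approx1[of u 0] by simp

lemma norm_iexp_minus_one_le2: "norm (iexp u - 1) \<le> 2"
  by (rule order_trans[OF norm_triangle_ineq4]) simp

lemma (in levy_measure) integrable_iexp_minus_one:
  assumes k: "0 < \<kappa>" "\<kappa> \<le> 1" "0 < lam" and int: "integrable \<nu> (\<lambda>y. powexp lam \<kappa> y - 1)"
  shows "integrable \<nu> (\<lambda>y. iexp (\<xi> \<bullet> y) - 1)"
proof (rule Bochner_Integration.integrable_bound)
  \<comment> \<open>The constant joins two bounds of |exp (i u) - 1|: |u| \<le> |\<xi>| |y| for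
    small jumps and 2 for large ones.\<close>
  show "integrable \<nu> (\<lambda>y. (2 + norm \<xi>) / lam * (powexp lam \<kappa> y - 1))" using int by simp
  show "AE y in \<nu>. norm (iexp (\<xi> \<bullet> y) - 1) \<le> norm ((2 + norm \<xi>) / lam * (powexp lam \<kappa> y - 1))"
  proof (rule AE_I2)
    fix y :: 'a
    have "norm (iexp (\<xi> \<bullet> y) - 1) \<le> (2 + norm \<xi>) * min 1 (norm y)"
    proof (cases "norm y \<le> 1")
      case True
      have "norm (iexp (\<xi> \<bullet> y) - 1) \<le> norm \<xi> * norm y"
        using norm_iexp_minus_one_le[of "\<xi> \<bullet> y"] Cauchy_Schwarz_ineq2[of \<xi> y] by linarith
      then show ?thesis using True norm_ge_zero[of y] by (simp add: min_def distrib_right del: norm_ge_zero)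
    next
      case False
      then show ?thesis using norm_iexp_minus_one_le2[of "\<xi> \<bullet> y"] by (simp add: min_def) (smt (verit) norm_ge_zero)
    qed
    also have "\<dots> \<le> (2 + norm \<xi>) * ((powexp lam \<kappa> y - 1) / lam)"
      using min_one_le_powexp[OF k, of y] k by (intro mult_left_mono) (auto simp: le_divide_eq mult.commute)
    also have "\<dots> = (2 + norm \<xi>) / lam * (powexp lam \<kappa> y - 1)" by simp
    also have "\<dots> \<le> norm ((2 + norm \<xi>) / lam * (powexp lam \<kappa> y - 1))"
      by (simp only: real_norm_def abs_ge_self)
    finally show "norm (iexp (\<xi> \<bullet> y) - 1) \<le> norm ((2 + norm \<xi>) / lam * (powexp lam \<kappa> y - 1))" .
  qed
qed measurable

text \<open>Without compensation the drift does not depend on the cutoff. As the weight is at least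
  1, truncating the jumps only lowers the integral in the exponent, so the full integral bounds all
  approximants uniformly.\<close>

lemma (in levy_measure) powexp_bound_finite_variation:
  fixes \<mu> :: "'a measure"
  assumes \<mu>: "borel_prob \<mu>" and t: "0 \<le> t" and k: "0 < \<kappa>" "\<kappa> \<le> 1" "0 < lam"
    and int: "integrable \<nu> (\<lambda>y. powexp lam \<kappa> y - 1)"
    and cf: "\<And>\<xi>. charfn \<mu> \<xi> = exp (\<i> * (\<xi> \<bullet> (t *\<^sub>R a)) + t * (CLINT y|\<nu>. iexp (\<xi> \<bullet> y) - 1))"
  shows "(\<integral>\<^sup>+x. ennreal (powexp lam \<kappa> x) \<partial>\<mu>) \<le>
    ennreal (powexp lam \<kappa> (t *\<^sub>R a) * exp (t * (LINT y|\<nu>. powexp lam \<kappa> y - 1)))"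
proof -
  let ?g = "powexp lam \<kappa> :: 'a \<Rightarrow> real"
  let ?\<eta> = "\<lambda>n. jumps (cutoff UNIV n)"
  note int2 = integrable_iexp_minus_one[OF k int]
  have "(\<lambda>n. \<i> * (\<xi> \<bullet> (t *\<^sub>R a)) + t * (CLINT y|?\<eta> n. iexp (\<xi> \<bullet> y) - 1))
      \<longlonglongrightarrow> \<i> * (\<xi> \<bullet> (t *\<^sub>R a)) + t * (CLINT y|\<nu>. iexp (\<xi> \<bullet> y) - 1)" for \<xi>
    using tendsto_integral_cutoff[of UNIV "\<lambda>y. iexp (\<xi> \<bullet> y) - 1"] int2[of \<xi>]
    by (intro tendsto_intros) auto
  from compound_poisson_sequence[of ?\<eta>, OF finite_measure_cutoff sets_jumps t this]
  obtain N where N: "\<And>n. borel_prob (N n)"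
    and cfN: "\<And>\<xi>. (\<lambda>n. charfn (N n) \<xi>) \<longlonglongrightarrow> charfn \<mu> \<xi>"
    and hN: "\<And>n h. submult_weight h \<Longrightarrow> integrable (?\<eta> n) h \<Longrightarrow>
      (\<integral>\<^sup>+x. ennreal (h x) \<partial>N n) \<le> ennreal (h (t *\<^sub>R a) * exp (t * (LINT y|?\<eta> n. h y - 1)))"
    unfolding cf by auto
  show ?thesis
  proof (rule powexp_limit_bound[OF \<mu> N cfN k])
    fix n
    \<comment> \<open>The weight is integrable over the truncated jumps as the sum of an integrable
      excess over 1 and the constant 1 on a set of finite mass.\<close>
    have "indicator (cutoff UNIV n) y *\<^sub>R (?g y - 1) + indicator (cutoff UNIV n) y = indicator (cutoff UNIV n) y *\<^sub>R ?g y" for y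
      by (simp add: indicator_def)
    moreover have "integrable \<nu> (\<lambda>y. indicator (cutoff UNIV n) y *\<^sub>R (?g y - 1) + indicator (cutoff UNIV n) y)"
      by (intro Bochner_Integration.integrable_add integrable_mult_indicator integrable_indicator_cutoff int) auto
    ultimately have I: "integrable (?\<eta> n) ?g"
      by (simp add: integrable_jumps)
    have "(\<integral>\<^sup>+x. ennreal (?g x) \<partial>N n) \<le> ennreal (?g (t *\<^sub>R a) * exp (t * (LINT y|?\<eta> n. ?g y - 1)))"
      using hN[OF submult_weight_powexp[OF k] I] .
    also have "(LINT y|?\<eta> n. ?g y - 1) \<le> (LINT y|\<nu>. ?g y - 1)"
    proof -
      have "0 \<le> ?g y - 1" for y
        using k by (simp add: powexp_def)
      moreover have "integrable \<nu> (\<lambda>y. indicator (cutoff UNIV n) y *\<^sub>R (?g y - 1))"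
        by (intro integrable_mult_indicator int) auto
      ultimately have "(LINT y|\<nu>. indicator (cutoff UNIV n) y *\<^sub>R (?g y - 1)) \<le> (LINT y|\<nu>. ?g y - 1)"
        by (intro integral_mono int) (auto simp: indicator_def)
      then show ?thesis by (subst integral_jumps) auto
    qed
    finally show "(\<integral>\<^sup>+x. ennreal (?g x) \<partial>N n) \<le> ennreal (?g (t *\<^sub>R a) * exp (t * (LINT y|\<nu>. ?g y - 1)))"
      using t by (auto simp: mult_left_mono elim!: order_trans intro!: ennreal_leI mult_left_mono)
  qed
qed

section \<open>Compensated small jumps\<close>

lemma exp_minus_one_minus_le: "\<bar>exp u - 1 - u\<bar> \<le> exp \<bar>u\<bar> * u\<^sup>2" for u :: real
proof -
  have "norm (exp u - (\<Sum>i\<le>1. u ^ i / fact i)) \<le> exp (norm u) * norm u ^ Suc 1 / fact 1"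
    by (rule Taylor_exp_field)
  moreover have "exp u - (\<Sum>i\<le>1. u ^ i / fact i) = exp u - 1 - u" by simp
  moreover have "exp (norm u) * norm u ^ Suc 1 / fact 1 = exp \<bar>u\<bar> * u\<^sup>2" by (simp add: power2_eq_square)
  ultimately show ?thesis by (simp only: real_norm_def)
qed

lemma norm_iexp_taylor: "norm (iexp (\<xi> \<bullet> y) - 1 - \<i> * (\<xi> \<bullet> y)) \<le> (norm \<xi>)\<^sup>2 * (norm y)\<^sup>2"
proof -
  have "norm (iexp (\<xi> \<bullet> y) - 1 - \<i> * (\<xi> \<bullet> y)) \<le> (\<xi> \<bullet> y)\<^sup>2"
  proof -
    let ?u = "\<xi> \<bullet> y"
    have "norm (iexp ?u - (\<Sum>k\<le>1. (\<i> * ?u) ^ k / fact k)) \<le> \<bar>?u\<bar> ^ Suc 1 / fact (Suc 1)"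
      by (rule iexp_approx1)
    moreover have "iexp ?u - (\<Sum>k\<le>1. (\<i> * ?u) ^ k / fact k) = iexp ?u - 1 - \<i> * ?u" by simp
    moreover have "\<bar>?u\<bar> ^ Suc 1 / fact (Suc 1) = ?u\<^sup>2 / 2" by (simp add: power2_eq_square)
    ultimately have "norm (iexp ?u - 1 - \<i> * ?u) \<le> ?u\<^sup>2 / 2" by (simp only:)
    then show ?thesis using zero_le_power2[of ?u] by linarith
  qed
  also have "\<dots> \<le> (norm \<xi> * norm y)\<^sup>2"
    using Cauchy_Schwarz_ineq2[of \<xi> y] by (intro abs_le_square_iff[THEN iffD1]) simp
  finally show ?thesis by (simp add: power_mult_distrib)
qed

context levy_measure
begin

text \<open>The Levy-Khintchine integral is the negative of the sum of \<open>small_exponent\<close>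
  and \<open>large_exponent\<close>: the sign is that of the exponent of the characteristic
  function, not of \<psi>. Compensation is confined to the small part.\<close>

definition small_exponent :: "'a \<Rightarrow> complex" where
  "small_exponent \<xi> = (CLINT y|\<nu>. indicator {y. norm y < 1} y *\<^sub>R (iexp (\<xi> \<bullet> y) - 1 - \<i> * (\<xi> \<bullet> y)))"

definition large_exponent :: "'a \<Rightarrow> complex" where
  "large_exponent \<xi> = (CLINT y|\<nu>. indicator {y. 1 \<le> norm y} y *\<^sub>R (iexp (\<xi> \<bullet> y) - 1))"

lemma integrable_small_exponent:
  "integrable \<nu> (\<lambda>y. indicator {y. norm y < 1} y *\<^sub>R (iexp (\<xi> \<bullet> y) - 1 - \<i> * (\<xi> \<bullet> y)))"
proof (rule integrable_by_min[where C="(norm \<xi>)\<^sup>2"])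
  fix y :: 'a
  have "norm y < 1 \<Longrightarrow> (norm y)\<^sup>2 \<le> 1" by (intro power_le_one) auto
  then show "norm (indicator {y. norm y < 1} y *\<^sub>R (iexp (\<xi> \<bullet> y) - 1 - \<i> * (\<xi> \<bullet> y))) \<le> (norm \<xi>)\<^sup>2 * min 1 ((norm y)\<^sup>2)"
    using norm_iexp_taylor[of \<xi> y] by (auto simp: indicator_def min_def)
qed measurable

lemma integrable_large_exponent:
  "integrable \<nu> (\<lambda>y. indicator {y. 1 \<le> norm y} y *\<^sub>R (iexp (\<xi> \<bullet> y) - 1))"
proof (rule integrable_by_min[where C=2])
  fix y :: 'a
  have "1 \<le> norm y \<Longrightarrow> 1 \<le> (norm y)\<^sup>2" by simp
  then show "norm (indicator {y. 1 \<le> norm y} y *\<^sub>R (iexp (\<xi> \<bullet> y) - 1)) \<le> 2 * min 1 ((norm y)\<^sup>2)"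
    using norm_iexp_minus_one_le2[of "\<xi> \<bullet> y"] by (auto simp: indicator_def min_def)
qed measurable

lemma integrable_cutoff_bounded:
  fixes f :: "'a \<Rightarrow> 'b::{banach, second_countable_topology}"
  assumes [measurable]: "A \<in> sets borel" "f \<in> borel_measurable borel" and "\<And>y. y \<in> A \<Longrightarrow> norm (f y) \<le> c"
  shows "integrable (jumps (cutoff A n)) f"
proof -
  have "integrable \<nu> (\<lambda>y. c *\<^sub>R (indicator (cutoff A n) y :: real))"
    by (intro integrable_scaleR_right integrable_indicator_cutoff) auto
  then have "integrable \<nu> (\<lambda>y. indicator (cutoff A n) y *\<^sub>R f y)"
    by (rule Bochner_Integration.integrable_bound)
      (use assms cutoff_subset[of A n] in \<open>auto simp: indicator_def intro!: AE_I2 order_trans[OF _ abs_ge_self]\<close>)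
  then show ?thesis by (simp add: integrable_jumps)
qed

text \<open>The compensating drift \<open>- t *\<^sub>R b n\<close>, with \<open>b n\<close> the
  mean of the truncated jumps, may be unbounded in n. Against exp (y . w) it supplies exactly the
  term that completes exp (y . w) - 1 - y . w, which is of second order in y and hence integrable
  uniformly in n.\<close>

lemma small_jumps_sequence:
  assumes t: "0 \<le> t"
  obtains S where "\<And>n. borel_prob (S n)"
    and "\<And>\<xi>. (\<lambda>n. charfn (S n) \<xi>) \<longlonglongrightarrow> exp (t * small_exponent \<xi>)"
    and "\<And>n w. (\<integral>\<^sup>+y. ennreal (exp (y \<bullet> w)) \<partial>S n) \<le> ennreal (exp (t * ((norm w)\<^sup>2 * exp (norm w) * J)))"
proof -
  let ?B = "{y::'a. norm y < 1}"
  let ?\<eta> = "\<lambda>n. jumps (cutoff ?B n)"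
  define b where "b n = (LINT y|?\<eta> n. y)" for n
  have [measurable]: "?B \<in> sets borel" by measurable
  have int_id: "integrable (?\<eta> n) (\<lambda>y. y)" for n
    by (rule integrable_cutoff_bounded[where c=1]) auto
  have int1: "integrable (?\<eta> n) (\<lambda>y. iexp (\<xi> \<bullet> y) - 1)" for n \<xi>
    by (rule integrable_cutoff_bounded[where c=2]) (auto intro: norm_iexp_minus_one_le2)
  have expo: "\<i> * (\<xi> \<bullet> (- t *\<^sub>R b n)) + t * (CLINT y|?\<eta> n. iexp (\<xi> \<bullet> y) - 1) =
     t * (CLINT y|?\<eta> n. iexp (\<xi> \<bullet> y) - 1 - \<i> * (\<xi> \<bullet> y))" for n \<xi>
  proof -
    have "(CLINT y|?\<eta> n. \<i> * complex_of_real (\<xi> \<bullet> y)) = \<i> * complex_of_real (\<xi> \<bullet> b n)"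
      unfolding b_def using int_id[of n] by simp
    then show ?thesis
      using int_id[of n] int1[of n \<xi>]
      by (subst Bochner_Integration.integral_diff) (auto simp: algebra_simps)
  qed
  have "(\<lambda>n. \<i> * (\<xi> \<bullet> (- t *\<^sub>R b n)) + t * (CLINT y|?\<eta> n. iexp (\<xi> \<bullet> y) - 1)) \<longlonglongrightarrow> t * small_exponent \<xi>" for \<xi>
    unfolding expo small_exponent_def
    by (intro tendsto_intros tendsto_integral_cutoff integrable_small_exponent) auto
  note conv = this
  have fin: "finite_measure (?\<eta> n)" for n by (rule finite_measure_cutoff) measurable
  obtain S where S: "\<And>n. borel_prob (S n)"
    and cfS: "\<And>\<xi>. (\<lambda>n. charfn (S n) \<xi>) \<longlonglongrightarrow> exp (t * small_exponent \<xi>)"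
    and hS: "\<And>n h. submult_weight h \<Longrightarrow> integrable (?\<eta> n) h \<Longrightarrow>
      (\<integral>\<^sup>+x. ennreal (h x) \<partial>S n) \<le> ennreal (h (- t *\<^sub>R b n) * exp (t * (LINT y|?\<eta> n. h y - 1)))"
    by (rule compound_poisson_sequence[OF fin sets_jumps t conv]) blast
  show thesis
  proof (rule that[OF S cfS])
    fix n and w :: 'a
    have yw: "\<bar>y \<bullet> w\<bar> \<le> norm y * norm w" for y by (rule Cauchy_Schwarz_ineq2)
    have yw1: "\<bar>y \<bullet> w\<bar> \<le> norm w" if "norm y < 1" for y
      using yw[of y] mult_right_mono[of "norm y" 1 "norm w"] that by simp
    have int_exp: "integrable (?\<eta> n) (\<lambda>y. exp (y \<bullet> w))"
      using yw1 by (intro integrable_cutoff_bounded[where c="exp (norm w)"]) (auto simp: abs_le_iff)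
    interpret fm: finite_measure "?\<eta> n" by (rule fin)
    have bw: "(LINT y|?\<eta> n. y \<bullet> w) = b n \<bullet> w"
      unfolding b_def using int_id[of n] by simp
    \<comment> \<open>The subtracted term is what the drift contributes to the exponent, per unit of
      time; it becomes the compensator under the integral.\<close>
    have "(LINT y|?\<eta> n. exp (y \<bullet> w) - 1) - b n \<bullet> w = (LINT y|?\<eta> n. exp (y \<bullet> w) - 1 - y \<bullet> w)"
      using int_exp int_id[of n] by (subst (2) Bochner_Integration.integral_diff) (auto simp: bw)
    also have "\<dots> = (LINT y|\<nu>. indicator (cutoff ?B n) y *\<^sub>R (exp (y \<bullet> w) - 1 - y \<bullet> w))"
      by (rule integral_jumps) measurable
    also have "\<dots> \<le> (LINT y|\<nu>. ((norm w)\<^sup>2 * exp (norm w)) * min 1 ((norm y)\<^sup>2))"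
    proof (rule integral_mono)
      show "integrable \<nu> (\<lambda>y. indicator (cutoff ?B n) y *\<^sub>R (exp (y \<bullet> w) - 1 - y \<bullet> w))"
      proof (rule integrable_jumps[THEN iffD1])
        show "integrable (?\<eta> n) (\<lambda>y. exp (y \<bullet> w) - 1 - y \<bullet> w)"
          using int_exp int_id[of n] by auto
      qed measurable
      show "integrable \<nu> (\<lambda>y. ((norm w)\<^sup>2 * exp (norm w)) * min 1 ((norm y)\<^sup>2))"
        using integrable_min by simp
    next
      fix y :: 'a
      show "indicator (cutoff ?B n) y *\<^sub>R (exp (y \<bullet> w) - 1 - y \<bullet> w) \<le> ((norm w)\<^sup>2 * exp (norm w)) * min 1 ((norm y)\<^sup>2)"
      proof (cases "y \<in> cutoff ?B n")
        case True
        then have y: "norm y < 1" using cutoff_subset[of ?B n] by auto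
        have "exp (y \<bullet> w) - 1 - y \<bullet> w \<le> exp \<bar>y \<bullet> w\<bar> * (y \<bullet> w)\<^sup>2"
          using exp_minus_one_minus_le[of "y \<bullet> w"] by linarith
        also have "\<dots> \<le> exp (norm w) * (norm y * norm w)\<^sup>2"
          using yw1[OF y] yw[of y]
          by (intro mult_mono abs_le_square_iff[THEN iffD1]) auto
        also have "\<dots> = ((norm w)\<^sup>2 * exp (norm w)) * min 1 ((norm y)\<^sup>2)"
        proof -
          have "(norm y)\<^sup>2 \<le> 1" using y by (intro power_le_one) auto
          then show ?thesis by (simp add: min_def power_mult_distrib)
        qed
        finally show ?thesis using True by simp
      next
        case False
        then show ?thesis by simp
      qed
    qed
    also have "\<dots> = (norm w)\<^sup>2 * exp (norm w) * J"
      by (simp add: J_def)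
    finally have le: "(LINT y|?\<eta> n. exp (y \<bullet> w) - 1) - b n \<bullet> w \<le> (norm w)\<^sup>2 * exp (norm w) * J" .
    have "(\<integral>\<^sup>+y. ennreal (exp (y \<bullet> w)) \<partial>S n) \<le>
        ennreal (exp ((- t *\<^sub>R b n) \<bullet> w) * exp (t * (LINT y|?\<eta> n. exp (y \<bullet> w) - 1)))"
      by (rule hS[OF submult_weight_exp_inner int_exp])
    also have "\<dots> = ennreal (exp (t * ((LINT y|?\<eta> n. exp (y \<bullet> w) - 1) - b n \<bullet> w)))"
      by (simp add: algebra_simps flip: exp_add)
    also have "\<dots> \<le> ennreal (exp (t * ((norm w)\<^sup>2 * exp (norm w) * J)))"
      using mult_left_mono[OF le t] by (intro ennreal_leI) simp
    finally show "(\<integral>\<^sup>+y. ennreal (exp (y \<bullet> w)) \<partial>S n) \<le> ennreal (exp (t * ((norm w)\<^sup>2 * exp (norm w) * J)))" .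
  qed
qed

text \<open>Off the unit ball the measure is already finite, so the jump measures form a constant
  sequence; only the error of the approximation by rare jumps depends on n. The drift of the process
  is accounted for here, where the weight itself is available.\<close>

lemma large_jumps_sequence:
  assumes t: "0 \<le> t" and k: "0 < \<kappa>" "\<kappa> \<le> 1" "0 < lam"
    and int: "integrable \<nu> (\<lambda>y. indicator {y. 1 \<le> norm y} y * powexp lam \<kappa> y)"
  defines "K \<equiv> (LINT y|\<nu>. indicator {y. 1 \<le> norm y} y * (powexp lam \<kappa> y - 1))"
  obtains S where "\<And>n::nat. borel_prob (S n)"
    and "\<And>\<xi>. (\<lambda>n. charfn (S n) \<xi>) \<longlonglongrightarrow> exp (\<i> * (\<xi> \<bullet> (t *\<^sub>R a)) + t * large_exponent \<xi>)"
    and "\<And>n. (\<integral>\<^sup>+y. ennreal (powexp lam \<kappa> y) \<partial>S n) \<le> ennreal (powexp lam \<kappa> (t *\<^sub>R a) * exp (t * K))"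
proof -
  let ?B = "{y::'a. 1 \<le> norm y}"
  let ?\<eta> = "\<lambda>n::nat. jumps ?B"
  have [measurable]: "?B \<in> sets borel" by measurable
  have fin: "finite_measure (?\<eta> n)" for n
    by (rule finite_measure_jumps[where r=1]) auto
  have "(CLINT y|?\<eta> n. iexp (\<xi> \<bullet> y) - 1) = large_exponent \<xi>" for \<xi> n
    unfolding large_exponent_def by (rule integral_jumps) measurable
  then have "(\<lambda>n. \<i> * (\<xi> \<bullet> (t *\<^sub>R a)) + t * (CLINT y|?\<eta> n. iexp (\<xi> \<bullet> y) - 1)) \<longlonglongrightarrow>
     \<i> * (\<xi> \<bullet> (t *\<^sub>R a)) + t * large_exponent \<xi>" for \<xi>
    by simp
  from compound_poisson_sequence[of ?\<eta>, OF fin sets_jumps t this]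
  obtain S where S: "\<And>n. borel_prob (S n)"
    and cfS: "\<And>\<xi>. (\<lambda>n. charfn (S n) \<xi>) \<longlonglongrightarrow> exp (\<i> * (\<xi> \<bullet> (t *\<^sub>R a)) + t * large_exponent \<xi>)"
    and hS: "\<And>n h. submult_weight h \<Longrightarrow> integrable (?\<eta> n) h \<Longrightarrow>
      (\<integral>\<^sup>+x. ennreal (h x) \<partial>S n) \<le> ennreal (h (t *\<^sub>R a) * exp (t * (LINT y|?\<eta> n. h y - 1)))"
    by auto
  show thesis
  proof (rule that[OF S cfS])
    fix n
    have "integrable (?\<eta> n) (powexp lam \<kappa>)"
      using int by (subst integrable_jumps) auto
    from hS[OF submult_weight_powexp[OF k] this]
    show "(\<integral>\<^sup>+y. ennreal (powexp lam \<kappa> y) \<partial>S n) \<le> ennreal (powexp lam \<kappa> (t *\<^sub>R a) * exp (t * K))"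
      unfolding K_def by (subst (asm) integral_jumps) auto
  qed
qed

end

text \<open>The functions cosh - 1 combine what the left side needs: quadratic vanishing at 0 and
  exponential growth. A coordinate of largest modulus carries the norm up to the factor d, and the
  remaining summands are nonnegative.\<close>

lemma norm_sq_exp_le_cosh:
  fixes y :: "'a::euclidean_space"
  assumes lam: "0 < lam"
  shows "(norm y)\<^sup>2 * exp (lam * norm y) \<le>
    2 * (real DIM('a))\<^sup>2 * (\<Sum>b\<in>Basis. cosh ((4 + lam * real DIM('a)) * (y \<bullet> b)) - 1)"
proof -
  let ?d = "real DIM('a)"
  have "Max ((\<lambda>b. \<bar>y \<bullet> b\<bar>) ` Basis) \<in> (\<lambda>b. \<bar>y \<bullet> b\<bar>) ` Basis"
    by (rule Max_in) auto
  then obtain b0 where b0: "b0 \<in> Basis" "\<bar>y \<bullet> b0\<bar> = Max ((\<lambda>b. \<bar>y \<bullet> b\<bar>) ` Basis)"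
    by (metis (no_types, lifting) imageE)
  have "norm y \<le> (\<Sum>b\<in>Basis. \<bar>y \<bullet> b\<bar>)" by (rule norm_le_l1)
  also have "\<dots> \<le> (\<Sum>b\<in>(Basis::'a set). \<bar>y \<bullet> b0\<bar>)"
    unfolding b0(2) by (intro sum_mono) auto
  finally have ny: "norm y \<le> ?d * \<bar>y \<bullet> b0\<bar>" by simp
  define u where "u = \<bar>y \<bullet> b0\<bar>"
  define \<alpha> where "\<alpha> = lam * ?d"
  have u: "0 \<le> u" and \<alpha>: "0 \<le> \<alpha>" using lam by (auto simp: u_def \<alpha>_def)
  have "(norm y)\<^sup>2 * exp (lam * norm y) \<le> (?d * u)\<^sup>2 * exp (lam * (?d * u))"
    using ny lam unfolding u_def[symmetric] by (intro mult_mono power_mono) auto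
  also have "\<dots> = ?d\<^sup>2 * (u\<^sup>2 * exp (\<alpha> * u))"
    by (simp add: power_mult_distrib \<alpha>_def mult_ac)
  also have "u\<^sup>2 * exp (\<alpha> * u) \<le> 2 * (cosh ((4 + \<alpha>) * u) - 1)"
  proof -
    \<comment> \<open>The bound is proved for square roots: u exp (- u) \<le> sinh u and exp (x) / 2
      \<le> cosh x at x = (1 + \<alpha> / 2) u multiply to u exp (\<alpha> u / 2) / 2 \<le> sinh v.
      Squaring doubles the argument v = (2 + \<alpha> / 2) u, whence the constant 4 +
      \<alpha>.\<close>
    let ?v = "u + (1 + \<alpha> / 2) * u"
    have "u * exp (- u) \<le> sinh u"
    proof -
      have "(1 + 2 * u) * exp (- u) \<le> exp (2 * u) * exp (- u)"
        using exp_ge_add_one_self[of "2 * u"] by (intro mult_right_mono) auto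
      then show ?thesis by (simp add: sinh_def algebra_simps flip: exp_add)
    qed
    moreover have "exp ((1 + \<alpha> / 2) * u) / 2 \<le> cosh ((1 + \<alpha> / 2) * u)"
      by (simp add: cosh_def)
    ultimately have "(u * exp (- u)) * (exp ((1 + \<alpha> / 2) * u) / 2) \<le> sinh u * cosh ((1 + \<alpha> / 2) * u)"
      using u by (intro mult_mono) auto
    also have "(u * exp (- u)) * (exp ((1 + \<alpha> / 2) * u) / 2) = u * (exp (\<alpha> * u / 2) / 2)"
      by (simp add: algebra_simps flip: exp_add)
    also have "sinh u * cosh ((1 + \<alpha> / 2) * u) \<le> sinh ?v"
      using u \<alpha> unfolding sinh_add by simp
    finally have "(u * (exp (\<alpha> * u / 2) / 2))\<^sup>2 \<le> (sinh ?v)\<^sup>2"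
      using u by (intro power_mono) auto
    moreover have "cosh (2 * ?v) - 1 = 2 * (sinh ?v)\<^sup>2"
      unfolding cosh_double cosh_square_eq by simp
    moreover have "(u * (exp (\<alpha> * u / 2) / 2))\<^sup>2 = u\<^sup>2 * exp (\<alpha> * u) / 4"
      by (simp add: power_mult_distrib power_divide flip: exp_double)
    ultimately show ?thesis by (simp add: algebra_simps)
  qed
  also have "cosh ((4 + \<alpha>) * u) - 1 = cosh ((4 + \<alpha>) * (y \<bullet> b0)) - 1"
    by (cases "0 \<le> y \<bullet> b0") (auto simp: u_def abs_if)
  also have "\<dots> \<le> (\<Sum>b\<in>Basis. cosh ((4 + \<alpha>) * (y \<bullet> b)) - 1)"
    using b0(1) by (intro member_le_sum) (auto simp: cosh_real_ge_1)
  finally show ?thesis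
    by (simp add: \<alpha>_def mult_left_mono mult.assoc mult.left_commute)
qed

lemma exp_minus_one_le: "exp u - 1 \<le> u * exp u" for u :: real
proof -
  have "(1 + - u) * exp u \<le> exp (- u) * exp u"
    by (intro mult_right_mono exp_ge_add_one_self) auto
  then show ?thesis by (simp add: algebra_simps flip: exp_add)
qed

lemma exp_norm_le:
  fixes y :: "'a::real_normed_vector"
  assumes "0 < lam"
  shows "exp (lam * norm y) \<le> exp lam + (norm y)\<^sup>2 * exp (lam * norm y)"
proof (cases "norm y \<le> 1")
  case True
  then have "exp (lam * norm y) \<le> exp lam" using assms by simp
  then show ?thesis by (simp add: add_increasing2)
next
  case False
  then have "1 \<le> (norm y)\<^sup>2" by simp
  then have "1 * exp (lam * norm y) \<le> (norm y)\<^sup>2 * exp (lam * norm y)" by (intro mult_right_mono) auto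
  then show ?thesis by (simp add: add_increasing)
qed

text \<open>The compensated jumps up to time t have size sqrt t, so |y|^2 / t stays bounded on
  average. Bounding the excess over 1 by u exp u, with u the exponent of the weight, keeps the
  factor t^(kappa/2) in front of everything else.\<close>

lemma powexp_le_small_time:
  assumes k: "0 < \<kappa>" "\<kappa> \<le> 1" "0 < lam" and t: "0 < t" "t < 1"
  shows "powexp lam \<kappa> y \<le> 1 + lam * t powr (\<kappa> / 2) * exp lam *
    (exp lam + 2 / t * ((norm y)\<^sup>2 * exp (lam * norm y)))"
proof -
  let ?G = "(norm y)\<^sup>2 * exp (lam * norm y)"
  have "(norm y / sqrt t) powr \<kappa> \<le> 1 + (norm y / sqrt t) powr 2"
    using k t by (intro powr_le_one_plus) auto
  also have "(norm y / sqrt t) powr 2 = (norm y)\<^sup>2 / t"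
    using t by (subst powr_numeral) (auto simp: power_divide)
  finally have "norm y powr \<kappa> \<le> t powr (\<kappa> / 2) * (1 + (norm y)\<^sup>2 / t)"
    using t by (simp add: powr_divide divide_le_eq powr_half_sqrt[symmetric] powr_powr mult.commute)
  then have 1: "lam * norm y powr \<kappa> \<le> lam * t powr (\<kappa> / 2) * (1 + (norm y)\<^sup>2 / t)"
    using k by (simp add: mult.assoc)
  note 2 = exp_norm_le[OF k(3), of y]
  have "(1 + (norm y)\<^sup>2 / t) * exp (lam * norm y) = exp (lam * norm y) + 1 / t * ?G"
    by (simp add: algebra_simps)
  also have "\<dots> \<le> exp lam + 1 / t * ?G + 1 / t * ?G"
  proof -
    have "?G \<le> 1 / t * ?G" using t mult_right_mono[of 1 "1 / t" ?G] by simp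
    with 2 show ?thesis by linarith
  qed
  finally have 3: "(1 + (norm y)\<^sup>2 / t) * exp (lam * norm y) \<le> exp lam + 2 / t * ?G" by (simp add: mult_ac)
  have "powexp lam \<kappa> y \<le> 1 + lam * norm y powr \<kappa> * powexp lam \<kappa> y"
    unfolding powexp_def using exp_minus_one_le[of "lam * norm y powr \<kappa>"] by linarith
  also have "\<dots> \<le> 1 + (lam * t powr (\<kappa> / 2) * (1 + (norm y)\<^sup>2 / t)) * (exp lam * exp (lam * norm y))"
  proof (rule add_left_mono, rule mult_mono[OF 1])
    show "powexp lam \<kappa> y \<le> exp lam * exp (lam * norm y)"
      using powexp_le_exp[OF k, of y] by (simp add: distrib_left exp_add)
  qed (use k t in auto)
  also have "\<dots> = 1 + lam * t powr (\<kappa> / 2) * exp lam * ((1 + (norm y)\<^sup>2 / t) * exp (lam * norm y))"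
    by (simp add: mult_ac)
  also have "\<dots> \<le> 1 + lam * t powr (\<kappa> / 2) * exp lam * (exp lam + 2 / t * ?G)"
    using k by (intro add_left_mono mult_left_mono 3) auto
  finally show ?thesis .
qed

lemma powexp_le_large_time:
  assumes k: "0 < \<kappa>" "\<kappa> \<le> 1" "0 < lam"
  shows "powexp lam \<kappa> y \<le> exp lam * (exp lam + (norm y)\<^sup>2 * exp (lam * norm y))"
proof -
  let ?G = "(norm y)\<^sup>2 * exp (lam * norm y)"
  have "exp lam * exp (lam * norm y) \<le> exp lam * (exp lam + ?G)"
    using exp_norm_le[OF k(3), of y] by simp
  then show ?thesis
    using powexp_le_exp[OF k, of y] by (simp add: distrib_left exp_add)
qed

text \<open>Exponential moments on one sphere control all coordinates in both directions, hence the
  hyperbolic cosines that dominate |y|^2 exp (lam |y|). Small times use that E (cosh - 1) is of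
  order t; large times only use its exponential rate.\<close>

lemma powexp_moment_from_exponential_moments:
  fixes S :: "'a::euclidean_space measure"
  assumes "borel_prob S" and k: "0 < \<kappa>" "\<kappa> \<le> 1" "0 < lam" and K: "0 \<le> K" and t: "0 < t"
    and mom: "\<And>w. norm w = 4 + lam * real DIM('a) \<Longrightarrow> (\<integral>\<^sup>+y. ennreal (exp (y \<bullet> w)) \<partial>S) \<le> ennreal (exp (t * K))"
  shows "t < 1 \<Longrightarrow> (\<integral>\<^sup>+y. ennreal (powexp lam \<kappa> y) \<partial>S) \<le>
       ennreal (exp (lam * exp lam * (exp lam + 4 * real DIM('a) ^ 3 * (K * exp K)) * t powr (\<kappa> / 2)))"
    and "1 \<le> t \<Longrightarrow> (\<integral>\<^sup>+y. ennreal (powexp lam \<kappa> y) \<partial>S) \<le>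
       ennreal (exp ((2 * lam + 2 * real DIM('a) ^ 3 + K) * t))"
proof -
  interpret borel_prob S by fact
  let ?d = "real DIM('a)"
  define c where "c = 4 + lam * ?d"
  have c: "0 < c" using k by (simp add: c_def add_pos_nonneg)
  define F where "F y = (\<Sum>b\<in>Basis. cosh (c * (y \<bullet> b)) - 1)" for y :: 'a
  define G where "G y = (norm y)\<^sup>2 * exp (lam * norm y)" for y :: 'a
  have G0: "0 \<le> G y" for y by (simp add: G_def)
  have [measurable]: "G \<in> borel_measurable borel" unfolding G_def[abs_def] by measurable
  have e: "integrable S (\<lambda>y. exp (y \<bullet> w))" "(LINT y|S. exp (y \<bullet> w)) \<le> exp (t * K)" if "norm w = c" for w
  proof -
    show I: "integrable S (\<lambda>y. exp (y \<bullet> w))"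
      using mom[of w] that by (intro integrableI_nonneg) (auto simp: c_def intro: le_less_trans)
    have "ennreal (LINT y|S. exp (y \<bullet> w)) \<le> ennreal (exp (t * K))"
      using mom[of w] that by (subst nn_integral_eq_integral[symmetric]) (auto simp: c_def I[unfolded c_def])
    then show "(LINT y|S. exp (y \<bullet> w)) \<le> exp (t * K)" by simp
  qed
  have ch: "integrable S (\<lambda>y. cosh (c * (y \<bullet> b)) - 1)" "(LINT y|S. cosh (c * (y \<bullet> b)) - 1) \<le> exp (t * K) - 1"
    if b: "b \<in> Basis" for b
  proof -
    \<comment> \<open>Averaging two opposite exponentials and subtracting the value at 0 leaves exp
      (t K) - 1, which is small with t and not merely bounded.\<close>
    have "norm (c *\<^sub>R b) = c" "norm (- c *\<^sub>R b) = c" using b c by auto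
    note e1 = e[OF this(1)] and e2 = e[OF this(2)]
    have eq: "cosh (c * (y \<bullet> b)) - 1 = (exp (y \<bullet> (c *\<^sub>R b)) + exp (y \<bullet> (- c *\<^sub>R b))) / 2 - 1" for y
      by (simp add: cosh_def)
    show "integrable S (\<lambda>y. cosh (c * (y \<bullet> b)) - 1)"
      unfolding eq using e1(1) e2(1) by (intro Bochner_Integration.integrable_diff integrable_divide Bochner_Integration.integrable_add) auto
    have "(LINT y|S. cosh (c * (y \<bullet> b)) - 1) = ((LINT y|S. exp (y \<bullet> (c *\<^sub>R b))) + (LINT y|S. exp (y \<bullet> (- c *\<^sub>R b)))) / 2 - 1"
      unfolding eq using e1(1) e2(1)
      by (subst Bochner_Integration.integral_diff) (auto simp: prob_space)
    also have "\<dots> \<le> exp (t * K) - 1" using e1(2) e2(2) by simp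
    finally show "(LINT y|S. cosh (c * (y \<bullet> b)) - 1) \<le> exp (t * K) - 1" .
  qed
  have F: "integrable S F" unfolding F_def using ch(1) by auto
  have "(LINT y|S. F y) = (\<Sum>b\<in>Basis. LINT y|S. cosh (c * (y \<bullet> b)) - 1)"
    unfolding F_def using ch(1) by (intro Bochner_Integration.integral_sum) auto
  also have "\<dots> \<le> (\<Sum>b\<in>(Basis::'a set). exp (t * K) - 1)"
    by (intro sum_mono ch(2))
  finally have F': "(LINT y|S. F y) \<le> ?d * (exp (t * K) - 1)" by simp
  have GF: "G y \<le> 2 * ?d\<^sup>2 * F y" for y
    unfolding G_def F_def c_def by (rule norm_sq_exp_le_cosh[OF k(3)])
  have G: "integrable S G"
  proof (rule Bochner_Integration.integrable_bound)
    show "integrable S (\<lambda>y. 2 * ?d\<^sup>2 * F y)" using F by simp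
    show "AE y in S. norm (G y) \<le> norm (2 * ?d\<^sup>2 * F y)"
    proof (rule AE_I2)
      fix y
      have "norm (G y) = G y" using G0[of y] by simp
      also have "\<dots> \<le> norm (2 * ?d\<^sup>2 * F y)" using GF[of y] by (simp only: real_norm_def abs_ge_self order_trans[OF GF])
      finally show "norm (G y) \<le> norm (2 * ?d\<^sup>2 * F y)" .
    qed
  qed measurable
  have "(LINT y|S. G y) \<le> (LINT y|S. 2 * ?d\<^sup>2 * F y)"
    using F G GF by (intro integral_mono) auto
  also have "\<dots> \<le> 2 * ?d\<^sup>2 * (?d * (exp (t * K) - 1))"
    using F' by (simp add: mult_left_mono)
  \<comment> \<open>One factor d counts the coordinates; the other two come from comparing the norm
    with its largest coordinate.\<close>
  finally have G': "(LINT y|S. G y) \<le> 2 * ?d ^ 3 * (exp (t * K) - 1)"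
    by (simp add: power2_eq_square power3_eq_cube mult.assoc)
  {
    assume t1: "t < 1"
    let ?A = "lam * t powr (\<kappa> / 2) * exp lam"
    have "exp (t * K) - 1 \<le> t * K * exp (t * K)" by (rule exp_minus_one_le)
    also have "\<dots> \<le> t * K * exp K"
      using t t1 K by (intro mult_left_mono) (auto simp: mult_left_le_one_le)
    finally have tK: "exp (t * K) - 1 \<le> t * (K * exp K)" by (simp add: mult_ac)
    have "(\<integral>\<^sup>+y. ennreal (powexp lam \<kappa> y) \<partial>S) \<le> (\<integral>\<^sup>+y. ennreal (1 + ?A * (exp lam + 2 / t * G y)) \<partial>S)"
      unfolding G_def by (intro nn_integral_mono ennreal_leI powexp_le_small_time[OF k t t1])
    also have "\<dots> = ennreal (LINT y|S. 1 + ?A * (exp lam + 2 / t * G y))"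
      using G k t G0 by (intro nn_integral_eq_integral) auto
    also have "(LINT y|S. 1 + ?A * (exp lam + 2 / t * G y)) = 1 + ?A * (exp lam + 2 / t * (LINT y|S. G y))"
      using G by (simp add: prob_space)
    \<comment> \<open>The factor t in the bound of exp (t K) - 1 cancels 1 / t, so t powr (\<kappa>
      / 2) is the only power of t left.\<close>
    also have "\<dots> \<le> 1 + ?A * (exp lam + 2 / t * (2 * ?d ^ 3 * (t * (K * exp K))))"
      using k t G' tK
      by (intro add_left_mono mult_left_mono order_trans[OF G']) auto
    also have "\<dots> = 1 + lam * exp lam * (exp lam + 4 * ?d ^ 3 * (K * exp K)) * t powr (\<kappa> / 2)"
      using t by (simp add: mult_ac)
    also have "\<dots> \<le> exp (lam * exp lam * (exp lam + 4 * ?d ^ 3 * (K * exp K)) * t powr (\<kappa> / 2))"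
      by (rule exp_ge_add_one_self)
    finally show "(\<integral>\<^sup>+y. ennreal (powexp lam \<kappa> y) \<partial>S) \<le>
       ennreal (exp (lam * exp lam * (exp lam + 4 * ?d ^ 3 * (K * exp K)) * t powr (\<kappa> / 2)))"
      by (simp add: ennreal_leI)
  }
  {
    assume t1: "1 \<le> t"
    have "(\<integral>\<^sup>+y. ennreal (powexp lam \<kappa> y) \<partial>S) \<le> (\<integral>\<^sup>+y. ennreal (exp lam * (exp lam + G y)) \<partial>S)"
      unfolding G_def by (intro nn_integral_mono ennreal_leI powexp_le_large_time[OF k])
    also have "\<dots> = ennreal (LINT y|S. exp lam * (exp lam + G y))"
      using G G0 by (intro nn_integral_eq_integral) auto
    also have "(LINT y|S. exp lam * (exp lam + G y)) = exp lam * (exp lam + (LINT y|S. G y))"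
      using G by (simp add: prob_space)
    also have "\<dots> \<le> exp lam * (exp lam + 2 * ?d ^ 3 * exp (t * K))"
      by (intro mult_left_mono add_left_mono order_trans[OF G']) auto
    also have "\<dots> \<le> exp lam * (exp lam * exp (t * K) + exp lam * (2 * ?d ^ 3 * exp (t * K)))"
    proof -
      have "1 \<le> exp (t * K)" "1 \<le> exp lam" using t K k by auto
      then have "exp lam \<le> exp lam * exp (t * K)" "2 * ?d ^ 3 * exp (t * K) \<le> exp lam * (2 * ?d ^ 3 * exp (t * K))"
        using mult_left_mono[of 1 "exp (t * K)" "exp lam"] mult_right_mono[of 1 "exp lam" "2 * ?d ^ 3 * exp (t * K)"] by auto
      then show ?thesis by (intro mult_left_mono add_mono) auto
    qed
    also have "\<dots> = exp (2 * lam + t * K) * (1 + 2 * ?d ^ 3)"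
    proof -
      have "exp (2 * lam + t * K) = exp lam * exp lam * exp (t * K)" by (simp flip: exp_add)
      then show ?thesis by (simp add: algebra_simps)
    qed
    \<comment> \<open>The claim leaves no room for a constant prefactor; 1 + u \<le> exp u moves it
      into the exponent, where t \<ge> 1 allows a multiplication by t.\<close>
    also have "\<dots> \<le> exp (2 * lam + t * K) * exp (2 * ?d ^ 3)"
      by (intro mult_left_mono exp_ge_add_one_self) auto
    also have "\<dots> \<le> exp ((2 * lam + 2 * ?d ^ 3 + K) * t)"
    proof -
      have "(2 * lam + 2 * ?d ^ 3) * 1 \<le> (2 * lam + 2 * ?d ^ 3) * t"
        using t1 k by (intro mult_left_mono) auto
      then have "2 * lam + t * K + 2 * ?d ^ 3 \<le> (2 * lam + 2 * ?d ^ 3 + K) * t"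
        by (simp add: algebra_simps)
      then show ?thesis by (simp flip: exp_add)
    qed
    finally show "(\<integral>\<^sup>+y. ennreal (powexp lam \<kappa> y) \<partial>S) \<le> ennreal (exp ((2 * lam + 2 * ?d ^ 3 + K) * t))"
      by (simp add: ennreal_leI)
  }
qed

text \<open>Small and large jumps are approximated separately and convolved; submultiplicativity
  multiplies their bounds. All constants are fixed before t is chosen, so that one \<open>C\<close>
  serves every time.\<close>

lemma (in levy_measure) powexp_bound:
  fixes \<mu> :: "real \<Rightarrow> 'a measure"
  assumes \<mu>: "\<And>t. 0 < t \<Longrightarrow> borel_prob (\<mu> t)" and k: "0 < \<kappa>" "\<kappa> \<le> 1" "0 < lam"
    and int: "integrable \<nu> (\<lambda>y. indicator {y. 1 \<le> norm y} y * powexp lam \<kappa> y)"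
    and cf: "\<And>t \<xi>. 0 < t \<Longrightarrow> charfn (\<mu> t) \<xi> = exp (t * (\<i> * (\<xi> \<bullet> a) + small_exponent \<xi> + large_exponent \<xi>))"
  obtains C where "0 < C"
    and "\<And>t. 0 < t \<Longrightarrow> t < 1 \<Longrightarrow> (\<integral>\<^sup>+x. ennreal (powexp lam \<kappa> x) \<partial>\<mu> t) \<le> ennreal (exp (C * t powr (\<kappa> / 2)))"
    and "\<And>t. 1 \<le> t \<Longrightarrow> (\<integral>\<^sup>+x. ennreal (powexp lam \<kappa> x) \<partial>\<mu> t) \<le> ennreal (exp (C * t))"
proof -
  let ?d = "real DIM('a)"
  define c where "c = 4 + lam * ?d"
  define K where "K = c\<^sup>2 * exp c * J"
  have K: "0 \<le> K" using J_nonneg by (simp add: K_def)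
  define L where "L = (LINT y|\<nu>. indicator {y. 1 \<le> norm y} y * (powexp lam \<kappa> y - 1))"
  have L: "0 \<le> L" unfolding L_def
    using k by (intro integral_nonneg_AE AE_I2) (auto simp: indicator_def powexp_def)
  define C1 where "C1 = lam * exp lam * (exp lam + 4 * ?d ^ 3 * (K * exp K))"
  define C2 where "C2 = 2 * lam + 2 * ?d ^ 3 + K"
  have C1: "0 < C1" unfolding C1_def using k K by (intro mult_pos_pos add_pos_nonneg) auto
  have C2: "0 \<le> C2" unfolding C2_def using k K by auto
  define C3 where "C3 = lam * norm a powr \<kappa>"
  have C3: "0 \<le> C3" unfolding C3_def using k by auto
  define B where "B t = (if t < 1 then exp (C1 * t powr (\<kappa> / 2)) else exp (C2 * t))" for t :: real
  have main: "(\<integral>\<^sup>+x. ennreal (powexp lam \<kappa> x) \<partial>\<mu> t) \<le> ennreal (B t * (exp (C3 * t powr \<kappa>) * exp (t * L)))"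
    if t: "0 < t" for t
  proof -
    have t0: "0 \<le> t" using t by simp
    obtain S where S: "\<And>n. borel_prob (S n)"
      and cfS: "\<And>\<xi>. (\<lambda>n. charfn (S n) \<xi>) \<longlonglongrightarrow> exp (t * small_exponent \<xi>)"
      and mS: "\<And>n w. (\<integral>\<^sup>+y. ennreal (exp (y \<bullet> w)) \<partial>S n) \<le> ennreal (exp (t * ((norm w)\<^sup>2 * exp (norm w) * J)))"
      by (rule small_jumps_sequence[OF t0]) blast
    obtain T where T: "\<And>n::nat. borel_prob (T n)"
      and cfT: "\<And>\<xi>. (\<lambda>n. charfn (T n) \<xi>) \<longlonglongrightarrow> exp (\<i> * (\<xi> \<bullet> (t *\<^sub>R a)) + t * large_exponent \<xi>)"
      and mT: "\<And>n. (\<integral>\<^sup>+y. ennreal (powexp lam \<kappa> y) \<partial>T n) \<le> ennreal (powexp lam \<kappa> (t *\<^sub>R a) * exp (t * L))"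
      unfolding L_def by (rule large_jumps_sequence[OF t0 k int, of a]) blast
    have mS': "(\<integral>\<^sup>+y. ennreal (powexp lam \<kappa> y) \<partial>S n) \<le> ennreal (B t)" for n
    proof -
      have "(\<integral>\<^sup>+y. ennreal (exp (y \<bullet> w)) \<partial>S n) \<le> ennreal (exp (t * K))" if "norm w = 4 + lam * ?d" for w
        using mS[of n w] that by (simp add: K_def c_def)
      from powexp_moment_from_exponential_moments[OF S[of n] k K t this]
      show ?thesis by (cases "t < 1") (simp_all add: B_def C1_def C2_def)
    qed
    have pa: "powexp lam \<kappa> (t *\<^sub>R a) = exp (C3 * t powr \<kappa>)"
      using t by (simp add: powexp_def C3_def powr_mult mult_ac)
    show ?thesis
    proof (rule powexp_limit_bound[OF \<mu>[OF t] borel_prob_convolution[OF S T] _ k])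
      fix \<xi>
      have "(\<lambda>n. charfn (S n) \<xi> * charfn (T n) \<xi>) \<longlonglongrightarrow>
          exp (t * small_exponent \<xi>) * exp (\<i> * (\<xi> \<bullet> (t *\<^sub>R a)) + t * large_exponent \<xi>)"
        by (intro tendsto_mult cfS cfT)
      also have "exp (t * small_exponent \<xi>) * exp (\<i> * (\<xi> \<bullet> (t *\<^sub>R a)) + t * large_exponent \<xi>) = charfn (\<mu> t) \<xi>"
        by (simp add: cf[OF t] algebra_simps flip: exp_add)
      finally show "(\<lambda>n. charfn (S n \<star> T n) \<xi>) \<longlonglongrightarrow> charfn (\<mu> t) \<xi>"
        by (simp add: charfn_convolution S T)
    next
      fix n
      have "(\<integral>\<^sup>+x. ennreal (powexp lam \<kappa> x) \<partial>(S n \<star> T n)) \<le>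
         (\<integral>\<^sup>+x. ennreal (powexp lam \<kappa> x) \<partial>S n) * (\<integral>\<^sup>+x. ennreal (powexp lam \<kappa> x) \<partial>T n)"
        by (intro nn_integral_convolution_le S T submult_weight_powexp k)
      also have "\<dots> \<le> ennreal (B t) * ennreal (powexp lam \<kappa> (t *\<^sub>R a) * exp (t * L))"
        by (intro mult_mono mS' mT) auto
      finally show "(\<integral>\<^sup>+x. ennreal (powexp lam \<kappa> x) \<partial>(S n \<star> T n)) \<le> ennreal (B t * (exp (C3 * t powr \<kappa>) * exp (t * L)))"
        by (simp add: pa B_def ennreal_mult')
    qed
  qed
  \<comment> \<open>Below 1, both t^kappa and t are at most t^(kappa/2); from 1 on, t^kappa is at
    most t. The sum of all rates therefore serves both regimes.\<close>
  let ?C = "C1 + C2 + C3 + L"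
  show thesis
  proof (rule that[of ?C])
    show "0 < ?C" using C1 C2 C3 L by simp
  next
    fix t :: real assume t: "0 < t" "t < 1"
    have "t powr \<kappa> \<le> t powr (\<kappa> / 2)" "t powr 1 \<le> t powr (\<kappa> / 2)"
      using t k by (intro powr_mono'; simp)+
    then have "C1 * t powr (\<kappa> / 2) + (C3 * t powr \<kappa> + t * L) \<le> C1 * t powr (\<kappa> / 2) + (C3 * t powr (\<kappa> / 2) + t powr (\<kappa> / 2) * L)"
      using C3 L t by (intro add_left_mono add_mono mult_left_mono mult_right_mono) auto
    also have "\<dots> \<le> ?C * t powr (\<kappa> / 2)"
      using C2 by (simp add: algebra_simps)
    finally have "B t * (exp (C3 * t powr \<kappa>) * exp (t * L)) \<le> exp (?C * t powr (\<kappa> / 2))"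
      using t by (simp add: B_def flip: exp_add)
    then show "(\<integral>\<^sup>+x. ennreal (powexp lam \<kappa> x) \<partial>\<mu> t) \<le> ennreal (exp (?C * t powr (\<kappa> / 2)))"
      by (rule order_trans[OF main[OF t(1)] ennreal_leI])
  next
    fix t :: real assume t: "1 \<le> t"
    have "t powr \<kappa> \<le> t powr 1"
      using t k by (intro powr_mono) auto
    then have "C2 * t + (C3 * t powr \<kappa> + t * L) \<le> C2 * t + (C3 * t + t * L)"
      using C3 t by (intro add_left_mono add_mono mult_left_mono) auto
    also have "\<dots> \<le> ?C * t"
      using C1 t by (simp add: algebra_simps)
    finally have "B t * (exp (C3 * t powr \<kappa>) * exp (t * L)) \<le> exp (?C * t)"
      using t by (simp add: B_def flip: exp_add)
    then show "(\<integral>\<^sup>+x. ennreal (powexp lam \<kappa> x) \<partial>\<mu> t) \<le> ennreal (exp (?C * t))"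
      using t by (intro order_trans[OF main ennreal_leI]) auto
  qed
qed

section \<open>Negative moments\<close>

lemma power_le_fact_exp:
  fixes x :: real
  assumes "0 \<le> x"
  shows "x ^ n \<le> fact n * exp x"
proof -
  have "(\<Sum>k\<in>{n}. x ^ k /\<^sub>R fact k) \<le> (\<Sum>k. x ^ k /\<^sub>R fact k)"
    using assms exp_converges[of x] by (intro sum_le_suminf) (auto simp: sums_iff)
  then have "x ^ n /\<^sub>R fact n \<le> exp x"
    using exp_converges[of x] by (simp add: sums_iff)
  then show ?thesis by (simp add: field_simps)
qed

lemma power_le_const_exp_powr:
  fixes c \<kappa> :: real
  assumes c: "0 < c" and \<kappa>: "0 < \<kappa>"
  obtains C where "0 < C" "\<And>u. 0 < u \<Longrightarrow> u ^ m \<le> C * exp (c * u powr \<kappa>)"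
proof -
  \<comment> \<open>N is large enough for \<kappa> N \<ge> m. A single term of the exponential
    series then dominates u^m for u > 1, and the summand 1 in the constant covers u \<le> 1.\<close>
  define N where "N = Suc (nat \<lceil>real m / \<kappa>\<rceil>)"
  have "real m / \<kappa> \<le> real N" unfolding N_def by linarith
  then have N: "real m \<le> \<kappa> * real N" using \<kappa> by (simp add: divide_le_eq mult.commute)
  show thesis
  proof (rule that[of "1 + fact N / c ^ N"])
    show "0 < 1 + fact N / c ^ N" using c by (intro add_pos_pos) auto
  next
    fix u :: real assume u: "0 < u"
    have "u ^ m \<le> 1 + u powr (\<kappa> * N)"
    proof (cases "u \<le> 1")
      case True
      then have "u ^ m \<le> 1" using u by (intro power_le_one) auto
      then show ?thesis using powr_ge_zero[of u "\<kappa> * N"] by linarith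
    next
      case False
      then have "u ^ m \<le> u powr (\<kappa> * N)"
        using N u by (subst powr_realpow[symmetric]) (auto intro!: powr_mono)
      then show ?thesis by simp
    qed
    also have "u powr (\<kappa> * N) = (c * u powr \<kappa>) ^ N / c ^ N"
      using u c by (simp add: power_mult_distrib powr_power mult.commute)
    also have "\<dots> \<le> fact N * exp (c * u powr \<kappa>) / c ^ N"
      using c by (intro divide_right_mono power_le_fact_exp) auto
    also have "1 \<le> exp (c * u powr \<kappa>)" using c by simp
    finally show "u ^ m \<le> (1 + fact N / c ^ N) * exp (c * u powr \<kappa>)"
      by (simp add: distrib_right)
  qed
qed

context borel_prob
begin

lemma isCont_charfn: "isCont (charfn \<mu>) \<xi>"
  unfolding continuous_at_sequentially o_def charfn_def
proof (intro allI impI)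
  fix x assume x: "x \<longlonglongrightarrow> \<xi>"
  show "(\<lambda>n. CLINT y|\<mu>. iexp (x n \<bullet> y)) \<longlonglongrightarrow> (CLINT y|\<mu>. iexp (\<xi> \<bullet> y))"
    by (rule integral_dominated_convergence[where w="\<lambda>_. 1"])
      (auto intro!: AE_I2 tendsto_intros x)
qed

lemma charfn_0: "charfn \<mu> 0 = 1"
  by (simp add: charfn_def prob_space)

text \<open>If the characteristic function is non-negative, the mass near the origin is at least that
  of a bounded density which is positive there.\<close>

lemma gauss_average_lower_bound:
  assumes pos: "\<And>\<xi>. 0 \<le> Re (charfn \<mu> \<xi>)"
  obtains c \<delta> where "0 < c" "0 < \<delta>"
    and "\<And>s. \<delta> \<le> s \<Longrightarrow> c / s ^ DIM('a) \<le> (LINT x|\<mu>. exp (- (s * norm x)\<^sup>2 / 2))"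
proof -
  have "((\<lambda>\<xi>. Re (charfn \<mu> \<xi>)) \<longlongrightarrow> Re (charfn \<mu> 0)) (at 0)"
    using isCont_charfn[of 0] unfolding isCont_def by (rule tendsto_Re)
  then have "((\<lambda>\<xi>. Re (charfn \<mu> \<xi>)) \<longlongrightarrow> 1) (at 0)" by (simp add: charfn_0)
  then have "\<forall>\<^sub>F \<xi> in at 0. 1 / 2 < Re (charfn \<mu> \<xi>)" by (rule order_tendstoD) simp
  then obtain \<epsilon> where \<epsilon>: "0 < \<epsilon>" and half': "\<And>\<xi>. \<xi> \<noteq> 0 \<Longrightarrow> dist \<xi> 0 < \<epsilon> \<Longrightarrow> 1 / 2 < Re (charfn \<mu> \<xi>)"
    unfolding eventually_at by auto
  define \<delta> where "\<delta> = \<epsilon> / 2"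
  have \<delta>: "0 < \<delta>" using \<epsilon> by (simp add: \<delta>_def)
  have half: "1 / 2 \<le> Re (charfn \<mu> \<xi>)" if "norm \<xi> \<le> \<delta>" for \<xi>
    using half'[of \<xi>] that \<epsilon> by (cases "\<xi> = 0") (auto simp: \<delta>_def charfn_0)
  \<comment> \<open>This is the value of \<open>gauss\<close> on the unit sphere, hence its minimum
    over the unit ball.\<close>
  define g where "g = (1 / sqrt (2 * pi)) ^ DIM('a) * exp (- 1 / 2)"
  have g: "0 < g" unfolding g_def by simp
  have g_le: "g \<le> gauss w" if "norm w \<le> 1" for w :: 'a
    using that unfolding g_def gauss_eq by (simp add: power_le_one)
  let ?V = "unit_ball_vol (real DIM('a))"
  show thesis
  proof (rule that[of "g / 2 * (?V * \<delta> ^ DIM('a))" \<delta>])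
    show "0 < g / 2 * (?V * \<delta> ^ DIM('a))" using g \<delta> by (intro mult_pos_pos) auto
    show "0 < \<delta>" by fact
  next
    fix s assume s: "\<delta> \<le> s"
    then have s0: "0 < s" using \<delta> by simp
    let ?D = "LINT x|\<mu>. exp (- (s * norm x)\<^sup>2 / 2)"
    let ?f = "\<lambda>w. gauss w * charfn \<mu> (- s *\<^sub>R w)"
    have int: "integrable lborel ?f"
      by (rule integrable_gauss_times) (auto simp: norm_charfn_le_1)
    have "complex_of_real ?D = (CLINT w|lborel. ?f w)"
      using gauss_smoothing[of s 0] s0 by simp
    then have "?D = Re (CLINT w|lborel. ?f w)" by (metis Re_complex_of_real)
    also have "\<dots> = (LINT w|lborel. Re (?f w))" by (rule integral_Re[OF int, symmetric])
    finally have D: "?D = (LINT w|lborel. gauss w * Re (charfn \<mu> (- s *\<^sub>R w)))" by simp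
    \<comment> \<open>On the ball of radius \<delta> / s the argument - s w stays where the
      characteristic function has real part at least 1/2, and s \<ge> \<delta> keeps the ball inside
      the unit ball, where \<open>gauss\<close> is at least g. Its volume gives the order s^(-d);
      elsewhere positivity suffices.\<close>
    have "g / 2 * (?V * \<delta> ^ DIM('a)) / s ^ DIM('a) = g / 2 * measure lborel (cball (0::'a) (\<delta> / s))"
      using \<delta> s0 by (simp add: measure_def emeasure_cball power_divide enn2real_ennreal)
    also have "\<dots> = (LINT w|lborel. g / 2 * indicator (cball (0::'a) (\<delta> / s)) w)"
      by simp
    also have "\<dots> \<le> (LINT w|lborel. gauss w * Re (charfn \<mu> (- s *\<^sub>R w)))"
    proof (rule integral_mono)
      show "integrable lborel (\<lambda>w. g / 2 * indicator (cball (0::'a) (\<delta> / s)) w)"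
        using emeasure_lborel_cball_finite[of "0::'a" "\<delta> / s"]
        by (intro integrable_mult_right integrable_real_indicator) auto
      show "integrable lborel (\<lambda>w. gauss w * Re (charfn \<mu> (- s *\<^sub>R w)))"
        using integrable_Re[OF int] by simp
    next
      fix w :: 'a
      show "g / 2 * indicator (cball 0 (\<delta> / s)) w \<le> gauss w * Re (charfn \<mu> (- s *\<^sub>R w))"
      proof (cases "w \<in> cball 0 (\<delta> / s)")
        case True
        then have w: "norm w \<le> \<delta> / s" by simp
        have "\<delta> / s \<le> 1" using s s0 by simp
        then have "norm w \<le> 1" using w by linarith
        moreover have "norm (- s *\<^sub>R w) \<le> \<delta>" using w s0 by (simp add: le_divide_eq mult.commute)
        ultimately have "g * (1 / 2) \<le> gauss w * Re (charfn \<mu> (- s *\<^sub>R w))"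
          by (intro mult_mono g_le half) auto
        then show ?thesis using True by simp
      next
        case False
        then show ?thesis using pos[of "- s *\<^sub>R w"] by simp
      qed
    qed
    finally show "g / 2 * (?V * \<delta> ^ DIM('a)) / s ^ DIM('a) \<le> ?D" by (simp only: D)
  qed
qed

lemma negative_powexp_moment_infinite:
  assumes pos: "\<And>\<xi>. 0 \<le> Re (charfn \<mu> \<xi>)" and lam: "0 < lam" and \<kappa>: "0 < \<kappa>"
  shows "(\<integral>\<^sup>+x. (if x = 0 then \<infinity> else ennreal (exp (lam * norm x powr (- \<kappa>)))) \<partial>\<mu>) = \<infinity>"
proof (rule ccontr)
  let ?W = "\<lambda>x::'a. if x = 0 then \<infinity> else ennreal (exp (lam * norm x powr (- \<kappa>)))"
  assume "(\<integral>\<^sup>+x. ?W x \<partial>\<mu>) \<noteq> \<infinity>"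
  then obtain I where I: "(\<integral>\<^sup>+x. ?W x \<partial>\<mu>) = ennreal I" "0 \<le> I"
    by (cases "\<integral>\<^sup>+x. ?W x \<partial>\<mu>") auto
  \<comment> \<open>One power of 1 / s more than in the lower bound is enough for a contradiction as
    s grows.\<close>
  define m where "m = Suc DIM('a)"
  obtain c \<delta> where c: "0 < c" and \<delta>: "0 < \<delta>"
    and low: "\<And>s. \<delta> \<le> s \<Longrightarrow> c / s ^ DIM('a) \<le> (LINT x|\<mu>. exp (- (s * norm x)\<^sup>2 / 2))"
    by (rule gauss_average_lower_bound[OF pos]) blast
  obtain C1 where C1: "0 < C1" "\<And>u. 0 < u \<Longrightarrow> u ^ m \<le> C1 * exp (lam * u powr \<kappa>)"
    by (rule power_le_const_exp_powr[OF lam \<kappa>]) blast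
  obtain C2 where C2: "0 < C2" "\<And>u::real. 0 < u \<Longrightarrow> u ^ m \<le> C2 * exp (1 / 2 * u powr 2)"
    by (rule power_le_const_exp_powr[of "1 / 2" 2 m]) auto
  have up: "c / s ^ DIM('a) \<le> C1 * C2 * I / s ^ m" if s: "\<delta> \<le> s" for s
  proof -
    have s0: "0 < s" using s \<delta> by simp
    have pw: "ennreal (exp (- (s * norm x)\<^sup>2 / 2)) \<le> ennreal (C1 * C2 / s ^ m) * ?W x" for x :: 'a
    proof (cases "x = 0")
      \<comment> \<open>At the origin the weight is infinite, and so is its product with a positive
        constant.\<close>
      case True
      then show ?thesis using C1 C2 s0 by (simp add: ennreal_mult_top)
    next
      case False
      define v where "v = s * norm x"
      have v: "0 < v" using False s0 by (simp add: v_def)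
      have "v ^ m \<le> C2 * exp (v\<^sup>2 / 2)" using C2(2)[OF v] v by (simp add: powr_numeral)
      then have 1: "exp (- v\<^sup>2 / 2) \<le> C2 / v ^ m"
        using v by (simp add: exp_minus field_simps)
      have "(1 / norm x) ^ m \<le> C1 * exp (lam * (1 / norm x) powr \<kappa>)"
        using False by (intro C1(2)) simp
      also have "(1 / norm x) powr \<kappa> = norm x powr (- \<kappa>)"
        by (simp add: powr_minus_divide powr_divide)
      finally have 2: "(1 / norm x) ^ m \<le> C1 * exp (lam * norm x powr (- \<kappa>))" .
      have "C2 / v ^ m = C2 / s ^ m * (1 / norm x) ^ m"
        by (simp add: v_def power_mult_distrib power_divide)
      also have "\<dots> \<le> C2 / s ^ m * (C1 * exp (lam * norm x powr (- \<kappa>)))"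
        using C2 s0 by (intro mult_left_mono 2) auto
      finally have "exp (- v\<^sup>2 / 2) \<le> C1 * C2 / s ^ m * exp (lam * norm x powr (- \<kappa>))"
        using 1 by (simp add: mult_ac)
      then show ?thesis
        using False C1 C2 s0 by (simp add: v_def flip: ennreal_mult)
    qed
    have "ennreal (c / s ^ DIM('a)) \<le> ennreal (LINT x|\<mu>. exp (- (s * norm x)\<^sup>2 / 2))"
      using low[OF s] by (rule ennreal_leI)
    also have "\<dots> = (\<integral>\<^sup>+x. ennreal (exp (- (s * norm x)\<^sup>2 / 2)) \<partial>\<mu>)"
      by (intro nn_integral_eq_integral[symmetric] integrable_const_bound[of _ 1]) auto
    also have "\<dots> \<le> (\<integral>\<^sup>+x. ennreal (C1 * C2 / s ^ m) * ?W x \<partial>\<mu>)"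
      by (intro nn_integral_mono pw)
    also have "\<dots> = ennreal (C1 * C2 / s ^ m) * ennreal I"
      unfolding I(1)[symmetric] by (rule nn_integral_cmult) measurable
    also have "\<dots> = ennreal (C1 * C2 / s ^ m * I)"
      using C1 C2 s0 I by (simp flip: ennreal_mult)
    finally show ?thesis using C1 C2 s0 I by (simp add: ennreal_le_iff)
  qed
  \<comment> \<open>The two bounds combine to c s \<le> C1 C2 I, which fails for this s; it also
    exceeds \<delta>, as the lower bound requires.\<close>
  define s where "s = \<delta> + C1 * C2 * I / c + 1"
  have q: "0 \<le> C1 * C2 * I / c" using C1 C2 I c by simp
  have s: "\<delta> \<le> s" "0 < s" using q \<delta> by (auto simp: s_def)
  have "c * s \<le> C1 * C2 * I"
    using up[OF s(1)] s by (simp add: m_def field_simps)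
  then have "s \<le> C1 * C2 * I / c" using c by (simp add: le_divide_eq mult.commute)
  then show False using \<delta> by (simp add: s_def)
qed

end

section \<open>Super-exponential moments\<close>

lemma one_minus_cos_sq: "2 * (1 - cos u)\<^sup>2 = 4 * (1 - cos u) - (1 - cos (2 * u))" for u :: real
  unfolding cos_double_cos by (simp add: power2_eq_square algebra_simps)

section \<open>The jump part of the exponent and its oscillation\<close>

definition levy_integrand :: "'a::real_inner \<Rightarrow> 'a \<Rightarrow> complex" where
  "levy_integrand \<xi> y = 1 - iexp (\<xi> \<bullet> y) + \<i> * complex_of_real (\<xi> \<bullet> y * indicator {0<..<1} (norm y))"

context levy_measure
begin

lemma levy_integrand_split:
  "levy_integrand \<xi> y =
    - (indicator {y. norm y < 1} y *\<^sub>R (iexp (\<xi> \<bullet> y) - 1 - \<i> * (\<xi> \<bullet> y)) +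
       indicator {y. 1 \<le> norm y} y *\<^sub>R (iexp (\<xi> \<bullet> y) - 1))"
  by (cases "y = 0") (auto simp: levy_integrand_def indicator_def)

lemma integrable_levy_integrand: "integrable \<nu> (levy_integrand \<xi>)"
  unfolding levy_integrand_split[abs_def]
  by (intro Bochner_Integration.integrable_minus Bochner_Integration.integrable_add
      integrable_small_exponent integrable_large_exponent)

lemma integral_levy_integrand:
  "(CLINT y|\<nu>. levy_integrand \<xi> y) = - (small_exponent \<xi> + large_exponent \<xi>)"
  unfolding levy_integrand_split small_exponent_def large_exponent_def
  using integrable_small_exponent[of \<xi>] integrable_large_exponent[of \<xi>] by simp

lemma integrable_one_minus_cos: "integrable \<nu> (\<lambda>y. 1 - cos (\<xi> \<bullet> y))"
  using integrable_Re[OF integrable_levy_integrand[of \<xi>]] by (simp add: levy_integrand_def Re_exp)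

lemma Re_integral_levy_integrand:
  "Re (CLINT y|\<nu>. levy_integrand \<xi> y) = (LINT y|\<nu>. 1 - cos (\<xi> \<bullet> y))"
proof -
  have "Re (levy_integrand \<xi> y) = 1 - cos (\<xi> \<bullet> y)" for y
    by (simp add: levy_integrand_def Re_exp)
  then show ?thesis
    using integral_Re[OF integrable_levy_integrand[of \<xi>]] by simp
qed

lemma integrable_one_minus_cos_sq: "integrable \<nu> (\<lambda>y. (1 - cos (\<xi> \<bullet> y))\<^sup>2)"
proof -
  have "integrable \<nu> (\<lambda>y. 4 * (1 - cos (\<xi> \<bullet> y)) - (1 - cos ((2 *\<^sub>R \<xi>) \<bullet> y)))"
    by (intro Bochner_Integration.integrable_diff integrable_mult_right integrable_one_minus_cos)
  then have "integrable \<nu> (\<lambda>y. 2 * (1 - cos (\<xi> \<bullet> y))\<^sup>2)"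
    by (simp add: one_minus_cos_sq)
  then show ?thesis by simp
qed

lemma integral_one_minus_cos_sq:
  "2 * (LINT y|\<nu>. (1 - cos (\<xi> \<bullet> y))\<^sup>2) =
    4 * (LINT y|\<nu>. 1 - cos (\<xi> \<bullet> y)) - (LINT y|\<nu>. 1 - cos ((2 *\<^sub>R \<xi>) \<bullet> y))"
proof -
  have "2 * (LINT y|\<nu>. (1 - cos (\<xi> \<bullet> y))\<^sup>2) = (LINT y|\<nu>. 2 * (1 - cos (\<xi> \<bullet> y))\<^sup>2)" by simp
  also have "\<dots> = (LINT y|\<nu>. 4 * (1 - cos (\<xi> \<bullet> y)) - (1 - cos ((2 *\<^sub>R \<xi>) \<bullet> y)))"
    by (simp add: one_minus_cos_sq)
  also have "\<dots> = (LINT y|\<nu>. 4 * (1 - cos (\<xi> \<bullet> y))) - (LINT y|\<nu>. 1 - cos ((2 *\<^sub>R \<xi>) \<bullet> y))"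
    by (intro Bochner_Integration.integral_diff integrable_mult_right integrable_one_minus_cos)
  finally show ?thesis by (simp only: integral_mult_right_zero)
qed

text \<open>Otherwise cos (\<xi> . y) = 1 almost everywhere for every \<xi>. Multiples of the basis
  vectors that shrink to 0 then leave only y = 0, which has no mass.\<close>

lemma exists_oscillation:
  assumes zero: "emeasure \<nu> {0} = 0" and "\<nu> \<noteq> null_measure borel"
  obtains \<xi> where "0 < (LINT y|\<nu>. (1 - cos (\<xi> \<bullet> y))\<^sup>2)"
proof (rule ccontr)
  assume "\<not> thesis"
  then have no: "\<not> 0 < (LINT y|\<nu>. (1 - cos (\<xi> \<bullet> y))\<^sup>2)" for \<xi> using that by blast
  have AE1: "AE y in \<nu>. cos (\<xi> \<bullet> y) = 1" for \<xi>
  proof -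
    have "0 \<le> (LINT y|\<nu>. (1 - cos (\<xi> \<bullet> y))\<^sup>2)" by (intro integral_nonneg_AE) auto
    then have "(LINT y|\<nu>. (1 - cos (\<xi> \<bullet> y))\<^sup>2) = 0" using no[of \<xi>] by linarith
    then have "AE y in \<nu>. (1 - cos (\<xi> \<bullet> y))\<^sup>2 = 0"
      using integral_nonneg_eq_0_iff_AE[OF integrable_one_minus_cos_sq[of \<xi>]] by simp
    then show ?thesis by eventually_elim simp
  qed
  \<comment> \<open>The exceptional null set depends on \<xi>, so a countable family of \<xi> is
    chosen that still determines y.\<close>
  have "AE y in \<nu>. \<forall>b\<in>Basis. \<forall>n::nat. cos (((1 / real (Suc n)) *\<^sub>R b) \<bullet> y) = 1"
    unfolding AE_all_countable by (rule AE_finite_allI[OF finite_Basis]) (simp only: AE_all_countable AE1 simp_thms)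
  then have "AE y in \<nu>. y \<notin> {0} \<longrightarrow> False"
  proof eventually_elim
    case (elim y)
    have "b \<bullet> y = 0" if b: "b \<in> Basis" for b
    proof (rule ccontr)
      assume nz: "b \<bullet> y \<noteq> 0"
      obtain n :: nat where n: "\<bar>b \<bullet> y\<bar> < real n" using reals_Archimedean2 by blast
      have "((1 / real (Suc n)) *\<^sub>R b) \<bullet> y = (b \<bullet> y) / real (Suc n)" by simp
      then have "cos ((b \<bullet> y) / real (Suc n)) = 1" using elim[rule_format, OF b, of n] by (simp only:)
      then obtain k :: int where k: "(b \<bullet> y) / real (Suc n) = real_of_int k * 2 * pi"
        unfolding cos_one_2pi_int by blast
      \<comment> \<open>A multiple of 2 pi of modulus below 1 is 0.\<close>
      have "\<bar>(b \<bullet> y) / real (Suc n)\<bar> < 1" using n by (simp add: abs_divide divide_less_eq)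
      then have "\<bar>real_of_int k\<bar> * (2 * pi) < 1" unfolding k by (simp add: abs_mult)
      moreover have "k \<noteq> 0"
      proof
        assume "k = 0"
        then have "(b \<bullet> y) / real (Suc n) = 0" using k by simp
        then show False using nz by simp
      qed
      then have "1 * (2 * pi) \<le> \<bar>real_of_int k\<bar> * (2 * pi)"
        by (intro mult_right_mono) auto
      ultimately show False using pi_gt3 by simp
    qed
    then have "y = 0" using euclidean_all_zero_iff[of y] by (simp add: inner_commute)
    then show ?case by simp
  qed
  moreover have "AE y in \<nu>. y \<notin> {0}"
    using zero by (intro AE_not_in) (auto simp: null_sets_def)
  ultimately have "AE y in \<nu>. False" by eventually_elim auto
  then have "emeasure \<nu> UNIV = 0"
    using AE_iff_null[of \<nu> "\<lambda>_. False"] by (simp add: null_sets_def)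
  then have "emeasure \<nu> A = 0" for A
    using emeasure_mono[of A UNIV \<nu>] by simp
  then have "\<nu> = null_measure borel" by (intro measure_eqI) simp_all
  with assms(2) show False by simp
qed

end

section \<open>Tails of small increments\<close>

lemma tendsto_one_minus_Re_exp:
  fixes z :: complex
  shows "(\<lambda>n. real n * (1 - Re (exp (- (t / real n) * z)))) \<longlonglongrightarrow> t * Re z"
proof (rule Lim_transform)
  let ?f = "\<lambda>n. real n * (1 - Re (exp (- (t / real n) * z)))"
  have "norm (?f n - t * Re z) \<le> exp (norm (t * z)) * (norm (t * z))\<^sup>2 * (1 / real n)" if n: "0 < n" for n :: nat
  proof -
    define w where "w = - complex_of_real (t / real n) * z"
    have nw: "norm w = norm (t * z) / real n" by (simp add: w_def norm_mult norm_divide)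
    then have "norm w \<le> norm (t * z)" using n by (simp add: divide_le_eq mult_le_cancel_left1)
    have "norm (exp w - (\<Sum>i\<le>1. w ^ i / fact i)) \<le> exp (norm w) * norm w ^ Suc 1 / fact 1"
      by (rule Taylor_exp_field)
    moreover have "exp w - (\<Sum>i\<le>1. w ^ i / fact i) = exp w - 1 - w" by simp
    moreover have "exp (norm w) * norm w ^ Suc 1 / fact 1 = exp (norm w) * (norm w)\<^sup>2" by (simp add: power2_eq_square)
    ultimately have "norm (exp w - 1 - w) \<le> exp (norm w) * (norm w)\<^sup>2" by (simp only:)
    also have "\<dots> \<le> exp (norm (t * z)) * (norm w)\<^sup>2"
      using \<open>norm w \<le> norm (t * z)\<close> by (intro mult_right_mono) auto
    finally have "\<bar>Re (exp w - 1 - w)\<bar> \<le> exp (norm (t * z)) * (norm w)\<^sup>2"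
      using abs_Re_le_cmod[of "exp w - 1 - w"] by linarith
    then have "real n * \<bar>Re (exp w - 1 - w)\<bar> \<le> real n * (exp (norm (t * z)) * (norm w)\<^sup>2)"
      by (intro mult_left_mono) auto
    moreover have "?f n - t * Re z = - (real n * Re (exp w - 1 - w))"
      using n by (simp add: w_def algebra_simps)
    moreover have "real n * (exp (norm (t * z)) * (norm w)\<^sup>2) = exp (norm (t * z)) * (norm (t * z))\<^sup>2 * (1 / real n)"
      unfolding nw using n by (simp add: power2_eq_square)
    ultimately show ?thesis by (simp add: abs_mult)
  qed
  then have "\<forall>\<^sub>F n in sequentially. norm (?f n - t * Re z) \<le> exp (norm (t * z)) * (norm (t * z))\<^sup>2 * (1 / real n)"
    by (intro eventually_sequentiallyI[of 1]) auto
  moreover have "(\<lambda>n. exp (norm (t * z)) * (norm (t * z))\<^sup>2 * (1 / real n)) \<longlonglongrightarrow> 0"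
    by (intro tendsto_mult_right_zero lim_1_over_n)
  ultimately show "(\<lambda>n. ?f n - t * Re z) \<longlonglongrightarrow> 0" by (rule Lim_null_comparison)
  show "(\<lambda>n. t * Re z) \<longlonglongrightarrow> t * Re z" by simp
qed

text \<open>Where |u| < c, one of the two factors 1 - cos u is at most c^2 / 2. Taking expectations,
  the second-order quantity is thus bounded by a tail probability plus a small multiple of the
  first-order one.\<close>

lemma one_minus_cos_sq_le:
  fixes u c :: real
  assumes "0 < c"
  shows "(1 - cos u)\<^sup>2 \<le> 4 * indicator {u. c \<le> \<bar>u\<bar>} u + c\<^sup>2 / 2 * (1 - cos u)"
proof (cases "c \<le> \<bar>u\<bar>")
  case True
  have "\<bar>1 - cos u\<bar> \<le> 2" using cos_ge_minus_one[of u] cos_le_one[of u] by linarith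
  then have "(1 - cos u)\<^sup>2 \<le> 2\<^sup>2" by (intro power2_le_iff_abs_le[THEN iffD2]) auto
  then have "(1 - cos u)\<^sup>2 \<le> 4 * 1 + c\<^sup>2 / 2 * (1 - cos u)"
    by (simp add: add_increasing2)
  moreover have "indicator {u. c \<le> \<bar>u\<bar>} u = (1 :: real)" using True by simp
  ultimately show ?thesis by (simp only:)
next
  case False
  have "1 - cos u = 2 * (sin (u / 2))\<^sup>2"
    using cos_double_sin[of "u / 2"] by simp
  also have "\<dots> \<le> 2 * (u / 2)\<^sup>2"
    using abs_sin_x_le_abs_x[of "u / 2"] by (intro mult_left_mono abs_le_square_iff[THEN iffD1]) auto
  also have "\<dots> \<le> c\<^sup>2 / 2"
    using False assms abs_le_square_iff[of u c] by (simp add: power_divide)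
  finally have "(1 - cos u) * (1 - cos u) \<le> c\<^sup>2 / 2 * (1 - cos u)"
    by (intro mult_right_mono) auto
  then show ?thesis using False by (simp add: power2_eq_square)
qed

text \<open>The combination \<open>4 (1 - cos u) - (1 - cos (2 u)) = 2 (1 - cos u)\<^sup>2\<close> annihilates quadratic terms,
  so \<open>B\<close> only sees the jumps.\<close>

lemma (in prob_space) tail_from_cosine_moments:
  fixes Y :: "nat \<Rightarrow> 'a \<Rightarrow> real"
  assumes [measurable]: "\<And>n. random_variable borel (Y n)"
    and A: "(\<lambda>n. real n * expectation (\<lambda>\<omega>. 1 - cos (Y n \<omega>))) \<longlonglongrightarrow> A"
    and B: "(\<lambda>n. real n * expectation (\<lambda>\<omega>. (1 - cos (Y n \<omega>))\<^sup>2)) \<longlonglongrightarrow> B" "0 < B"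
  obtains c q where "0 < c" "0 < q"
    and "\<forall>\<^sub>F n in sequentially. q \<le> real n * prob {\<omega> \<in> space M. c \<le> \<bar>Y n \<omega>\<bar>}"
proof -
  have "0 \<le> A"
    by (rule LIMSEQ_le_const[OF A]) (auto intro!: exI[of _ 0] mult_nonneg_nonneg integral_nonneg_AE)
  \<comment> \<open>With this c the near part c^2 A / 2 stays below B / 2; the added 1 keeps the
    quotient meaningful when A = 0.\<close>
  define c where "c = sqrt (B / (2 * (A + 1)))"
  have c: "0 < c" and c2: "c\<^sup>2 = B / (2 * (A + 1))" using B(2) \<open>0 \<le> A\<close> by (auto simp: c_def)
  have le: "real n * expectation (\<lambda>\<omega>. (1 - cos (Y n \<omega>))\<^sup>2) \<le>
     4 * (real n * prob {\<omega> \<in> space M. c \<le> \<bar>Y n \<omega>\<bar>}) + c\<^sup>2 / 2 * (real n * expectation (\<lambda>\<omega>. 1 - cos (Y n \<omega>)))" for n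
  proof -
    let ?S = "{\<omega> \<in> space M. c \<le> \<bar>Y n \<omega>\<bar>}"
    have S [measurable]: "?S \<in> events" by measurable
    have i1: "integrable M (\<lambda>\<omega>. 1 - cos (Y n \<omega>))"
      by (rule integrable_const_bound[of _ 2]) (auto simp: abs_le_iff intro!: AE_I2 order_trans[OF _ cos_ge_minus_one])
    have i2: "integrable M (\<lambda>\<omega>. (1 - cos (Y n \<omega>))\<^sup>2)"
    proof (rule integrable_const_bound[of _ 4])
      show "AE \<omega> in M. norm ((1 - cos (Y n \<omega>))\<^sup>2) \<le> 4"
      proof (rule AE_I2)
        fix \<omega>
        have "\<bar>1 - cos (Y n \<omega>)\<bar> \<le> 2" using cos_ge_minus_one[of "Y n \<omega>"] cos_le_one[of "Y n \<omega>"] by linarith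
        then have "(1 - cos (Y n \<omega>))\<^sup>2 \<le> 2\<^sup>2" by (intro power2_le_iff_abs_le[THEN iffD2]) auto
        then show "norm ((1 - cos (Y n \<omega>))\<^sup>2) \<le> 4" by simp
      qed
    qed measurable
    have i3: "integrable M (\<lambda>\<omega>. 4 * indicator ?S \<omega> :: real)"
      by (intro integrable_mult_right integrable_real_indicator) (auto simp: emeasure_eq_measure)
    have "expectation (\<lambda>\<omega>. (1 - cos (Y n \<omega>))\<^sup>2) \<le>
       expectation (\<lambda>\<omega>. 4 * indicator ?S \<omega> + c\<^sup>2 / 2 * (1 - cos (Y n \<omega>)))"
    proof (rule integral_mono[OF i2])
      show "integrable M (\<lambda>\<omega>. 4 * indicator ?S \<omega> + c\<^sup>2 / 2 * (1 - cos (Y n \<omega>)))"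
        by (intro Bochner_Integration.integrable_add i3 integrable_mult_right i1)
      fix \<omega> assume "\<omega> \<in> space M"
      then show "(1 - cos (Y n \<omega>))\<^sup>2 \<le> 4 * indicator ?S \<omega> + c\<^sup>2 / 2 * (1 - cos (Y n \<omega>))"
        using one_minus_cos_sq_le[OF c, of "Y n \<omega>"] by (auto simp: indicator_def)
    qed
    also have "\<dots> = expectation (\<lambda>\<omega>. 4 * indicator ?S \<omega>) + expectation (\<lambda>\<omega>. c\<^sup>2 / 2 * (1 - cos (Y n \<omega>)))"
      by (intro Bochner_Integration.integral_add i3 integrable_mult_right i1)
    also have "\<dots> = 4 * prob ?S + c\<^sup>2 / 2 * expectation (\<lambda>\<omega>. 1 - cos (Y n \<omega>))"
      using S by (simp only: integral_mult_right_zero) (simp add: Int_absorb1 sets.sets_into_space[OF S])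
    finally have "real n * expectation (\<lambda>\<omega>. (1 - cos (Y n \<omega>))\<^sup>2) \<le>
        real n * (4 * prob ?S + c\<^sup>2 / 2 * expectation (\<lambda>\<omega>. 1 - cos (Y n \<omega>)))"
      by (intro mult_left_mono) auto
    then show ?thesis by (simp add: algebra_simps)
  qed
  show thesis
  \<comment> \<open>Eventually 3/4 B < 4 n p + B / 2 for the tail probability p, which leaves n p >
    B / 16.\<close>
  proof (rule that[OF c, of "B / 16"])
    show "0 < B / 16" using B by simp
    have "c\<^sup>2 / 2 * A < B / 2"
      unfolding c2 using B(2) \<open>0 \<le> A\<close> by (simp add: field_simps add_pos_nonneg)
    with tendsto_mult[OF tendsto_const A, of "c\<^sup>2 / 2"]
    have "\<forall>\<^sub>F n in sequentially. c\<^sup>2 / 2 * (real n * expectation (\<lambda>\<omega>. 1 - cos (Y n \<omega>))) < B / 2"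
      by (rule order_tendstoD)
    moreover have "\<forall>\<^sub>F n in sequentially. 3 / 4 * B < real n * expectation (\<lambda>\<omega>. (1 - cos (Y n \<omega>))\<^sup>2)"
      using B by (intro order_tendstoD(1)[OF B(1)]) simp
    ultimately show "\<forall>\<^sub>F n in sequentially. B / 16 \<le> real n * prob {\<omega> \<in> space M. c \<le> \<bar>Y n \<omega>\<bar>}"
    proof eventually_elim
      case (elim n)
      then show ?case using le[of n] by linarith
    qed
  qed
qed

text \<open>If all n independent increments reach at least c in the same direction, they cannot
  cancel and their sum reaches n c. The half-space, rather than the modulus, is what makes this
  work.\<close>

lemma (in levy_process) prob_increments_ge:
  fixes \<zeta> :: "real ^ 'd"
  assumes t: "0 < t" and n: "0 < n"
  shows "prob {\<omega> \<in> space M. c \<le> \<zeta> \<bullet> X (t / real n) \<omega>} ^ n \<le> prob {\<omega> \<in> space M. real n * c \<le> \<zeta> \<bullet> X t \<omega>}"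
proof -
  define \<tau> where "\<tau> i = real i * (t / real n)" for i
  define D where "D i \<omega> = X (\<tau> (Suc i)) \<omega> - X (\<tau> i) \<omega>" for i \<omega>
  define A where "A = {x :: real ^ 'd. c \<le> \<zeta> \<bullet> x}"
  have A [measurable]: "A \<in> sets borel" unfolding A_def by measurable
  have \<tau>0: "0 \<le> \<tau> i" for i using t by (simp add: \<tau>_def)
  have \<tau>S: "\<tau> (Suc i) = \<tau> i + t / real n" for i by (simp add: \<tau>_def algebra_simps add_divide_distrib)
  have \<tau>n: "\<tau> n = t" using n by (simp add: \<tau>_def)
  have [measurable]: "random_variable borel (X (\<tau> i))" for i by (rule random_variable[OF \<tau>0])
  have [measurable]: "random_variable borel (X (t / real n))" using t by (intro random_variable) simp
  have Xt [measurable]: "random_variable borel (X t)" using t by (intro random_variable) simp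
  have [measurable]: "random_variable borel (D i)" for i
    unfolding D_def[abs_def] by measurable
  have "mono_on {..n} \<tau>"
    unfolding \<tau>_def using t by (intro mono_onI mult_right_mono) auto
  then have ind: "indep_vars (\<lambda>_. borel) D {..<n}"
    unfolding D_def[abs_def] by (intro independent_increments \<tau>0)
  have p: "prob (D i -` A \<inter> space M) = prob {\<omega> \<in> space M. c \<le> \<zeta> \<bullet> X (t / real n) \<omega>}" for i
  proof -
    have tn: "0 \<le> t / real n" using t by simp
    have "prob (D i -` A \<inter> space M) = measure (distr M borel (D i)) A"
      by (subst measure_distr) auto
    also have "distr M borel (D i) = distr M borel (X (t / real n))"
      unfolding D_def[abs_def] \<tau>S by (rule stationary_increments[OF \<tau>0 tn])
    also have "measure \<dots> A = prob (X (t / real n) -` A \<inter> space M)"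
      by (subst measure_distr) auto
    also have "X (t / real n) -` A \<inter> space M = {\<omega> \<in> space M. c \<le> \<zeta> \<bullet> X (t / real n) \<omega>}"
      by (auto simp: A_def)
    finally show ?thesis .
  qed
  have "prob {\<omega> \<in> space M. c \<le> \<zeta> \<bullet> X (t / real n) \<omega>} ^ n = (\<Prod>i<n. prob (D i -` A \<inter> space M))"
    unfolding p by simp
  also have "\<dots> = prob (\<Inter>i<n. D i -` A \<inter> space M)"
    using n by (intro indep_varsD[OF ind, symmetric]) auto
  also have "\<dots> \<le> prob {\<omega> \<in> space M. real n * c \<le> \<zeta> \<bullet> X t \<omega>}"
  proof (rule finite_measure_mono)
    show "(\<Inter>i<n. D i -` A \<inter> space M) \<subseteq> {\<omega> \<in> space M. real n * c \<le> \<zeta> \<bullet> X t \<omega>}"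
    proof
      fix \<omega> assume \<omega>: "\<omega> \<in> (\<Inter>i<n. D i -` A \<inter> space M)"
      have "\<omega> \<in> D 0 -` A \<inter> space M" using \<omega> n by blast
      then have sp: "\<omega> \<in> space M" by simp
      have "(\<Sum>i<n. D i \<omega>) = X (\<tau> n) \<omega> - X (\<tau> 0) \<omega>"
        unfolding D_def by (rule sum_lessThan_telescope)
      also have "\<dots> = X t \<omega>" using start_zero[OF sp] \<tau>n by (simp add: \<tau>_def)
      finally have "\<zeta> \<bullet> X t \<omega> = (\<Sum>i<n. \<zeta> \<bullet> D i \<omega>)" by (simp add: inner_sum_right[symmetric])
      moreover have "(\<Sum>i<n. c) \<le> (\<Sum>i<n. \<zeta> \<bullet> D i \<omega>)"
      proof (rule sum_mono)
        fix i assume "i \<in> {..<n}"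
        then have "\<omega> \<in> D i -` A \<inter> space M" using \<omega> by blast
        then show "c \<le> \<zeta> \<bullet> D i \<omega>" by (simp add: A_def)
      qed
      ultimately show "\<omega> \<in> {\<omega> \<in> space M. real n * c \<le> \<zeta> \<bullet> X t \<omega>}" using sp by simp
    qed
    show "{\<omega> \<in> space M. real n * c \<le> \<zeta> \<bullet> X t \<omega>} \<in> events" using Xt by measurable
  qed
  finally show ?thesis .
qed

text \<open>On the logarithmic scale D n^kappa competes with n ln n and wins because
  \<open>1 < \<kappa>\<close>.\<close>

lemma filterlim_powexp_vs_power:
  assumes "0 < D" "1 < \<kappa>" "0 < q"
  shows "filterlim (\<lambda>n::nat. exp (D * real n powr \<kappa>) * (q / real n) ^ n) at_top sequentially"
proof -
  have "filterlim (\<lambda>n::nat. D * real n powr \<kappa> + real n * (ln q - ln (real n))) at_top sequentially"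
    using assms by real_asymp
  then have "filterlim (\<lambda>n::nat. exp (D * real n powr \<kappa> + real n * (ln q - ln (real n)))) at_top sequentially"
    by (rule filterlim_compose[OF exp_at_top])
  moreover have "\<forall>\<^sub>F n in sequentially. exp (D * real n powr \<kappa> + real n * (ln q - ln (real n))) =
      exp (D * real n powr \<kappa>) * (q / real n) ^ n"
    using eventually_gt_at_top[of 0]
  proof eventually_elim
    case (elim n)
    then have "exp (real n * (ln q - ln (real n))) = (q / real n) ^ n"
      using assms by (simp add: exp_of_nat_mult exp_diff)
    then show ?case by (simp add: exp_add)
  qed
  ultimately show ?thesis by (subst (asm) filterlim_cong[OF refl refl]) auto
qed

lemma (in levy_process) powexp_moment_infinite:
  fixes \<zeta> :: "real ^ 'd"
  assumes t: "0 < t" and lam: "0 < lam" and \<kappa>: "1 < \<kappa>" and cq: "0 < c" "0 < q"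
    and tail: "\<forall>\<^sub>F n in sequentially. q \<le> real n * prob {\<omega> \<in> space M. c \<le> \<bar>\<zeta> \<bullet> X (t / real n) \<omega>\<bar>}"
  shows "(\<integral>\<^sup>+\<omega>. ennreal (powexp lam \<kappa> (X t \<omega>)) \<partial>M) = \<infinity>"
proof (rule ccontr)
  assume "(\<integral>\<^sup>+\<omega>. ennreal (powexp lam \<kappa> (X t \<omega>)) \<partial>M) \<noteq> \<infinity>"
  then obtain I where I: "(\<integral>\<^sup>+\<omega>. ennreal (powexp lam \<kappa> (X t \<omega>)) \<partial>M) = ennreal I" "0 \<le> I"
    by (cases "\<integral>\<^sup>+\<omega>. ennreal (powexp lam \<kappa> (X t \<omega>)) \<partial>M") auto
  have [measurable]: "random_variable borel (X t)" using t by (intro random_variable) simp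
  \<comment> \<open>By Cauchy-Schwarz, a projection of at least n c forces a norm of at least n r;
    the 1 keeps the denominator positive for every \<zeta>.\<close>
  define r where "r = c / (norm \<zeta> + 1)"
  have r: "0 < r" using cq by (simp add: r_def add_nonneg_pos)
  have step: "exp (lam * r powr \<kappa> * real n powr \<kappa>) * (q / 2 / real n) ^ n \<le> I"
    if tl: "q \<le> real n * prob {\<omega> \<in> space M. c \<le> \<bar>\<zeta> \<bullet> X (t / real n) \<omega>\<bar>}" and n: "0 < n" for n
  proof -
    have [measurable]: "random_variable borel (X (t / real n))" using t by (intro random_variable) simp
    let ?P = "\<lambda>\<zeta>. prob {\<omega> \<in> space M. c \<le> \<zeta> \<bullet> X (t / real n) \<omega>}"
    have "prob {\<omega> \<in> space M. c \<le> \<bar>\<zeta> \<bullet> X (t / real n) \<omega>\<bar>} \<le>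
        prob ({\<omega> \<in> space M. c \<le> \<zeta> \<bullet> X (t / real n) \<omega>} \<union> {\<omega> \<in> space M. c \<le> - \<zeta> \<bullet> X (t / real n) \<omega>})"
      by (intro finite_measure_mono) auto
    also have "\<dots> \<le> ?P \<zeta> + ?P (- \<zeta>)"
      by (intro measure_Un_le) auto
    finally have "prob {\<omega> \<in> space M. c \<le> \<bar>\<zeta> \<bullet> X (t / real n) \<omega>\<bar>} \<le> ?P \<zeta> + ?P (- \<zeta>)" .
    moreover have "q / real n \<le> prob {\<omega> \<in> space M. c \<le> \<bar>\<zeta> \<bullet> X (t / real n) \<omega>\<bar>}"
      using tl n by (simp add: divide_le_eq mult.commute)
    moreover have "q / real n = q / 2 / real n + q / 2 / real n" by simp
    \<comment> \<open>One of the two signs carries at least half of the tail. Which one may change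
      with n, but only the common norm of \<zeta> and - \<zeta> enters below.\<close>
    ultimately have "q / 2 / real n \<le> ?P \<zeta> \<or> q / 2 / real n \<le> ?P (- \<zeta>)" by linarith
    then have "\<exists>\<eta>. norm \<eta> = norm \<zeta> \<and> q / 2 / real n \<le> ?P \<eta>"
      using norm_minus_cancel[of \<zeta>] by blast
    then obtain \<eta> where \<eta>: "norm \<eta> = norm \<zeta>" "q / 2 / real n \<le> ?P \<eta>" by blast
    have "(q / 2 / real n) ^ n \<le> ?P \<eta> ^ n"
      using \<eta> cq by (intro power_mono) auto
    also have "\<dots> \<le> prob {\<omega> \<in> space M. real n * c \<le> \<eta> \<bullet> X t \<omega>}"
      by (rule prob_increments_ge[OF t n])
    also have "\<dots> \<le> prob {\<omega> \<in> space M. real n * r \<le> norm (X t \<omega>)}"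
    proof (rule finite_measure_mono)
      show "{\<omega> \<in> space M. real n * r \<le> norm (X t \<omega>)} \<in> events" by measurable
      have "real n * r \<le> norm x" if "real n * c \<le> \<eta> \<bullet> x" for x :: "real ^ 'd"
      proof -
        have "real n * c \<le> norm \<zeta> * norm x"
          using that norm_cauchy_schwarz[of \<eta> x] \<eta>(1) by simp
        also have "\<dots> \<le> (norm \<zeta> + 1) * norm x" by (intro mult_right_mono) auto
        finally show ?thesis by (simp add: r_def divide_le_eq add_nonneg_pos mult.commute)
      qed
      then show "{\<omega> \<in> space M. real n * c \<le> \<eta> \<bullet> X t \<omega>} \<subseteq> {\<omega> \<in> space M. real n * r \<le> norm (X t \<omega>)}" by auto
    qed
    finally have p: "(q / 2 / real n) ^ n \<le> prob {\<omega> \<in> space M. real n * r \<le> norm (X t \<omega>)}" .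
    let ?E = "exp (lam * r powr \<kappa> * real n powr \<kappa>)" and ?S = "{\<omega> \<in> space M. real n * r \<le> norm (X t \<omega>)}"
    have S: "?S \<in> events" by measurable
    have "ennreal (?E * (q / 2 / real n) ^ n) \<le> ennreal (?E * prob ?S)"
      using p by (intro ennreal_leI mult_left_mono) auto
    also have "\<dots> = (\<integral>\<^sup>+\<omega>. ennreal ?E * indicator ?S \<omega> \<partial>M)"
      using S by (simp add: nn_integral_cmult_indicator ennreal_mult' emeasure_eq_measure)
    also have "\<dots> \<le> (\<integral>\<^sup>+\<omega>. ennreal (powexp lam \<kappa> (X t \<omega>)) \<partial>M)"
    proof (rule nn_integral_mono)
      fix \<omega> assume "\<omega> \<in> space M"
      have "?E \<le> powexp lam \<kappa> (X t \<omega>)" if "real n * r \<le> norm (X t \<omega>)"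
      proof -
        have "(real n * r) powr \<kappa> \<le> norm (X t \<omega>) powr \<kappa>"
          using that r \<kappa> by (intro powr_mono2) auto
        then have "lam * (real n * r) powr \<kappa> \<le> lam * norm (X t \<omega>) powr \<kappa>"
          using lam by simp
        moreover have "(real n * r) powr \<kappa> = r powr \<kappa> * real n powr \<kappa>"
          using r by (simp add: powr_mult)
        ultimately show ?thesis by (simp add: powexp_def)
      qed
      then show "ennreal ?E * indicator ?S \<omega> \<le> ennreal (powexp lam \<kappa> (X t \<omega>))"
        by (auto simp: indicator_def intro!: ennreal_leI)
    qed
    finally show ?thesis using I by (simp add: ennreal_le_iff)
  qed
  have "\<forall>\<^sub>F n in sequentially. exp (lam * r powr \<kappa> * real n powr \<kappa>) * (q / 2 / real n) ^ n \<le> I"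
    using tail eventually_gt_at_top[of 0] by eventually_elim (rule step)
  moreover have "\<forall>\<^sub>F n in sequentially. I < exp (lam * r powr \<kappa> * real n powr \<kappa>) * (q / 2 / real n) ^ n"
    using lam r \<kappa> cq
    by (intro filterlim_at_top_dense[THEN iffD1, rule_format] filterlim_powexp_vs_power) auto
  ultimately have "\<forall>\<^sub>F n::nat in sequentially. False" by eventually_elim linarith
  then show False by simp
qed

section \<open>Exponential moments of Levy processes\<close>

lemma (in levy_measure) integrable_iff_nn_integral_finite:
  fixes f :: "'a \<Rightarrow> real"
  assumes [measurable]: "f \<in> borel_measurable borel" "A \<in> sets borel" and f: "\<And>y. y \<in> A \<Longrightarrow> 0 \<le> f y"
    and finite: "(\<integral>\<^sup>+y\<in>A. ennreal (f y) \<partial>\<nu>) < \<infinity>"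
  shows "integrable \<nu> (\<lambda>y. indicator A y * f y)"
proof (rule integrableI_nonneg)
  have "(\<integral>\<^sup>+y. ennreal (indicator A y * f y) \<partial>\<nu>) = (\<integral>\<^sup>+y\<in>A. ennreal (f y) \<partial>\<nu>)"
    by (intro nn_integral_cong) (auto simp: indicator_def)
  then show "(\<integral>\<^sup>+y. ennreal (indicator A y * f y) \<partial>\<nu>) < \<infinity>" using finite by simp
qed (auto simp: indicator_def f)

text \<open>Inside the unit ball exp u - 1 \<le> u exp u with u \<le> lam bounds the excess by a
  multiple of |y|^kappa; outside, the weight itself dominates.\<close>

lemma (in levy_measure) integrable_powexp_minus_one:
  assumes k: "0 < \<kappa>" "\<kappa> \<le> 1" "0 < lam"
    and large: "integrable \<nu> (\<lambda>y. indicator {y. 1 \<le> norm y} y * powexp lam \<kappa> y)"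
    and small: "integrable \<nu> (\<lambda>y. indicator {y. 0 < norm y \<and> norm y < 1} y * norm y powr \<kappa>)"
  shows "integrable \<nu> (\<lambda>y. powexp lam \<kappa> y - 1)"
proof (rule Bochner_Integration.integrable_bound)
  let ?b = "\<lambda>y. indicator {y. 1 \<le> norm y} y * powexp lam \<kappa> y +
      lam * exp lam * (indicator {y. 0 < norm y \<and> norm y < 1} y * norm y powr \<kappa>)"
  show "integrable \<nu> ?b"
    by (intro Bochner_Integration.integrable_add integrable_mult_right large small)
  show "AE y in \<nu>. norm (powexp lam \<kappa> y - 1) \<le> norm (?b y)"
  proof (rule AE_I2)
    fix y :: 'a
    have "1 \<le> powexp lam \<kappa> y" using k by (simp add: powexp_def)
    then have eq: "norm (powexp lam \<kappa> y - 1) = powexp lam \<kappa> y - 1" by simp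
    have "powexp lam \<kappa> y - 1 \<le> ?b y"
    proof (cases "norm y < 1")
      case True
      have "norm y powr \<kappa> \<le> 1" using True k by (intro powr_le1) auto
      then have le: "lam * norm y powr \<kappa> \<le> lam" using k by simp
      have "powexp lam \<kappa> y - 1 \<le> lam * norm y powr \<kappa> * powexp lam \<kappa> y"
        unfolding powexp_def by (rule exp_minus_one_le)
      also have "\<dots> \<le> lam * norm y powr \<kappa> * exp lam"
        unfolding powexp_def using le k by (intro mult_left_mono) auto
      also have "\<dots> = ?b y" using True by (cases "y = 0") auto
      finally show ?thesis .
    next
      case False
      then show ?thesis by simp
    qed
    also have "\<dots> \<le> norm (?b y)" by (simp only: real_norm_def abs_ge_self)
    finally show "norm (powexp lam \<kappa> y - 1) \<le> norm (?b y)" unfolding eq .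
  qed
qed measurable

text \<open>Once the small jumps are integrable, the compensator can be split off the integral and
  becomes a correction of the drift, as in \<open>lhat\<close>.\<close>

lemma (in levy_measure) small_large_exponent_finite_variation:
  assumes id: "integrable \<nu> (\<lambda>y. indicator {y. 0 < norm y \<and> norm y < 1} y *\<^sub>R y)"
    and e: "integrable \<nu> (\<lambda>y. iexp (\<xi> \<bullet> y) - 1)"
  shows "small_exponent \<xi> + large_exponent \<xi> = (CLINT y|\<nu>. iexp (\<xi> \<bullet> y) - 1) -
    \<i> * (\<xi> \<bullet> (LINT y|\<nu>. indicator {y. 0 < norm y \<and> norm y < 1} y *\<^sub>R y))"
proof -
  let ?B = "{y::'a. 0 < norm y \<and> norm y < 1}"
  have "- levy_integrand \<xi> y = (iexp (\<xi> \<bullet> y) - 1) - \<i> * complex_of_real (\<xi> \<bullet> (indicator ?B y *\<^sub>R y))" for y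
    by (auto simp: levy_integrand_def indicator_def)
  then have "- (CLINT y|\<nu>. levy_integrand \<xi> y) =
      (CLINT y|\<nu>. (iexp (\<xi> \<bullet> y) - 1) - \<i> * complex_of_real (\<xi> \<bullet> (indicator ?B y *\<^sub>R y)))"
    by (subst integral_minus[symmetric]) simp
  also have "\<dots> = (CLINT y|\<nu>. iexp (\<xi> \<bullet> y) - 1) - (CLINT y|\<nu>. \<i> * complex_of_real (\<xi> \<bullet> (indicator ?B y *\<^sub>R y)))"
    using id by (intro Bochner_Integration.integral_diff e integrable_mult_right integrable_of_real integrable_inner_right)
  also have "(CLINT y|\<nu>. \<i> * complex_of_real (\<xi> \<bullet> (indicator ?B y *\<^sub>R y))) =
      \<i> * (\<xi> \<bullet> (LINT y|\<nu>. indicator ?B y *\<^sub>R y))"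
    using id by (simp only: integral_mult_right_zero integral_complex_of_real integral_inner_right)
  finally show ?thesis by (simp add: integral_levy_integrand add.commute)
qed

lemma levy_measure_of_is_levy_measure:
  assumes "is_levy_measure \<nu>"
  shows "levy_measure \<nu>"
proof
  show "sets \<nu> = sets borel" using assms by (simp add: is_levy_measure_def)
  have "(\<integral>\<^sup>+y. ennreal (min 1 ((norm y)\<^sup>2)) \<partial>\<nu>) = (\<integral>\<^sup>+y\<in>{y. y \<noteq> 0}. ennreal (min 1 ((norm y)\<^sup>2)) \<partial>\<nu>)"
    by (intro nn_integral_cong) (auto simp: indicator_def)
  then show "(\<integral>\<^sup>+y. ennreal (min 1 ((norm y)\<^sup>2)) \<partial>\<nu>) < \<infinity>"
    using assms by (simp add: is_levy_measure_def)
qed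

lemma levy_khintchine_eq:
  "levy_khintchine l Q \<nu> \<xi> = - \<i> * (l \<bullet> \<xi>) + complex_of_real (1 / 2 * (\<xi> \<bullet> (Q *v \<xi>))) +
    (CLINT y|\<nu>. levy_integrand \<xi> y)"
proof -
  have "indicator {y. y \<noteq> 0} y *\<^sub>R (1 - iexp (\<xi> \<bullet> y) +
      \<i> * complex_of_real (\<xi> \<bullet> y * indicator {0<..<1} (norm y))) = levy_integrand \<xi> y" for y
    by (cases "y = 0") (auto simp: levy_integrand_def)
  then show ?thesis unfolding levy_khintchine_def set_lebesgue_integral_def by simp
qed

theorem theorem3p3:
  fixes M :: "'w measure"
    and X :: "real \<Rightarrow> 'w \<Rightarrow> real ^ 'd"
    and l :: "real ^ 'd"
    and Q :: "real ^ 'd ^ 'd"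
    and \<nu> :: "(real ^ 'd) measure"
    and \<psi> :: "real ^ 'd \<Rightarrow> complex"
  assumes "levy_process M X"
    and "is_levy_triplet l Q \<nu>"
    and "is_characteristic_exponent M X \<psi>"
    and "\<And>\<xi>. \<psi> \<xi> = levy_khintchine l Q \<nu> \<xi>"
  shows
    "(\<forall>(\<kappa> :: real) (lam :: real).
        Q = 0 \<longrightarrow> 0 < \<kappa> \<longrightarrow> \<kappa> \<le> 1 \<longrightarrow> 0 < lam \<longrightarrow>
        (\<integral>\<^sup>+y\<in>{y. 1 \<le> norm y}. ennreal (exp (lam * norm y powr \<kappa>)) \<partial>\<nu>) < \<infinity> \<longrightarrow>
        (\<exists>C>0. \<forall>t\<ge>0.
           (\<integral>\<^sup>+\<omega>. ennreal (exp (lam * norm (X t \<omega>) powr \<kappa>)) \<partial>M)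
             \<le> ennreal (if t < 1 then exp (C * t powr (\<kappa> / 2)) else exp (C * t))))
     \<and>
     (\<forall>(\<kappa> :: real) (lam :: real).
        Q = 0 \<longrightarrow> 0 < \<kappa> \<longrightarrow> \<kappa> \<le> 1 \<longrightarrow> 0 < lam \<longrightarrow>
        (\<integral>\<^sup>+y\<in>{y. 1 \<le> norm y}. ennreal (exp (lam * norm y powr \<kappa>)) \<partial>\<nu>) < \<infinity> \<longrightarrow>
        (\<integral>\<^sup>+y\<in>{y. 0 < norm y \<and> norm y < 1}. ennreal (norm y powr \<kappa>) \<partial>\<nu>) < \<infinity> \<longrightarrow>
        (let lhat = l - (LINT y:{y. 0 < norm y \<and> norm y < 1}|\<nu>. y);
             K = (LINT y:{y. y \<noteq> 0}|\<nu>. exp (lam * norm y powr \<kappa>) - 1)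
         in \<forall>t>0.
              (\<integral>\<^sup>+\<omega>. ennreal (exp (lam * norm (X t \<omega>) powr \<kappa>)) \<partial>M)
                \<le> ennreal (exp (lam * norm lhat powr \<kappa> * t powr \<kappa> + K * t))))
     \<and>
     (\<forall>\<kappa> :: real.
        \<nu> \<noteq> null_measure borel \<longrightarrow> 1 < \<kappa> \<longrightarrow>
        (\<forall>lam>0. \<forall>t>0.
           (\<integral>\<^sup>+\<omega>. ennreal (exp (lam * norm (X t \<omega>) powr \<kappa>)) \<partial>M) = \<infinity>))
     \<and>
     ((\<forall>\<xi>. \<psi> \<xi> \<in> \<real>) \<longrightarrow>
        (\<forall>lam>0. \<forall>t>0. \<forall>\<kappa>>0.
           (\<integral>\<^sup>+\<omega>. (if X t \<omega> = 0 then \<infinity>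
                 else ennreal (exp (lam * norm (X t \<omega>) powr (- \<kappa>)))) \<partial>M) = \<infinity>))"
proof -
  interpret levy_process M X by fact
  have lm: "is_levy_measure \<nu>" using assms(2) by (simp add: is_levy_triplet_def)
  interpret levy_measure \<nu> by (rule levy_measure_of_is_levy_measure[OF lm])
  have zero: "emeasure \<nu> {0} = 0" using lm by (simp add: is_levy_measure_def)
  define \<mu> where "\<mu> t = distr M borel (X t)" for t
  have \<mu>: "borel_prob (\<mu> t)" if "0 \<le> t" for t
    unfolding \<mu>_def using random_variable[OF that]
    by (intro borel_prob.intro prob_space_distr borel_prob_axioms.intro) auto
  have nn_\<mu>: "(\<integral>\<^sup>+x. f x \<partial>\<mu> t) = (\<integral>\<^sup>+\<omega>. f (X t \<omega>) \<partial>M)"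
    if "0 \<le> t" "f \<in> borel_measurable borel" for f t
    unfolding \<mu>_def using random_variable[OF that(1)] that(2) by (intro nn_integral_distr) auto
  have expo: "(CLINT \<omega>|M. iexp (\<xi> \<bullet> X t \<omega>)) = exp (- complex_of_real t * \<psi> \<xi>)" if "0 \<le> t" for t \<xi>
    using assms(3) that by (simp add: is_characteristic_exponent_def)
  have cf: "charfn (\<mu> t) \<xi> = exp (- complex_of_real t * \<psi> \<xi>)" if "0 \<le> t" for t \<xi>
  proof -
    have "charfn (\<mu> t) \<xi> = (CLINT \<omega>|M. iexp (\<xi> \<bullet> X t \<omega>))"
      unfolding charfn_def \<mu>_def using random_variable[OF that] by (intro integral_distr) auto
    then show ?thesis by (simp only: expo[OF that])
  qed
  have \<psi>: "\<psi> \<xi> = - \<i> * (l \<bullet> \<xi>) + complex_of_real (1 / 2 * (\<xi> \<bullet> (Q *v \<xi>))) - (small_exponent \<xi> + large_exponent \<xi>)" for \<xi>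
    unfolding assms(4) levy_khintchine_eq integral_levy_integrand by simp
  have cf0: "charfn (\<mu> t) \<xi> = exp (t * (\<i> * (\<xi> \<bullet> l) + small_exponent \<xi> + large_exponent \<xi>))"
    if "Q = 0" "0 \<le> t" for t \<xi>
    unfolding cf[OF that(2)] \<psi> using that(1) by (simp add: inner_commute algebra_simps)
  have Re_\<psi>: "Re (\<psi> \<xi>) = 1 / 2 * (\<xi> \<bullet> (Q *v \<xi>)) + (LINT y|\<nu>. 1 - cos (\<xi> \<bullet> y))" for \<xi>
    unfolding assms(4) levy_khintchine_eq plus_complex.sel Re_integral_levy_integrand by simp
  have large: "integrable \<nu> (\<lambda>y. indicator {y. 1 \<le> norm y} y * powexp lam \<kappa> y)"
    if "(\<integral>\<^sup>+y\<in>{y. 1 \<le> norm y}. ennreal (exp (lam * norm y powr \<kappa>)) \<partial>\<nu>) < \<infinity>" for lam \<kappa>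
    using that by (intro integrable_iff_nn_integral_finite) (auto simp: powexp_def)

  have a: "\<exists>C>0. \<forall>t\<ge>0. (\<integral>\<^sup>+\<omega>. ennreal (exp (lam * norm (X t \<omega>) powr \<kappa>)) \<partial>M)
      \<le> ennreal (if t < 1 then exp (C * t powr (\<kappa> / 2)) else exp (C * t))"
    if Q: "Q = 0" and k: "0 < \<kappa>" "\<kappa> \<le> 1" "0 < lam"
      and fin: "(\<integral>\<^sup>+y\<in>{y. 1 \<le> norm y}. ennreal (exp (lam * norm y powr \<kappa>)) \<partial>\<nu>) < \<infinity>" for \<kappa> lam
  proof -
    obtain C where C: "0 < C"
      and small: "\<And>t. 0 < t \<Longrightarrow> t < 1 \<Longrightarrow> (\<integral>\<^sup>+x. ennreal (powexp lam \<kappa> x) \<partial>\<mu> t) \<le> ennreal (exp (C * t powr (\<kappa> / 2)))"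
      and big: "\<And>t. 1 \<le> t \<Longrightarrow> (\<integral>\<^sup>+x. ennreal (powexp lam \<kappa> x) \<partial>\<mu> t) \<le> ennreal (exp (C * t))"
      by (rule powexp_bound[OF \<mu> k large[OF fin] cf0[OF Q]]) auto
    show ?thesis
    proof (intro exI[of _ C] conjI allI impI)
      fix t :: real assume t: "0 \<le> t"
      have eq: "(\<integral>\<^sup>+\<omega>. ennreal (exp (lam * norm (X t \<omega>) powr \<kappa>)) \<partial>M) = (\<integral>\<^sup>+x. ennreal (powexp lam \<kappa> x) \<partial>\<mu> t)"
        using t by (subst nn_\<mu>) (auto simp: powexp_def)
      show "(\<integral>\<^sup>+\<omega>. ennreal (exp (lam * norm (X t \<omega>) powr \<kappa>)) \<partial>M)
          \<le> ennreal (if t < 1 then exp (C * t powr (\<kappa> / 2)) else exp (C * t))"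
      \<comment> \<open>\<open>powexp_bound\<close> covers positive times. At time 0 both sides are
        1, since \<open>X 0\<close> vanishes and 0 powr (\<kappa> / 2) = 0.\<close>
      proof (cases "t = 0")
        case True
        have "(\<integral>\<^sup>+\<omega>. ennreal (exp (lam * norm (X 0 \<omega>) powr \<kappa>)) \<partial>M) = (\<integral>\<^sup>+\<omega>. 1 \<partial>M)"
          by (intro nn_integral_cong) (simp add: start_zero)
        then show ?thesis using True by (simp add: emeasure_space_1)
      next
        case False
        then show ?thesis unfolding eq using t small[of t] big[of t] by auto
      qed
    qed (rule C)
  qed

  have b: "let lhat = l - (LINT y:{y. 0 < norm y \<and> norm y < 1}|\<nu>. y);
             K = (LINT y:{y. y \<noteq> 0}|\<nu>. exp (lam * norm y powr \<kappa>) - 1)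
         in \<forall>t>0. (\<integral>\<^sup>+\<omega>. ennreal (exp (lam * norm (X t \<omega>) powr \<kappa>)) \<partial>M)
                \<le> ennreal (exp (lam * norm lhat powr \<kappa> * t powr \<kappa> + K * t))"
    if Q: "Q = 0" and k: "0 < \<kappa>" "\<kappa> \<le> 1" "0 < lam"
      and fin: "(\<integral>\<^sup>+y\<in>{y. 1 \<le> norm y}. ennreal (exp (lam * norm y powr \<kappa>)) \<partial>\<nu>) < \<infinity>"
      and fin': "(\<integral>\<^sup>+y\<in>{y. 0 < norm y \<and> norm y < 1}. ennreal (norm y powr \<kappa>) \<partial>\<nu>) < \<infinity>" for \<kappa> lam
  proof -
    let ?B = "{y :: real ^ 'd. 0 < norm y \<and> norm y < 1}"
    define V where "V = (LINT y:?B|\<nu>. y)"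
    have V: "V = (LINT y|\<nu>. indicator ?B y *\<^sub>R y)" by (simp add: V_def set_lebesgue_integral_def)
    have small: "integrable \<nu> (\<lambda>y. indicator ?B y * norm y powr \<kappa>)"
      using fin' by (intro integrable_iff_nn_integral_finite) auto
    \<comment> \<open>This makes \<open>K\<close> a genuine integral: a Bochner integral that fails
      to exist has the default value 0.\<close>
    have int: "integrable \<nu> (\<lambda>y. powexp lam \<kappa> y - 1)"
      by (rule integrable_powexp_minus_one[OF k large[OF fin] small])
    have K: "(LINT y:{y. y \<noteq> 0}|\<nu>. exp (lam * norm y powr \<kappa>) - 1) = (LINT y|\<nu>. powexp lam \<kappa> y - 1)"
      unfolding set_lebesgue_integral_def powexp_def
      by (intro Bochner_Integration.integral_cong) (auto simp: indicator_def)
    \<comment> \<open>Likewise for the integral in \<open>lhat\<close>: for \<kappa> \<le> 1, |y| is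
      at most |y|^kappa inside the unit ball.\<close>
    have id: "integrable \<nu> (\<lambda>y. indicator ?B y *\<^sub>R y)"
    proof (rule Bochner_Integration.integrable_bound[OF small])
      have "norm y \<le> norm y powr \<kappa>" if "norm y < 1" for y :: "real ^ 'd"
        using powr_mono'[of \<kappa> 1 "norm y"] that k by simp
      then show "AE y in \<nu>. norm (indicator ?B y *\<^sub>R y) \<le> norm (indicator ?B y * norm y powr \<kappa>)"
        by (intro AE_I2) (auto simp: indicator_def)
    qed measurable
    have "(\<integral>\<^sup>+\<omega>. ennreal (exp (lam * norm (X t \<omega>) powr \<kappa>)) \<partial>M)
        \<le> ennreal (exp (lam * norm (l - V) powr \<kappa> * t powr \<kappa> + (LINT y|\<nu>. powexp lam \<kappa> y - 1) * t))"
      if t: "0 < t" for t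
    proof -
      have t0: "0 \<le> t" using t by simp
      have "charfn (\<mu> t) \<xi> = exp (\<i> * (\<xi> \<bullet> (t *\<^sub>R (l - V))) + t * (CLINT y|\<nu>. iexp (\<xi> \<bullet> y) - 1))" for \<xi>
      proof -
        have "small_exponent \<xi> + large_exponent \<xi> = (CLINT y|\<nu>. iexp (\<xi> \<bullet> y) - 1) - \<i> * (\<xi> \<bullet> V)"
          unfolding V by (rule small_large_exponent_finite_variation[OF id integrable_iexp_minus_one[OF k int]])
        then have eq: "\<i> * complex_of_real (\<xi> \<bullet> l) + small_exponent \<xi> + large_exponent \<xi> =
            \<i> * complex_of_real (\<xi> \<bullet> l) + ((CLINT y|\<nu>. iexp (\<xi> \<bullet> y) - 1) - \<i> * complex_of_real (\<xi> \<bullet> V))"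
          by (simp only: add.assoc)
        then show ?thesis
          unfolding cf0[OF Q t0] eq by (simp add: inner_diff_right algebra_simps)
      qed
      from powexp_bound_finite_variation[OF \<mu>[OF t0] t0 k int this]
      have "(\<integral>\<^sup>+x. ennreal (powexp lam \<kappa> x) \<partial>\<mu> t) \<le>
          ennreal (powexp lam \<kappa> (t *\<^sub>R (l - V)) * exp (t * (LINT y|\<nu>. powexp lam \<kappa> y - 1)))" .
      moreover have "(\<integral>\<^sup>+x. ennreal (powexp lam \<kappa> x) \<partial>\<mu> t) = (\<integral>\<^sup>+\<omega>. ennreal (exp (lam * norm (X t \<omega>) powr \<kappa>)) \<partial>M)"
        using t0 by (subst nn_\<mu>) (auto simp: powexp_def)
      moreover have "powexp lam \<kappa> (t *\<^sub>R (l - V)) * exp (t * (LINT y|\<nu>. powexp lam \<kappa> y - 1)) =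
          exp (lam * norm (l - V) powr \<kappa> * t powr \<kappa> + (LINT y|\<nu>. powexp lam \<kappa> y - 1) * t)"
        using t by (simp add: powexp_def[of lam \<kappa> "t *\<^sub>R (l - V)"] powr_mult exp_add mult_ac)
      ultimately show ?thesis by simp
    qed
    then show ?thesis unfolding Let_def K V_def[symmetric] by blast
  qed

  have c: "(\<integral>\<^sup>+\<omega>. ennreal (exp (lam * norm (X t \<omega>) powr \<kappa>)) \<partial>M) = \<infinity>"
    if nz: "\<nu> \<noteq> null_measure borel" and \<kappa>: "1 < \<kappa>" and lam: "0 < lam" and t: "0 < t" for \<kappa> lam t :: real
  proof -
    obtain \<xi> where \<xi>: "0 < (LINT y|\<nu>. (1 - cos (\<xi> \<bullet> y))\<^sup>2)"
      by (rule exists_oscillation[OF zero nz])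
    define Y where "Y n \<omega> = \<xi> \<bullet> X (t / real n) \<omega>" for n \<omega>
    \<comment> \<open>This includes n = 0, where t / 0 = 0 gives the variable
      \<open>X 0\<close>.\<close>
    have tn: "0 \<le> t / real n" for n using t by simp
    have [measurable]: "random_variable borel (X (t / real n))" for n by (rule random_variable[OF tn])
    have Y [measurable]: "random_variable borel (Y n)" for n unfolding Y_def[abs_def] by measurable
    have cos_int: "integrable M (\<lambda>\<omega>. 1 - cos (r * Y n \<omega>))" for n r
      by (rule integrable_const_bound[of _ 2]) (auto simp: abs_le_iff intro!: AE_I2 order_trans[OF _ cos_ge_minus_one])
    have E: "expectation (\<lambda>\<omega>. 1 - cos (r * Y n \<omega>)) = 1 - Re (exp (- (t / real n) * \<psi> (r *\<^sub>R \<xi>)))" for n r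
    proof -
      have i: "integrable M (\<lambda>\<omega>. iexp ((r *\<^sub>R \<xi>) \<bullet> X (t / real n) \<omega>))"
        by (rule integrable_const_bound[of _ 1]) auto
      have "Re (exp (- (t / real n) * \<psi> (r *\<^sub>R \<xi>))) = expectation (\<lambda>\<omega>. Re (iexp ((r *\<^sub>R \<xi>) \<bullet> X (t / real n) \<omega>)))"
        unfolding integral_Re[OF i] expo[OF tn] by simp
      also have "\<dots> = expectation (\<lambda>\<omega>. cos (r * Y n \<omega>))" by (simp add: Y_def Re_exp)
      also have "\<dots> = expectation (\<lambda>\<omega>. 1 - (1 - cos (r * Y n \<omega>)))" by simp
      also have "\<dots> = 1 - expectation (\<lambda>\<omega>. 1 - cos (r * Y n \<omega>))"
        by (subst Bochner_Integration.integral_diff) (auto simp: cos_int prob_space)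
      finally show ?thesis by simp
    qed
    have lim: "(\<lambda>n. real n * expectation (\<lambda>\<omega>. 1 - cos (r * Y n \<omega>))) \<longlonglongrightarrow> t * Re (\<psi> (r *\<^sub>R \<xi>))" for r
      unfolding E by (rule tendsto_one_minus_Re_exp)
    have lim_sq: "(\<lambda>n. real n * expectation (\<lambda>\<omega>. (1 - cos (Y n \<omega>))\<^sup>2)) \<longlonglongrightarrow> t * (LINT y|\<nu>. (1 - cos (\<xi> \<bullet> y))\<^sup>2)"
    proof -
      have "real n * expectation (\<lambda>\<omega>. (1 - cos (Y n \<omega>))\<^sup>2) =
         2 * (real n * expectation (\<lambda>\<omega>. 1 - cos (1 * Y n \<omega>))) - 1 / 2 * (real n * expectation (\<lambda>\<omega>. 1 - cos (2 * Y n \<omega>)))" for n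
      proof -
        have "a = 2 * b - 1 / 2 * d" if "2 * a = 4 * b - d" for a b d :: real
          using that by linarith
        from this[OF one_minus_cos_sq]
        have "(1 - cos u)\<^sup>2 = 2 * (1 - cos (1 * u)) - 1 / 2 * (1 - cos (2 * u))" for u :: real
          unfolding mult_1 .
        then have "expectation (\<lambda>\<omega>. (1 - cos (Y n \<omega>))\<^sup>2) =
            expectation (\<lambda>\<omega>. 2 * (1 - cos (1 * Y n \<omega>)) - 1 / 2 * (1 - cos (2 * Y n \<omega>)))" by (simp only:)
        also have "\<dots> = expectation (\<lambda>\<omega>. 2 * (1 - cos (1 * Y n \<omega>))) - expectation (\<lambda>\<omega>. 1 / 2 * (1 - cos (2 * Y n \<omega>)))"
          by (rule Bochner_Integration.integral_diff[OF integrable_mult_right[OF cos_int] integrable_mult_right[OF cos_int]])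
        finally show ?thesis by (simp only: integral_mult_right_zero) (simp only: right_diff_distrib mult.left_commute)
      qed
      moreover have "(\<lambda>n. 2 * (real n * expectation (\<lambda>\<omega>. 1 - cos (1 * Y n \<omega>))) - 1 / 2 * (real n * expectation (\<lambda>\<omega>. 1 - cos (2 * Y n \<omega>))))
          \<longlonglongrightarrow> 2 * (t * Re (\<psi> (1 *\<^sub>R \<xi>))) - 1 / 2 * (t * Re (\<psi> (2 *\<^sub>R \<xi>)))"
        by (intro tendsto_diff tendsto_mult_left lim)
      moreover have "2 * (t * Re (\<psi> (1 *\<^sub>R \<xi>))) - 1 / 2 * (t * Re (\<psi> (2 *\<^sub>R \<xi>))) = t * (LINT y|\<nu>. (1 - cos (\<xi> \<bullet> y))\<^sup>2)"
      proof -
        \<comment> \<open>With p the quadratic form of Q at \<xi> and p' that at 2 \<xi>, the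
          Gaussian contribution is p - p' / 4 = 0.\<close>
        have lin: "2 * (1 / 2 * p + I) - 1 / 2 * (1 / 2 * p' + I') = L"
          if "p' = 4 * p" "2 * L = 4 * I - I'" for p p' I I' L :: real
          using that by (simp add: field_simps)
        have "(2 *\<^sub>R \<xi>) \<bullet> (Q *v (2 *\<^sub>R \<xi>)) = 4 * (\<xi> \<bullet> (Q *v \<xi>))"
          by (simp add: matrix_vector_mult_scaleR)
        then have "2 * Re (\<psi> (1 *\<^sub>R \<xi>)) - 1 / 2 * Re (\<psi> (2 *\<^sub>R \<xi>)) = (LINT y|\<nu>. (1 - cos (\<xi> \<bullet> y))\<^sup>2)"
          unfolding Re_\<psi> scaleR_one by (rule lin[OF _ integral_one_minus_cos_sq])
        then have "t * (2 * Re (\<psi> (1 *\<^sub>R \<xi>)) - 1 / 2 * Re (\<psi> (2 *\<^sub>R \<xi>))) = t * (LINT y|\<nu>. (1 - cos (\<xi> \<bullet> y))\<^sup>2)"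
          by (simp only:)
        then show ?thesis by (simp add: algebra_simps)
      qed
      ultimately show ?thesis by (simp only:)
    qed
    have pos: "0 < t * (LINT y|\<nu>. (1 - cos (\<xi> \<bullet> y))\<^sup>2)" using t \<xi> by simp
    have lim1: "(\<lambda>n. real n * expectation (\<lambda>\<omega>. 1 - cos (Y n \<omega>))) \<longlonglongrightarrow> t * Re (\<psi> \<xi>)"
      using lim[of 1] by simp
    obtain c q where "0 < c" "0 < q"
      and "\<forall>\<^sub>F n in sequentially. q \<le> real n * prob {\<omega> \<in> space M. c \<le> \<bar>Y n \<omega>\<bar>}"
      by (rule tail_from_cosine_moments[OF Y lim1 lim_sq pos])
    then show ?thesis
      using powexp_moment_infinite[OF t lam \<kappa>, of c q \<xi>] by (simp add: Y_def powexp_def)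
  qed

  have d: "(\<integral>\<^sup>+\<omega>. (if X t \<omega> = 0 then \<infinity> else ennreal (exp (lam * norm (X t \<omega>) powr (- \<kappa>)))) \<partial>M) = \<infinity>"
    if real: "\<forall>\<xi>. \<psi> \<xi> \<in> \<real>" and lam: "0 < lam" and t: "0 < t" and \<kappa>: "0 < \<kappa>" for lam t \<kappa> :: real
  proof -
    have t0: "0 \<le> t" using t by simp
    have "0 \<le> Re (charfn (\<mu> t) \<xi>)" for \<xi>
    proof -
      \<comment> \<open>A real exponent r gives the characteristic function the value exp (- t r),
        which is positive whatever the sign of r.\<close>
      obtain r where "\<psi> \<xi> = complex_of_real r" using real by (metis Reals_cases)
      then show ?thesis unfolding cf[OF t0] by (simp add: Re_exp)
    qed
    from borel_prob.negative_powexp_moment_infinite[OF \<mu>[OF t0] this lam \<kappa>]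
    show ?thesis by (subst (asm) nn_\<mu>[OF t0]) auto
  qed

  show ?thesis
    by (intro conjI allI impI) (rule a b c d; assumption)+
qed

end
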